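(* Let $A$ be a semiprime approximately unital operator algebra. The following are equivalent: (i) Every minimal right ideal of $A$ has a left cai (or equivalently, equals $pA$ for a projection $p\in A$). (ii) Every algebraically minimal idempotent in $A$ has range projection in $A$. If either of these hold, and if $A$ has dense socle, then $A$ is completely isometrically isomorphic to an annihilator $C^*$-algebra.
   Context: An operator algebra is a norm closed subalgebra of $B(H)$ for a Hilbert space $H$. It is approximately unital if it has a contractive two-sided approximate identity. $A$ is semiprime if $J^2=(0)$ implies $J=(0)$ for closed two-sided ideals $J$. A left cai of a right ideal $J$ is a net $(e_t)$ of contractions in $J$ with $e_tx\to x$ for all $x\in J$. Projections are orthogonal projections. An idempotent $e\in A$ is algebraically minimal if $eAe=\mathbb{C}e$; in a semiprime Banach algebra the minimal right ideals are closed and are exactly the $eA$ for nonzero algebraically minimal idempotents $e$. The range projection of an idempotent $e$ is the orthogonal projection onto its range in $H$. The socle of a semiprime algebra is the sum of its minimal right ideals (equivalently, of its minimal left ideals). An annihilator $C^*$-algebra is a $c_0$-direct sum of $C^*$-algebras $\mathbb{K}(H_i)$ of compact operators on Hilbert spaces $H_i$. *)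

theory Defs
  imports "HOL-Analysis.Analysis"
begin

class scaleC =
  fixes scaleC :: "complex \<Rightarrow> 'a \<Rightarrow> 'a"  (infixr \<open>*\<^sub>C\<close> 75)

text \<open>
  The library has only real inner product spaces. A complex Hilbert space is rendered here as a
  real one together with a complex scalar multiplication extending the real one and a complex
  inner product, linear in its first argument, whose real part is the given real inner product.
  In particular the norm is the Hilbert space norm: \<open>norm x ^ 2 = Re (cinner x x)\<close>.
\<close>

class complex_hilbert_space = real_inner + banach + scaleC +
  fixes cinner :: "'a \<Rightarrow> 'a \<Rightarrow> complex"
  assumes scaleC_add_right: "c *\<^sub>C (x + y) = c *\<^sub>C x + c *\<^sub>C y"
    and scaleC_add_left: "(c + d) *\<^sub>C x = c *\<^sub>C x + d *\<^sub>C x"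
    and scaleC_scaleC: "c *\<^sub>C d *\<^sub>C x = (c * d) *\<^sub>C x"
    and scaleR_scaleC: "r *\<^sub>R x = complex_of_real r *\<^sub>C x"
    and cinner_commute: "cinner x y = cnj (cinner y x)"
    and cinner_add_left: "cinner (x + y) z = cinner x z + cinner y z"
    and cinner_scaleC_left: "cinner (c *\<^sub>C x) y = c * cinner x y"
    and inner_eq_Re_cinner: "inner x y = Re (cinner x y)"

instantiation complex :: complex_hilbert_space
begin

definition "scaleC_complex (c :: complex) (x :: complex) = c * x"

definition "cinner_complex (x :: complex) (y :: complex) = x * cnj y"

instance
  by standard
    (auto simp: scaleC_complex_def cinner_complex_def inner_complex_def complex_eq_iff algebra_simps)

end

lemma cinner_scaleC_right:
  "cinner x (c *\<^sub>C y) = cnj c * cinner x (y :: 'a :: complex_hilbert_space)"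
  by (metis cinner_commute cinner_scaleC_left complex_cnj_mult)

lemma norm_scaleC: "norm (c *\<^sub>C (x :: 'a :: complex_hilbert_space)) = cmod c * norm x"
proof -
  have "Im (cinner x x) = 0"
    using cinner_commute[of x x] by (metis Im_complex_of_real Reals_cnj_iff complex_is_Real_iff)
  then have "inner (c *\<^sub>C x) (c *\<^sub>C x) = (cmod c)\<^sup>2 * inner x x"
    by (simp add: inner_eq_Re_cinner cinner_scaleC_left cinner_scaleC_right cmod_def
        power2_eq_square algebra_simps)
  then show ?thesis
    by (simp add: norm_eq_sqrt_inner real_sqrt_mult)
qed

lemma bounded_linear_scaleC: "bounded_linear ((*\<^sub>C) c :: 'a :: complex_hilbert_space \<Rightarrow> 'a)"
proof (rule bounded_linear_intro[where K = "cmod c"])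
  show "c *\<^sub>C (r *\<^sub>R x) = r *\<^sub>R (c *\<^sub>C x)" for r and x :: 'a
    by (simp add: scaleR_scaleC scaleC_scaleC mult.commute)
qed (simp_all add: scaleC_add_right norm_scaleC mult.commute)

definition csubspace :: "'a :: {scaleC, ab_group_add} set \<Rightarrow> bool" where
  "csubspace S \<longleftrightarrow> 0 \<in> S \<and> (\<forall>x\<in>S. \<forall>y\<in>S. x + y \<in> S) \<and> (\<forall>c. \<forall>x\<in>S. c *\<^sub>C x \<in> S)"

instantiation blinfun :: (real_normed_vector, complex_hilbert_space) scaleC
begin

lift_definition scaleC_blinfun :: "complex \<Rightarrow> 'a \<Rightarrow>\<^sub>L 'b \<Rightarrow> 'a \<Rightarrow>\<^sub>L 'b" is "\<lambda>c T x. c *\<^sub>C T x"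
  by (rule bounded_linear_compose[OF bounded_linear_scaleC])

instance ..

end

type_synonym 'h op = "'h \<Rightarrow>\<^sub>L 'h"

text \<open>The type \<open>'h op\<close> consists of the real-linear bounded operators; \<open>B(H)\<close> is the following subset.\<close>

definition bounded_operators :: "'h :: complex_hilbert_space op set" where
  "bounded_operators = {T. \<forall>c x. blinfun_apply T (c *\<^sub>C x) = c *\<^sub>C blinfun_apply T x}"

definition is_projection :: "'h :: complex_hilbert_space op \<Rightarrow> bool" where
  "is_projection p \<longleftrightarrow> p \<in> bounded_operators \<and> p o\<^sub>L p = p \<and>
     (\<forall>x y. cinner (blinfun_apply p x) y = cinner x (blinfun_apply p y))"

definition is_range_projection :: "'h :: complex_hilbert_space op \<Rightarrow> 'h op \<Rightarrow> bool" where
  "is_range_projection p e \<longleftrightarrow>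
     is_projection p \<and> range (blinfun_apply p) = range (blinfun_apply e)"

definition compact_operator :: "'h :: complex_hilbert_space op \<Rightarrow> bool" where
  "compact_operator T \<longleftrightarrow> T \<in> bounded_operators \<and> compact (closure (blinfun_apply T ` cball 0 1))"

text \<open>
  The norm of an \<open>n \<times> n\<close> matrix of operators, as an operator on the \<open>n\<close>-fold Hilbert space
  direct sum of \<open>H\<close>. Only the entries with indices below \<open>n\<close> matter.
\<close>

definition matrix_norm :: "nat \<Rightarrow> (nat \<Rightarrow> nat \<Rightarrow> 'h :: complex_hilbert_space op) \<Rightarrow> real" where
  "matrix_norm n T =
     Sup {sqrt (\<Sum>i<n. (norm (\<Sum>j<n. blinfun_apply (T i j) (x j)))\<^sup>2) | x. (\<Sum>j<n. (norm (x j))\<^sup>2) \<le> 1}"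

definition operator_algebra :: "'h :: complex_hilbert_space op set \<Rightarrow> bool" where
  "operator_algebra A \<longleftrightarrow> A \<subseteq> bounded_operators \<and> closed A \<and> csubspace A \<and>
     (\<forall>a\<in>A. \<forall>b\<in>A. a o\<^sub>L b \<in> A)"

definition right_ideal :: "'h :: complex_hilbert_space op set \<Rightarrow> 'h op set \<Rightarrow> bool" where
  "right_ideal A J \<longleftrightarrow> J \<subseteq> A \<and> csubspace J \<and> (\<forall>x\<in>J. \<forall>a\<in>A. x o\<^sub>L a \<in> J)"

definition two_sided_ideal :: "'h :: complex_hilbert_space op set \<Rightarrow> 'h op set \<Rightarrow> bool" where
  "two_sided_ideal A J \<longleftrightarrow> right_ideal A J \<and> (\<forall>x\<in>J. \<forall>a\<in>A. a o\<^sub>L x \<in> J)"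

definition semiprime :: "'h :: complex_hilbert_space op set \<Rightarrow> bool" where
  "semiprime A \<longleftrightarrow>
     (\<forall>J. two_sided_ideal A J \<and> closed J \<and> (\<forall>x\<in>J. \<forall>y\<in>J. x o\<^sub>L y = 0) \<longrightarrow> J = {0})"

definition minimal_right_ideal :: "'h :: complex_hilbert_space op set \<Rightarrow> 'h op set \<Rightarrow> bool" where
  "minimal_right_ideal A J \<longleftrightarrow> right_ideal A J \<and> J \<noteq> {0} \<and>
     (\<forall>K. right_ideal A K \<and> K \<subseteq> J \<longrightarrow> K = {0} \<or> K = J)"

text \<open>The sum of the minimal right ideals, i.e. all finite sums of elements of such ideals.\<close>

definition socle :: "'h :: complex_hilbert_space op set \<Rightarrow> 'h op set" where
  "socle A = {sum_list xs | xs. set xs \<subseteq> \<Union> {J. minimal_right_ideal A J}}"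

definition algebraically_minimal_idempotent ::
  "'h :: complex_hilbert_space op set \<Rightarrow> 'h op \<Rightarrow> bool" where
  "algebraically_minimal_idempotent A e \<longleftrightarrow>
     e \<in> A \<and> e o\<^sub>L e = e \<and> {e o\<^sub>L a o\<^sub>L e | a. a \<in> A} = range (\<lambda>c. c *\<^sub>C e)"

text \<open>
  Nets are families with a proper filter on the index type, in the library's manner. Every net of
  operators can be reindexed by the operators themselves (take the image filter), so
  existence of a net with prescribed limits loses nothing by fixing that index type.
\<close>

definition is_left_cai ::
  "'t filter \<Rightarrow> ('t \<Rightarrow> 'h :: complex_hilbert_space op) \<Rightarrow> 'h op set \<Rightarrow> bool" where
  "is_left_cai F e J \<longleftrightarrow> F \<noteq> bot \<and> (\<forall>\<^sub>F t in F. e t \<in> J \<and> norm (e t) \<le> 1) \<and>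
     (\<forall>x\<in>J. ((\<lambda>t. e t o\<^sub>L x) \<longlongrightarrow> x) F)"

definition has_left_cai :: "'h :: complex_hilbert_space op set \<Rightarrow> bool" where
  "has_left_cai J \<longleftrightarrow> (\<exists>(F :: 'h op filter) e. is_left_cai F e J)"

definition approximately_unital :: "'h :: complex_hilbert_space op set \<Rightarrow> bool" where
  "approximately_unital A \<longleftrightarrow>
     (\<exists>(F :: 'h op filter) e. is_left_cai F e A \<and> (\<forall>x\<in>A. ((\<lambda>t. x o\<^sub>L e t) \<longlongrightarrow> x) F))"

text \<open>
  Hilbert spaces \<open>H\<^sub>i\<close> are given as closed subspaces of an ambient Hilbert space type. An operator on
  the closed subspace \<open>M\<close> is identified with its extension by zero on the orthogonal complement
  of \<open>M\<close>; this preserves compactness, the algebra structure and all matrix norms.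
\<close>

definition compact_operators_on :: "'k :: complex_hilbert_space set \<Rightarrow> 'k op set" where
  "compact_operators_on M =
     {T. compact_operator T \<and> range (blinfun_apply T) \<subseteq> M \<and>
         (\<forall>x. (\<forall>y\<in>M. cinner x y = 0) \<longrightarrow> blinfun_apply T x = 0)}"

text \<open>
  The \<open>c\<^sub>0\<close>-direct sum of the \<open>\<bbbK>(H\<^sub>i)\<close>, \<open>i \<in> I\<close>, with pointwise operations and the supremum norm.
  Its elements are extended by \<open>0\<close> outside \<open>I\<close>; the subspaces \<open>H\<^sub>i\<close> are not assumed to be
  orthogonal to each other.
\<close>

definition c0_sum_compacts :: "'i set \<Rightarrow> ('i \<Rightarrow> 'k :: complex_hilbert_space set) \<Rightarrow> ('i \<Rightarrow> 'k op) set" where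
  "c0_sum_compacts I H =
     {f. (\<forall>i\<in>I. f i \<in> compact_operators_on (H i)) \<and> (\<forall>i. i \<notin> I \<longrightarrow> f i = 0) \<and>
         (\<forall>\<epsilon>>0. finite {i \<in> I. norm (f i) \<ge> \<epsilon>})}"

text \<open>The \<open>0\<close> is inserted only to cover the case of an empty index set.\<close>

definition c0_matrix_norm ::
  "'i set \<Rightarrow> nat \<Rightarrow> (nat \<Rightarrow> nat \<Rightarrow> 'i \<Rightarrow> 'k :: complex_hilbert_space op) \<Rightarrow> real" where
  "c0_matrix_norm I n f = Sup (insert 0 ((\<lambda>i. matrix_norm n (\<lambda>j k. f j k i)) ` I))"

definition completely_isometric_isomorphism_c0 ::
  "'h :: complex_hilbert_space op set \<Rightarrow> 'i set \<Rightarrow> ('i \<Rightarrow> 'k :: complex_hilbert_space set) \<Rightarrow>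
   ('h op \<Rightarrow> 'i \<Rightarrow> 'k op) \<Rightarrow> bool" where
  "completely_isometric_isomorphism_c0 A I H \<phi> \<longleftrightarrow>
     bij_betw \<phi> A (c0_sum_compacts I H) \<and>
     (\<forall>a\<in>A. \<forall>b\<in>A. \<phi> (a + b) = (\<lambda>i. \<phi> a i + \<phi> b i)) \<and>
     (\<forall>c. \<forall>a\<in>A. \<phi> (c *\<^sub>C a) = (\<lambda>i. c *\<^sub>C \<phi> a i)) \<and>
     (\<forall>a\<in>A. \<forall>b\<in>A. \<phi> (a o\<^sub>L b) = (\<lambda>i. \<phi> a i o\<^sub>L \<phi> b i)) \<and>
     (\<forall>n a. (\<forall>j<n. \<forall>k<n. a j k \<in> A) \<longrightarrow>
        c0_matrix_norm I n (\<lambda>j k. \<phi> (a j k)) = matrix_norm n a)"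

text \<open>
  One cannot quantify existentially over types, so the index set and the Hilbert spaces are taken
  inside the Hilbert space on which \<open>A\<close> acts. This is no restriction: if \<open>A\<close> is
  completely isometrically isomorphic to a \<open>c\<^sub>0\<close>-sum of \<open>\<bbbK>(H\<^sub>i)\<close> with all \<open>H\<^sub>i\<close> nonzero, then the
  isomorphism is a faithful *-representation on \<open>H\<close>, which contains a copy of each \<open>H\<^sub>i\<close> (the cyclic
  subspace of a unit vector in the range of a minimal projection), and these copies are orthogonal.
\<close>

definition completely_isometric_to_annihilator_Cstar_algebra ::
  "'h :: complex_hilbert_space op set \<Rightarrow> bool" where
  "completely_isometric_to_annihilator_Cstar_algebra A \<longleftrightarrow>
     (\<exists>(I :: 'h set) (H :: 'h \<Rightarrow> 'h set) \<phi>.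
        (\<forall>i\<in>I. csubspace (H i) \<and> closed (H i)) \<and> completely_isometric_isomorphism_c0 A I H \<phi>)"

end

theory Submission
  imports Defs "HOL-Complex_Analysis.Cauchy_Integral_Formula"
begin

text \<open>
  A minimal right ideal is \<open>e A\<close> for an idempotent \<open>e\<close> with \<open>e A e = \<complex> e\<close> (Gelfand--Mazur). Elements \<open>f\<close>
  of a left cai of \<open>e A\<close> satisfy \<open>f e = c e\<close> with \<open>c \<rightarrow> 1\<close>; being contractions that almost fix the range
  of \<open>e\<close>, they converge in norm to the range projection of \<open>e\<close>.

  Suppose that range projections of minimal idempotents lie in \<open>A\<close>, and let \<open>q\<close> be a minimal projection.
  Perturbing \<open>q\<close> to the minimal idempotents \<open>q + (1 - q) a q\<close> shows \<open>(A q)\<^sup>* \<subseteq> A\<close>. For a unit vector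
  \<open>\<xi>\<close> with \<open>q \<xi> = \<xi>\<close> one has \<open>q a q = \<langle>a \<xi>, \<xi>\<rangle> q\<close>, so \<open>A q\<close> is isometric to the closed subspace \<open>A \<xi>\<close>;
  the Riesz representation theorem there and semiprimeness yield \<open>(q A)\<^sup>* \<subseteq> A\<close>. If the socle is dense, \<open>A\<close> is
  therefore self-adjoint. Choosing one \<open>\<xi>\<close> for each class of minimal projections under the relation
  \<open>p A q \<noteq> 0\<close>, restriction to the subspaces \<open>A \<xi>\<close> is the desired isomorphism. It is completely isometric
  because the socle maps the Hilbert space into an orthogonal sum of copies of these subspaces.
\<close>

section \<open>Complex Hilbert spaces\<close>

text \<open>The obstacle is that \<open>A\<close> is not assumed to be self-adjoint, so adjoints
  have to be manufactured from range projections, and in a forced order: adjoints of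
  \<open>A q\<close> express inner products on \<open>A \<xi>\<close> through corner scalars, this
  makes \<open>A \<xi>\<close> closed, and only then is the Riesz argument for \<open>q A\<close>
  available. A second obstacle is the position of these subspaces in the Hilbert space. One
  \<open>A \<xi>\<close> may occur with any multiplicity, counted by orthonormal vectors in the
  range of the minimal projection, and \<open>A\<close> may act degenerately. Norm estimates are
  therefore made on vectors \<open>s x\<close> with \<open>s\<close> in the socle, which involve
  only finitely many orthonormal vectors and hence only finite Gram--Schmidt; they reach arbitrary
  \<open>x\<close> through the contractive approximate identity, since \<open>T x\<close> is the
  limit of \<open>T e_t x\<close>.\<close>

lemma scaleC_one [simp]: "1 *\<^sub>C (x :: 'h :: complex_hilbert_space) = x"
  using scaleR_scaleC[of 1 x] by simp

lemma scaleC_zero_left [simp]: "0 *\<^sub>C (x :: 'h :: complex_hilbert_space) = 0"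
  using scaleR_scaleC[of 0 x] by simp

lemma scaleC_zero_right [simp]: "c *\<^sub>C (0 :: 'h :: complex_hilbert_space) = 0"
  using scaleC_scaleC[of c 0 0] by simp

lemma scaleC_minus_one: "(-1) *\<^sub>C (x :: 'h :: complex_hilbert_space) = - x"
  using scaleR_scaleC[of "-1" x] by simp

lemma scaleC_minus_left: "(- c) *\<^sub>C (x :: 'h :: complex_hilbert_space) = - (c *\<^sub>C x)"
  using scaleC_scaleC[of "-1" c x] by (simp add: scaleC_minus_one)

lemma scaleC_minus_right: "c *\<^sub>C (- x :: 'h :: complex_hilbert_space) = - (c *\<^sub>C x)"
  using scaleC_scaleC[of c "-1" x] by (simp add: scaleC_minus_one scaleC_minus_left)

lemma scaleC_diff_right: "c *\<^sub>C (x - y :: 'h :: complex_hilbert_space) = c *\<^sub>C x - c *\<^sub>C y"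
  using scaleC_add_right[of c x "- y"] by (simp add: scaleC_minus_right)

lemma scaleC_diff_left: "(c - d) *\<^sub>C (x :: 'h :: complex_hilbert_space) = c *\<^sub>C x - d *\<^sub>C x"
  using scaleC_add_left[of c "- d" x] by (simp add: scaleC_minus_left)

lemma scaleC_sum_right:
  "c *\<^sub>C (\<Sum>i\<in>F. f i :: 'h :: complex_hilbert_space) = (\<Sum>i\<in>F. c *\<^sub>C f i)"
  by (induction F rule: infinite_finite_induct) (auto simp: scaleC_add_right)

lemma cinner_add_right: "cinner x (y + z) = cinner x y + cinner x (z :: 'h :: complex_hilbert_space)"
  by (metis cinner_add_left cinner_commute complex_cnj_add)

lemma cinner_zero_left [simp]: "cinner 0 (x :: 'h :: complex_hilbert_space) = 0"
  using cinner_scaleC_left[of 0 x x] by simp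

lemma cinner_zero_right [simp]: "cinner (x :: 'h :: complex_hilbert_space) 0 = 0"
  using cinner_scaleC_right[of x 0 x] by simp

lemma cinner_minus_left: "cinner (- x) y = - cinner x (y :: 'h :: complex_hilbert_space)"
  using cinner_scaleC_left[of "-1" x y] by (simp add: scaleC_minus_one)

lemma cinner_minus_right: "cinner x (- y) = - cinner x (y :: 'h :: complex_hilbert_space)"
  using cinner_scaleC_right[of x "-1" y] by (simp add: scaleC_minus_one)

lemma cinner_diff_left: "cinner (x - y) z = cinner x z - cinner y (z :: 'h :: complex_hilbert_space)"
  using cinner_add_left[of x "- y" z] by (simp add: cinner_minus_left)

lemma cinner_diff_right: "cinner x (y - z) = cinner x y - cinner x (z :: 'h :: complex_hilbert_space)"
  using cinner_add_right[of x y "- z"] by (simp add: cinner_minus_right)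

lemma cinner_sum_left:
  "cinner (\<Sum>i\<in>F. f i) (x :: 'h :: complex_hilbert_space) = (\<Sum>i\<in>F. cinner (f i) x)"
  by (induction F rule: infinite_finite_induct) (auto simp: cinner_add_left)

lemma cinner_sum_right:
  "cinner (x :: 'h :: complex_hilbert_space) (\<Sum>i\<in>F. f i) = (\<Sum>i\<in>F. cinner x (f i))"
  by (induction F rule: infinite_finite_induct) (auto simp: cinner_add_right)

lemma cinner_self: "cinner x x = complex_of_real ((norm (x :: 'h :: complex_hilbert_space))\<^sup>2)"
proof -
  have "Im (cinner x x) = 0"
    using cinner_commute[of x x] by (metis Im_complex_of_real Reals_cnj_iff complex_is_Real_iff)
  moreover have "Re (cinner x x) = (norm x)\<^sup>2"
    using inner_eq_Re_cinner[of x x] by (simp add: power2_norm_eq_inner)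
  ultimately show ?thesis
    by (simp add: complex_eq_iff)
qed

lemma cinner_eq_zero_iff [simp]: "cinner x x = 0 \<longleftrightarrow> (x :: 'h :: complex_hilbert_space) = 0"
  by (simp add: cinner_self)

lemma cinner_ext_left:
  assumes "\<And>z. cinner x z = cinner y z"
  shows "x = (y :: 'h :: complex_hilbert_space)"
  using assms[of "x - y"] cinner_diff_left[of x y "x - y"] by simp

lemma cinner_commute_zero:
  "cinner x y = 0 \<Longrightarrow> cinner y (x :: 'h :: complex_hilbert_space) = 0"
  by (metis cinner_commute complex_cnj_zero)

text \<open>A unimodular factor \<open>c\<close> turns \<open>cinner x y\<close> into its modulus,
  so that the real Cauchy--Schwarz inequality applies to \<open>c *\<^sub>C x\<close> and
  \<open>y\<close>.\<close>

lemma cmod_cinner_le: "cmod (cinner x y) \<le> norm x * norm (y :: 'h :: complex_hilbert_space)"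
proof (cases "cinner x y = 0")
  case False
  define z where "z = cinner x y"
  define c where "c = cnj z / complex_of_real (cmod z)"
  have z: "cmod z \<noteq> 0" using False by (simp add: z_def)
  have c: "cmod c = 1" using z by (simp add: c_def norm_divide)
  have "c * z = (z * cnj z) / complex_of_real (cmod z)" by (simp add: c_def)
  also have "z * cnj z = complex_of_real (cmod z) * complex_of_real (cmod z)"
    unfolding complex_norm_square[symmetric] by (simp add: power2_eq_square)
  finally have "c * cinner x y = complex_of_real (cmod (cinner x y))"
    using z by (simp add: z_def)
  then have "cmod (cinner x y) = inner (c *\<^sub>C x) y"
    by (simp add: inner_eq_Re_cinner cinner_scaleC_left)
  also have "\<dots> \<le> norm (c *\<^sub>C x) * norm y"
    by (rule norm_cauchy_schwarz)
  finally show ?thesis by (simp add: norm_scaleC c)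
qed simp

lemma bounded_linear_cinner_left: "bounded_linear (\<lambda>x. cinner x (y :: 'h :: complex_hilbert_space))"
  by (rule bounded_linear_intro[where K = "norm y"])
    (auto simp: cinner_add_left scaleR_scaleC cinner_scaleC_left scaleC_complex_def cmod_cinner_le)

lemma bounded_bilinear_scaleC:
  "bounded_bilinear (\<lambda>c (x :: 'h :: complex_hilbert_space). c *\<^sub>C x)"
proof
  show "\<exists>K. \<forall>a b :: 'h. norm (a *\<^sub>C b) \<le> norm a * norm b * K"
    by (rule exI[of _ 1]) (simp add: norm_scaleC)
qed (auto simp: scaleC_add_left scaleC_add_right scaleR_scaleC scaleC_scaleC scaleC_complex_def mult.commute)

lemma norm_add_orthogonal:
  assumes "cinner x y = 0"
  shows "(norm (x + y :: 'h :: complex_hilbert_space))\<^sup>2 = (norm x)\<^sup>2 + (norm y)\<^sup>2"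
  using assms cinner_commute_zero[OF assms]
  by (simp add: power2_norm_eq_inner inner_eq_Re_cinner cinner_add_left cinner_add_right)

lemma norm_sum_orthogonal:
  fixes f :: "'i \<Rightarrow> 'h :: complex_hilbert_space"
  assumes "finite F" "\<And>i j. i \<in> F \<Longrightarrow> j \<in> F \<Longrightarrow> i \<noteq> j \<Longrightarrow> cinner (f i) (f j) = 0"
  shows "(norm (\<Sum>i\<in>F. f i))\<^sup>2 = (\<Sum>i\<in>F. (norm (f i))\<^sup>2)"
  using assms
proof (induction F)
  case (insert a F)
  have "cinner (f a) (\<Sum>i\<in>F. f i) = 0"
    using insert by (auto simp: cinner_sum_right intro!: sum.neutral)
  then show ?case using insert by (simp add: norm_add_orthogonal)
qed simp

lemma csubspace_imp_subspace: "csubspace (M :: 'h :: complex_hilbert_space set) \<Longrightarrow> subspace M"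
  by (auto simp: csubspace_def subspace_def scaleR_scaleC)

subsection \<open>Orthogonal projections and adjoints\<close>

lemma nearest_point_exists:
  fixes M :: "'h :: {real_inner, banach} set"
  assumes "subspace M" "closed M"
  shows "\<exists>y\<in>M. \<forall>z\<in>M. norm (x - y) \<le> norm (x - z)"
proof -
  define d where "d = (INF z\<in>M. norm (x - z))"
  have ne: "M \<noteq> {}" using assms(1) subspace_0 by auto
  have bdd: "bdd_below ((\<lambda>z. norm (x - z)) ` M)" by (rule bdd_belowI[of _ 0]) auto
  have d: "d \<le> norm (x - z)" if "z \<in> M" for z
    unfolding d_def using bdd that by (rule cINF_lower)
  have d0: "d \<ge> 0" unfolding d_def using ne by (intro cINF_greatest) auto
  have "\<exists>z. z \<in> M \<and> norm (x - z) < d + 1 / real (Suc n)" for n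
  proof -
    have "d < d + 1 / real (Suc n)" by simp
    then show ?thesis
      using cINF_less_iff[OF ne bdd, of "d + 1 / real (Suc n)"] unfolding d_def[symmetric] by blast
  qed
  then have "\<forall>n. \<exists>z. z \<in> M \<and> norm (x - z) < d + 1 / real (Suc n)" by blast
  from choice[OF this] obtain y
    where y: "\<And>n. y n \<in> M" "\<And>n. norm (x - y n) < d + 1 / real (Suc n)" by blast
  have lim: "(\<lambda>n. norm (x - y n)) \<longlonglongrightarrow> d"
  proof (rule tendsto_sandwich[of "\<lambda>n. d" _ _ "\<lambda>n. d + 1 / real (Suc n)"])
    show "(\<lambda>n. d + 1 / real (Suc n)) \<longlonglongrightarrow> d"
      using tendsto_add[OF tendsto_const LIMSEQ_Suc[OF lim_1_over_n], of d] by simp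
    show "\<forall>\<^sub>F n in sequentially. d \<le> norm (x - y n)" using d y(1) by simp
    show "\<forall>\<^sub>F n in sequentially. norm (x - y n) \<le> d + 1 / real (Suc n)"
      using y(2) by (intro always_eventually allI less_imp_le)
  qed simp
  \<comment> \<open>Parallelogram law: the midpoint of two almost nearest points is no nearer than \<open>d\<close>.\<close>
  have par: "(norm (y m - y n))\<^sup>2 \<le> 2 * (norm (x - y m))\<^sup>2 + 2 * (norm (x - y n))\<^sup>2 - 4 * d\<^sup>2" for m n
  proof -
    define w where "w = (1/2) *\<^sub>R (y m + y n)"
    have "w \<in> M" unfolding w_def using y assms(1) by (simp add: subspace_add subspace_scale)
    then have "d\<^sup>2 \<le> (norm (x - w))\<^sup>2" using d d0 by (simp add: power_mono)
    moreover have "4 * (norm (x - w))\<^sup>2 + (norm (y m - y n))\<^sup>2 =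
        2 * (norm (x - y m))\<^sup>2 + 2 * (norm (x - y n))\<^sup>2"
      unfolding w_def power2_norm_eq_inner
      by (simp add: inner_diff_left inner_diff_right inner_add_left inner_add_right inner_commute algebra_simps)
    ultimately show ?thesis by linarith
  qed
  have "Cauchy y"
  proof (rule CauchyI)
    fix e :: real assume "e > 0"
    have "(\<lambda>n. 2 * (norm (x - y n))\<^sup>2 - 2 * d\<^sup>2) \<longlonglongrightarrow> 2 * d\<^sup>2 - 2 * d\<^sup>2"
      by (intro tendsto_intros lim)
    moreover have "2 * d\<^sup>2 - 2 * d\<^sup>2 < e\<^sup>2 / 2" using \<open>e > 0\<close> by simp
    ultimately have "\<forall>\<^sub>F n in sequentially. 2 * (norm (x - y n))\<^sup>2 - 2 * d\<^sup>2 < e\<^sup>2 / 2"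
      by (rule order_tendstoD(2))
    then obtain N where N: "\<And>n. n \<ge> N \<Longrightarrow> 2 * (norm (x - y n))\<^sup>2 - 2 * d\<^sup>2 < e\<^sup>2 / 2"
      unfolding eventually_sequentially by auto
    have "norm (y m - y n) < e" if "m \<ge> N" "n \<ge> N" for m n
    proof -
      have "(norm (y m - y n))\<^sup>2 < e\<^sup>2" using par[of m n] N[OF that(1)] N[OF that(2)] by linarith
      then show ?thesis using \<open>e > 0\<close> by (simp add: power2_less_imp_less)
    qed
    then show "\<exists>N. \<forall>m\<ge>N. \<forall>n\<ge>N. norm (y m - y n) < e" by blast
  qed
  then obtain l where l: "y \<longlonglongrightarrow> l" using Cauchy_convergent_iff convergent_def by blast
  have "l \<in> M" using assms(2) y(1) l closed_sequentially by blast
  have "(\<lambda>n. norm (x - y n)) \<longlonglongrightarrow> norm (x - l)" by (intro tendsto_intros l)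
  then have "norm (x - l) = d" using lim LIMSEQ_unique by blast
  then show ?thesis using \<open>l \<in> M\<close> d by auto
qed

lemma orthogonal_decomposition:
  fixes M :: "'h :: {real_inner, banach} set"
  assumes M: "subspace M" "closed M"
  shows "\<exists>y\<in>M. \<forall>z\<in>M. inner (x - y) z = 0"
proof -
  obtain y where y: "y \<in> M" "\<And>z. z \<in> M \<Longrightarrow> norm (x - y) \<le> norm (x - z)"
    using nearest_point_exists[OF assms] by blast
  have "inner (x - y) z = 0" if z: "z \<in> M" for z
  proof (cases "z = 0")
    case False
    \<comment> \<open>This \<open>t\<close> minimises the quadratic polynomial
      \<open>(norm (x - y - t *\<^sub>R z))\<^sup>2\<close>. As \<open>y\<close> is already nearest,
      the decrease it would bring cannot be positive.\<close>
    define t where "t = inner (x - y) z / inner z z"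
    have "y + t *\<^sub>R z \<in> M" using M(1) y(1) z by (simp add: subspace_add subspace_scale)
    then have "norm (x - y) \<le> norm ((x - y) - t *\<^sub>R z)" using y(2) by (metis diff_diff_eq)
    then have "(norm (x - y))\<^sup>2 \<le> (norm ((x - y) - t *\<^sub>R z))\<^sup>2" by (simp add: power_mono)
    also have "\<dots> = (norm (x - y))\<^sup>2 - 2 * t * inner (x - y) z + t\<^sup>2 * inner z z"
      unfolding power2_norm_eq_inner
      by (simp add: inner_diff_left inner_diff_right inner_commute power2_eq_square algebra_simps)
    also have "\<dots> = (norm (x - y))\<^sup>2 - (inner (x - y) z)\<^sup>2 / inner z z"
      using False unfolding t_def by (simp add: field_simps power2_eq_square)
    finally have "(inner (x - y) z)\<^sup>2 / inner z z \<le> 0" by simp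
    moreover have "inner z z > 0" using False by simp
    ultimately show ?thesis by (simp add: divide_le_0_iff)
  qed simp
  then show ?thesis using y(1) by blast
qed

lemma complex_orthogonal_decomposition:
  fixes M :: "'h :: complex_hilbert_space set"
  assumes M: "csubspace M" "closed M"
  shows "\<exists>y\<in>M. \<forall>z\<in>M. cinner (x - y) z = 0"
proof -
  obtain y where y: "y \<in> M" "\<And>z. z \<in> M \<Longrightarrow> inner (x - y) z = 0"
    using orthogonal_decomposition csubspace_imp_subspace M by blast
  have "cinner (x - y) z = 0" if z: "z \<in> M" for z
  proof -
    \<comment> \<open>Real orthogonality to this multiple of \<open>z\<close> is the vanishing of
      the imaginary part of \<open>cinner (x - y) z\<close>.\<close>
    have "\<i> *\<^sub>C z \<in> M" using M z by (auto simp: csubspace_def)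
    from y(2)[OF this] have "Im (cinner (x - y) z) = 0"
      by (simp add: inner_eq_Re_cinner cinner_scaleC_right)
    moreover have "Re (cinner (x - y) z) = 0" using y(2)[OF z] by (simp add: inner_eq_Re_cinner)
    ultimately show ?thesis by (simp add: complex_eq_iff)
  qed
  then show ?thesis using y(1) by blast
qed

lemma riesz_representation_real:
  fixes g :: "'h :: {real_inner, banach} \<Rightarrow> real"
  assumes g: "bounded_linear g"
  shows "\<exists>w. \<forall>x. g x = inner x w"
proof (cases "\<forall>x. g x = 0")
  case True
  then show ?thesis by (intro exI[of _ 0]) simp
next
  case False
  interpret g: bounded_linear g by (rule g)
  define M where "M = {x. g x = 0}"
  obtain x0 where x0: "g x0 \<noteq> 0" using False by blast
  have "subspace M" unfolding M_def subspace_def by (auto simp: g.add g.scaleR)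
  moreover have "closed M" unfolding M_def
    by (intro closed_Collect_eq continuous_intros g.continuous_on)
  ultimately obtain y where y: "y \<in> M" "\<And>z. z \<in> M \<Longrightarrow> inner (x0 - y) z = 0"
    using orthogonal_decomposition by blast
  define z where "z = x0 - y"
  have gz: "g z \<noteq> 0" using x0 y(1) by (simp add: z_def g.diff M_def)
  then have z0: "inner z z \<noteq> 0" using g.zero by auto
  have "g x = inner x ((g z / inner z z) *\<^sub>R z)" for x
  proof -
    have "x - (g x / g z) *\<^sub>R z \<in> M" using gz by (simp add: M_def g.diff g.scaleR)
    then have "inner z (x - (g x / g z) *\<^sub>R z) = 0" using y(2) z_def by blast
    then have "inner x z = (g x / g z) * inner z z"
      by (simp add: inner_diff_right inner_commute)
    then show ?thesis using gz z0 by (simp add: field_simps)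
  qed
  then show ?thesis by blast
qed

lemma riesz_representation:
  fixes f :: "'h :: complex_hilbert_space \<Rightarrow> complex"
  assumes f: "bounded_linear f" and fC: "\<And>c x. f (c *\<^sub>C x) = c * f x"
  shows "\<exists>w. \<forall>x. f x = cinner x w"
proof -
  have "bounded_linear (\<lambda>x. Re (f x))"
    using bounded_linear_compose[OF bounded_linear_Re f] by simp
  then obtain w where w: "\<And>x. Re (f x) = inner x w"
    using riesz_representation_real by blast
  have "f x = cinner x w" for x
  proof (rule complex_eqI)
    show "Re (f x) = Re (cinner x w)" using w by (simp add: inner_eq_Re_cinner)
    show "Im (f x) = Im (cinner x w)"
      using w[of "\<i> *\<^sub>C x"] by (simp add: fC inner_eq_Re_cinner cinner_scaleC_left)
  qed
  then show ?thesis by blast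
qed

subsection \<open>Bounded operators\<close>

lemma scaleC_op_apply [simp]:
  "blinfun_apply (c *\<^sub>C (T :: 'a :: real_normed_vector \<Rightarrow>\<^sub>L 'h :: complex_hilbert_space)) x = c *\<^sub>C blinfun_apply T x"
  by (simp add: scaleC_blinfun.rep_eq)

lemma scaleC_op_one [simp]: "1 *\<^sub>C (T :: 'h :: complex_hilbert_space op) = T"
  by (rule blinfun_eqI) simp

lemma scaleC_op_zero_left [simp]: "0 *\<^sub>C (T :: 'h :: complex_hilbert_space op) = 0"
  by (rule blinfun_eqI) simp

lemma scaleC_op_zero_right [simp]: "c *\<^sub>C (0 :: 'h :: complex_hilbert_space op) = 0"
  by (rule blinfun_eqI) simp

lemma scaleC_op_scaleC [simp]: "c *\<^sub>C d *\<^sub>C (T :: 'h :: complex_hilbert_space op) = (c * d) *\<^sub>C T"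
  by (rule blinfun_eqI) (simp add: scaleC_scaleC)

lemma scaleC_op_diff_left:
  "(c - d) *\<^sub>C (T :: 'h :: complex_hilbert_space op) = c *\<^sub>C T - d *\<^sub>C T"
  by (rule blinfun_eqI) (simp add: scaleC_diff_left blinfun.diff_left)

lemma scaleC_op_minus_one: "(-1) *\<^sub>C (T :: 'h :: complex_hilbert_space op) = - T"
  by (rule blinfun_eqI) (simp add: scaleC_minus_one blinfun.minus_left)

lemma norm_scaleC_op: "norm (c *\<^sub>C (T :: 'h :: complex_hilbert_space op)) = cmod c * norm T"
proof -
  have le: "norm (c *\<^sub>C T) \<le> cmod c * norm T" for c and T :: "'h op"
  proof (rule norm_blinfun_bound)
    show "norm (blinfun_apply (c *\<^sub>C T) x) \<le> cmod c * norm T * norm x" for x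
      using mult_left_mono[OF norm_blinfun[of T x], of "cmod c"] by (simp add: norm_scaleC mult.assoc)
  qed simp
  show ?thesis
  proof (cases "c = 0")
    case False
    have "norm T \<le> cmod (inverse c) * norm (c *\<^sub>C T)"
      using le[of "inverse c" "c *\<^sub>C T"] False by simp
    then have "cmod c * norm T \<le> norm (c *\<^sub>C T)"
      using False by (simp add: norm_divide field_simps)
    then show ?thesis using le[of c T] by simp
  qed simp
qed

lemma scaleC_compose_left [simp]:
  "(c *\<^sub>C (S :: 'h :: complex_hilbert_space op)) o\<^sub>L T = c *\<^sub>C (S o\<^sub>L T)"
  by (rule blinfun_eqI) simp

lemma bounded_operators_scaleC:
  "T \<in> bounded_operators \<Longrightarrow> blinfun_apply T (c *\<^sub>C x) = c *\<^sub>C blinfun_apply T x"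
  by (simp add: bounded_operators_def)

lemma scaleC_compose_right:
  "S \<in> bounded_operators \<Longrightarrow> S o\<^sub>L (c *\<^sub>C T) = c *\<^sub>C (S o\<^sub>L T)"
  by (rule blinfun_eqI) (simp add: bounded_operators_scaleC)

lemma compose_assoc: "(R o\<^sub>L S) o\<^sub>L T = R o\<^sub>L (S o\<^sub>L T)"
  by (rule blinfun_eqI) simp

lemmas compose_bilinear =
  bounded_bilinear.add_left[OF bounded_bilinear_blinfun_compose]
  bounded_bilinear.add_right[OF bounded_bilinear_blinfun_compose]
  bounded_bilinear.diff_left[OF bounded_bilinear_blinfun_compose]
  bounded_bilinear.diff_right[OF bounded_bilinear_blinfun_compose]

lemmas tendsto_compose_op = bounded_bilinear.tendsto[OF bounded_bilinear_blinfun_compose]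

lemma bounded_operators_compose:
  "S \<in> bounded_operators \<Longrightarrow> T \<in> bounded_operators \<Longrightarrow> S o\<^sub>L T \<in> bounded_operators"
  by (simp add: bounded_operators_def)

lemma bounded_operators_add:
  "S \<in> bounded_operators \<Longrightarrow> T \<in> bounded_operators \<Longrightarrow> S + T \<in> bounded_operators"
  by (simp add: bounded_operators_def blinfun.add_left scaleC_add_right)

lemma bounded_operators_zero: "0 \<in> bounded_operators"
  by (simp add: bounded_operators_def)

text \<open>Riesz represents each functional x |-> <T x, y> by a vector \<open>s y\<close>. Vectors
  are determined by their inner products, so \<open>s\<close> is complex linear; its bound comes
  from |s x|^2 = <T (s x), x>.\<close>

lemma adjoint_exists:
  fixes T :: "'h :: complex_hilbert_space op"
  assumes T: "T \<in> bounded_operators"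
  shows "\<exists>S. S \<in> bounded_operators \<and>
    (\<forall>x y. cinner (blinfun_apply T x) y = cinner x (blinfun_apply S y))"
proof -
  have "\<exists>w. \<forall>x. cinner (blinfun_apply T x) y = cinner x w" for y
  proof (rule riesz_representation)
    show "bounded_linear (\<lambda>x. cinner (blinfun_apply T x) y)"
      using bounded_linear_compose[OF bounded_linear_cinner_left blinfun.bounded_linear_right] .
  qed (simp add: bounded_operators_scaleC[OF T] cinner_scaleC_left)
  then obtain s where s: "\<And>x y. cinner (blinfun_apply T x) y = cinner x (s y)" by metis
  have s': "cinner (s y) x = cinner y (blinfun_apply T x)" for x y
    by (metis s cinner_commute)
  have add: "s (x + y) = s x + s y" for x y
    by (rule cinner_ext_left) (simp add: s' cinner_add_left)
  have C: "s (c *\<^sub>C x) = c *\<^sub>C s x" for c x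
    by (rule cinner_ext_left) (simp add: s' cinner_scaleC_left)
  have "bounded_linear s"
  proof (rule bounded_linear_intro[where K = "norm T"])
    show "s (r *\<^sub>R x) = r *\<^sub>R s x" for r x by (simp add: scaleR_scaleC C)
    show "norm (s x) \<le> norm x * norm T" for x
    proof (cases "s x = 0")
      case False
      have "(norm (s x))\<^sup>2 = cmod (cinner (blinfun_apply T (s x)) x)"
        by (simp add: s cinner_self norm_power)
      also have "\<dots> \<le> norm (blinfun_apply T (s x)) * norm x" by (rule cmod_cinner_le)
      also have "\<dots> \<le> norm T * norm (s x) * norm x"
        by (intro mult_right_mono norm_blinfun) simp
      finally show ?thesis using False by (simp add: power2_eq_square mult.commute)
    qed simp
  qed (rule add)
  then have "blinfun_apply (Blinfun s) = s" by (rule bounded_linear_Blinfun_apply)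
  then show ?thesis
    using s C by (intro exI[of _ "Blinfun s"]) (simp add: bounded_operators_def)
qed

text \<open>The choice is meaningful for complex-linear \<open>T\<close>; this is why the rules for
  \<open>adj\<close> assume membership in \<open>bounded_operators\<close>.\<close>

definition adj :: "'h :: complex_hilbert_space op \<Rightarrow> 'h op" where
  "adj T = (SOME S. S \<in> bounded_operators \<and>
    (\<forall>x y. cinner (blinfun_apply T x) y = cinner x (blinfun_apply S y)))"

lemma
  assumes "T \<in> bounded_operators"
  shows adj_bounded: "adj T \<in> bounded_operators"
    and cinner_adj_right: "cinner x (blinfun_apply (adj T) y) = cinner (blinfun_apply T x) y"
proof -
  have "adj T \<in> bounded_operators \<and>
      (\<forall>x y. cinner (blinfun_apply T x) y = cinner x (blinfun_apply (adj T) y))"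
    unfolding adj_def by (rule someI_ex) (rule adjoint_exists[OF assms])
  then show "adj T \<in> bounded_operators"
    "cinner x (blinfun_apply (adj T) y) = cinner (blinfun_apply T x) y" by simp_all
qed

lemma cinner_adj_left:
  "T \<in> bounded_operators \<Longrightarrow> cinner (blinfun_apply (adj T) x) y = cinner x (blinfun_apply T y)"
  by (metis cinner_adj_right cinner_commute)

lemma adj_unique:
  assumes "T \<in> bounded_operators"
    and "\<And>x y. cinner (blinfun_apply T x) y = cinner x (blinfun_apply S y)"
  shows "adj T = S"
proof (rule blinfun_eqI, rule cinner_ext_left)
  fix x z
  show "cinner (blinfun_apply (adj T) x) z = cinner (blinfun_apply S x) z"
    using assms(2)[of z x] cinner_adj_left[OF assms(1), of x z]
      cinner_commute[of "blinfun_apply S x" z] cinner_commute[of x "blinfun_apply T z"] by simp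
qed

lemma adj_adj: "T \<in> bounded_operators \<Longrightarrow> adj (adj T) = T"
  by (rule adj_unique) (simp_all add: adj_bounded cinner_adj_left)

lemma adj_compose:
  "S \<in> bounded_operators \<Longrightarrow> T \<in> bounded_operators \<Longrightarrow> adj (S o\<^sub>L T) = adj T o\<^sub>L adj S"
  by (rule adj_unique) (simp_all add: bounded_operators_compose cinner_adj_right)

lemma adj_add:
  "S \<in> bounded_operators \<Longrightarrow> T \<in> bounded_operators \<Longrightarrow> adj (S + T) = adj S + adj T"
  by (rule adj_unique)
    (simp_all add: bounded_operators_add cinner_adj_right blinfun.add_left cinner_add_left cinner_add_right)

lemma bounded_operators_scaleC_op: "T \<in> bounded_operators \<Longrightarrow> c *\<^sub>C T \<in> bounded_operators"
  by (simp add: bounded_operators_def scaleC_scaleC mult.commute)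

lemma adj_scaleC: "T \<in> bounded_operators \<Longrightarrow> adj (c *\<^sub>C T) = cnj c *\<^sub>C adj T"
  by (rule adj_unique)
    (simp_all add: bounded_operators_scaleC_op cinner_adj_right cinner_scaleC_left cinner_scaleC_right)

lemma bounded_operators_minus: "T \<in> bounded_operators \<Longrightarrow> - T \<in> bounded_operators"
  by (simp add: bounded_operators_def blinfun.minus_left scaleC_minus_right)

lemma bounded_operators_diff:
  "S \<in> bounded_operators \<Longrightarrow> T \<in> bounded_operators \<Longrightarrow> S - T \<in> bounded_operators"
  using bounded_operators_add[OF _ bounded_operators_minus] by fastforce

lemma adj_diff:
  "S \<in> bounded_operators \<Longrightarrow> T \<in> bounded_operators \<Longrightarrow> adj (S - T) = adj S - adj T"
  by (rule adj_unique)
    (simp_all add: bounded_operators_diff cinner_adj_right blinfun.diff_left cinner_diff_left cinner_diff_right)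

lemma norm_adj_le: "T \<in> bounded_operators \<Longrightarrow> norm (adj T) \<le> norm T"
proof (rule norm_blinfun_bound)
  fix x
  assume T: "T \<in> bounded_operators"
  show "norm (blinfun_apply (adj T) x) \<le> norm T * norm x"
  proof (cases "blinfun_apply (adj T) x = 0")
    case False
    let ?s = "blinfun_apply (adj T) x"
    have "(norm ?s)\<^sup>2 = cmod (cinner (blinfun_apply T ?s) x)"
      by (simp add: cinner_adj_right[OF T, symmetric] cinner_self norm_power)
    also have "\<dots> \<le> norm (blinfun_apply T ?s) * norm x" by (rule cmod_cinner_le)
    also have "\<dots> \<le> norm T * norm ?s * norm x"
      by (intro mult_right_mono norm_blinfun) simp
    finally show ?thesis using False by (simp add: power2_eq_square mult.commute)
  qed simp
qed simp

lemma tendsto_adj: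
  assumes "(f \<longlongrightarrow> T) F" "\<And>t. f t \<in> bounded_operators" "T \<in> bounded_operators"
  shows "((\<lambda>t. adj (f t)) \<longlongrightarrow> adj T) F"
proof (rule LIM_zero_cancel, rule tendsto_0_le[where K = 1])
  show "((\<lambda>t. f t - T) \<longlongrightarrow> 0) F" using assms(1) by (rule LIM_zero)
  show "\<forall>\<^sub>F t in F. norm (adj (f t) - adj T) \<le> norm (f t - T) * 1"
    using norm_adj_le[OF bounded_operators_diff[OF assms(2,3)]] by (simp add: adj_diff assms(2,3))
qed

lemma
  assumes "is_projection p"
  shows projection_bounded: "p \<in> bounded_operators"
    and projection_idem: "p o\<^sub>L p = p"
    and projection_idem_apply: "blinfun_apply p (blinfun_apply p x) = blinfun_apply p x"
    and projection_adj: "adj p = p"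
    and projection_cinner: "cinner (blinfun_apply p x) y = cinner x (blinfun_apply p y)"
proof -
  show "p \<in> bounded_operators" "p o\<^sub>L p = p"
    "cinner (blinfun_apply p x) y = cinner x (blinfun_apply p y)"
    using assms by (auto simp: is_projection_def)
  show "blinfun_apply p (blinfun_apply p x) = blinfun_apply p x"
    by (metis \<open>p o\<^sub>L p = p\<close> blinfun_apply_blinfun_compose)
  show "adj p = p" by (rule adj_unique) (use assms in \<open>auto simp: is_projection_def\<close>)
qed

lemma projection_contractive:
  assumes p: "is_projection p"
  shows "norm (blinfun_apply p x) \<le> norm x" "norm p \<le> 1"
proof -
  show *: "norm (blinfun_apply p x) \<le> norm x" for x
  proof (cases "blinfun_apply p x = 0")
    case False
    have "(norm (blinfun_apply p x))\<^sup>2 = cmod (cinner (blinfun_apply p x) (blinfun_apply p x))"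
      by (simp add: cinner_self norm_power)
    also have "\<dots> = cmod (cinner (blinfun_apply p x) x)"
      by (metis p projection_cinner projection_idem_apply)
    also have "\<dots> \<le> norm (blinfun_apply p x) * norm x" by (rule cmod_cinner_le)
    finally show ?thesis using False by (simp add: power2_eq_square)
  qed simp
  show "norm p \<le> 1" by (rule norm_blinfun_bound) (use * in auto)
qed

lemma projection_onto_exists:
  fixes M :: "'h :: complex_hilbert_space set"
  assumes M: "csubspace M" "closed M"
  shows "\<exists>p. is_projection p \<and> range (blinfun_apply p) = M"
proof -
  obtain f where f: "\<And>x. f x \<in> M" "\<And>x z. z \<in> M \<Longrightarrow> cinner (x - f x) z = 0"
    using complex_orthogonal_decomposition[OF M] by metis
  have sub: "\<And>x y. x \<in> M \<Longrightarrow> y \<in> M \<Longrightarrow> x + y \<in> M" "\<And>x c. x \<in> M \<Longrightarrow> c *\<^sub>C x \<in> M"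
    using M by (auto simp: csubspace_def)
  have diff: "x - y \<in> M" if "x \<in> M" "y \<in> M" for x y
    using sub(1)[OF that(1) sub(2)[OF that(2), of "-1"]] by (simp add: scaleC_minus_one)
  \<comment> \<open>Additivity, homogeneity and idempotence of \<open>f\<close> are all read off
    from this uniqueness.\<close>
  have uniq: "f x = y" if y: "y \<in> M" "\<And>z. z \<in> M \<Longrightarrow> cinner (x - y) z = 0" for x y
  proof -
    have "cinner (f x - y) (f x - y) = cinner (x - y) (f x - y) - cinner (x - f x) (f x - y)"
      by (simp add: cinner_diff_left)
    also have "\<dots> = 0" using f y diff by simp
    finally show ?thesis by simp
  qed
  have add: "f (x + y) = f x + f y" for x y
  proof (rule uniq)
    show "cinner (x + y - (f x + f y)) z = 0" if "z \<in> M" for z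
      using f(2)[OF that, of x] f(2)[OF that, of y] by (simp add: cinner_diff_left cinner_add_left)
  qed (use f sub in auto)
  have C: "f (c *\<^sub>C x) = c *\<^sub>C f x" for c x
  proof (rule uniq)
    show "cinner (c *\<^sub>C x - c *\<^sub>C f x) z = 0" if "z \<in> M" for z
      using f(2)[OF that, of x]
      by (simp only: scaleC_diff_right[symmetric] cinner_scaleC_left mult_zero_right)
  qed (use f sub in auto)
  have id: "f x = x" if "x \<in> M" for x
    by (rule uniq) (use that in auto)
  have "norm (f x) \<le> norm x * 1" for x
  proof -
    have "cinner (f x) (x - f x) = 0" using f cinner_commute_zero by blast
    then have "(norm (f x + (x - f x)))\<^sup>2 = (norm (f x))\<^sup>2 + (norm (x - f x))\<^sup>2"
      by (rule norm_add_orthogonal)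
    then have "(norm (f x))\<^sup>2 \<le> (norm x)\<^sup>2" by simp
    then have "norm (f x) \<le> norm x" by (rule power2_le_imp_le) simp
    then show ?thesis by simp
  qed
  then have "bounded_linear f"
    using add C by (intro bounded_linear_intro[where K = 1]) (simp_all add: scaleR_scaleC)
  then have app: "blinfun_apply (Blinfun f) = f" by (rule bounded_linear_Blinfun_apply)
  have sym: "cinner (f x) y = cinner x (f y)" for x y
  proof -
    have "cinner (f x) (y - f y) = 0" "cinner (x - f x) (f y) = 0"
      using f cinner_commute_zero by blast+
    then show ?thesis by (simp add: cinner_diff_left cinner_diff_right)
  qed
  have "is_projection (Blinfun f)"
    unfolding is_projection_def bounded_operators_def
    by (auto simp: app C sym id f intro!: blinfun_eqI)
  moreover have "range f = M"
  proof
    show "range f \<subseteq> M" using f(1) by blast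
    show "M \<subseteq> range f" by (metis id rangeI subsetI)
  qed
  ultimately show ?thesis using app by metis
qed

definition proj_onto :: "'h :: complex_hilbert_space set \<Rightarrow> 'h op" where
  "proj_onto M = (SOME p. is_projection p \<and> range (blinfun_apply p) = M)"

lemma
  assumes "csubspace M" "closed M"
  shows is_projection_proj_onto: "is_projection (proj_onto M)"
    and range_proj_onto: "range (blinfun_apply (proj_onto M)) = M"
    and proj_onto_in: "blinfun_apply (proj_onto M) x \<in> M"
    and proj_onto_id: "x \<in> M \<Longrightarrow> blinfun_apply (proj_onto M) x = x"
    and proj_onto_orthogonal: "(\<And>y. y \<in> M \<Longrightarrow> cinner x y = 0) \<Longrightarrow> blinfun_apply (proj_onto M) x = 0"
proof -
  have *: "is_projection (proj_onto M) \<and> range (blinfun_apply (proj_onto M)) = M"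
    unfolding proj_onto_def by (rule someI_ex) (rule projection_onto_exists[OF assms])
  then show 1: "is_projection (proj_onto M)" "range (blinfun_apply (proj_onto M)) = M" by auto
  then show 2: "blinfun_apply (proj_onto M) x \<in> M" for x by blast
  show "blinfun_apply (proj_onto M) x = x" if "x \<in> M"
    using that 1 projection_idem_apply[OF 1(1)] by (metis rangeE)
  show "blinfun_apply (proj_onto M) x = 0" if "\<And>y. y \<in> M \<Longrightarrow> cinner x y = 0"
  proof (rule cinner_ext_left)
    fix z
    show "cinner (blinfun_apply (proj_onto M) x) z = cinner 0 z"
      using that[OF 2] projection_cinner[OF 1(1)] by simp
  qed
qed

subsection \<open>Orthonormal sets\<close>

definition orthonormal :: "'h :: complex_hilbert_space set \<Rightarrow> bool" where
  "orthonormal E \<longleftrightarrow> (\<forall>e\<in>E. norm e = 1) \<and> (\<forall>e\<in>E. \<forall>f\<in>E. e \<noteq> f \<longrightarrow> cinner e f = 0)"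

lemma csubspace_sum: "csubspace M \<Longrightarrow> (\<And>i. i \<in> F \<Longrightarrow> f i \<in> M) \<Longrightarrow> sum f F \<in> M"
  by (induction F rule: infinite_finite_induct) (auto simp: csubspace_def)

lemma orthonormal_coefficient:
  assumes "finite E" "orthonormal E" "f \<in> E"
  shows "cinner (\<Sum>e\<in>E. c e *\<^sub>C e) f = c f"
proof -
  have "cinner (\<Sum>e\<in>E. c e *\<^sub>C e) f = (\<Sum>e\<in>E. if e = f then c f else 0)"
    unfolding cinner_sum_left
    using assms(2,3) by (intro sum.cong) (auto simp: orthonormal_def cinner_scaleC_left cinner_self)
  then show ?thesis using assms(1,3) by simp
qed

text \<open>Gram--Schmidt; as the subspaces are orthogonal, each new vector stays in the subspace of the old one.\<close>

lemma orthonormal_expansion: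
  fixes V :: "'h :: complex_hilbert_space set set"
  assumes V: "\<And>M. M \<in> V \<Longrightarrow> csubspace M"
    and orth: "\<And>M M' x y. M \<in> V \<Longrightarrow> M' \<in> V \<Longrightarrow> M \<noteq> M' \<Longrightarrow> x \<in> M \<Longrightarrow> y \<in> M' \<Longrightarrow> cinner x y = 0"
    and N: "finite N" "N \<subseteq> \<Union>V"
  shows "\<exists>E. finite E \<and> E \<subseteq> \<Union>V \<and> orthonormal E \<and> (\<forall>x\<in>N. x = (\<Sum>e\<in>E. cinner x e *\<^sub>C e))"
  using N
proof (induction N)
  case empty
  then show ?case by (intro exI[of _ "{}"]) (simp add: orthonormal_def)
next
  case (insert a N)
  then obtain E where E: "finite E" "E \<subseteq> \<Union>V" "orthonormal E"
      "\<And>x. x \<in> N \<Longrightarrow> x = (\<Sum>e\<in>E. cinner x e *\<^sub>C e)"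
    by auto
  obtain M where M: "M \<in> V" "a \<in> M" using insert.prems by auto
  define b where "b = a - (\<Sum>e\<in>E. cinner a e *\<^sub>C e)"
  have bE: "cinner b e = 0" if "e \<in> E" for e
    using orthonormal_coefficient[OF E(1,3) that, of "cinner a"] by (simp add: b_def cinner_diff_left)
  have "cinner a e *\<^sub>C e \<in> M" if e: "e \<in> E" for e
  proof (cases "e \<in> M")
    case True
    then show ?thesis using V[OF M(1)] by (simp add: csubspace_def)
  next
    case False
    obtain M' where "M' \<in> V" "e \<in> M'" using E(2) e by auto
    then have "cinner a e = 0" using False M orth[of M M' a e] by auto
    then show ?thesis using V[OF M(1)] by (simp add: csubspace_def)
  qed
  then have "(\<Sum>e\<in>E. cinner a e *\<^sub>C e) \<in> M" by (intro csubspace_sum V[OF M(1)]) auto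
  then have "(-1) *\<^sub>C (\<Sum>e\<in>E. cinner a e *\<^sub>C e) \<in> M" using V[OF M(1)] unfolding csubspace_def by blast
  then have "a + (-1) *\<^sub>C (\<Sum>e\<in>E. cinner a e *\<^sub>C e) \<in> M"
    using V[OF M(1)] M(2) unfolding csubspace_def by blast
  then have bM: "b \<in> M" by (simp add: b_def scaleC_minus_one)
  show ?case
  proof (cases "b = 0")
    case True
    then have "a = (\<Sum>e\<in>E. cinner a e *\<^sub>C e)" by (simp add: b_def)
    then show ?thesis using E by (intro exI[of _ E]) auto
  next
    case False
    define f where "f = complex_of_real (1 / norm b) *\<^sub>C b"
    have nf: "norm f = 1" using False by (simp add: f_def norm_scaleC norm_divide)
    have fE: "cinner f e = 0" "cinner e f = 0" if "e \<in> E" for e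
      using bE[OF that] cinner_commute_zero[OF bE[OF that]]
      by (simp_all add: f_def cinner_scaleC_left cinner_scaleC_right)
    have fnE: "f \<notin> E" using fE(1)[of f] nf by (auto simp: cinner_self)
    have fM: "f \<in> M" using V[OF M(1)] bM by (simp add: f_def csubspace_def)
    have "orthonormal (insert f E)"
      using E(3) nf fE by (auto simp: orthonormal_def)
    moreover have "x = (\<Sum>e\<in>insert f E. cinner x e *\<^sub>C e)" if x: "x \<in> insert a N" for x
    proof (cases "x = a")
      case True
      have "cinner (\<Sum>e\<in>E. cinner a e *\<^sub>C e) f = 0"
        by (simp add: cinner_sum_left cinner_scaleC_left fE)
      then have "cinner a f = cinner b f" by (simp add: b_def cinner_diff_left)
      also have "\<dots> = complex_of_real (norm b)"
        using False by (simp add: f_def cinner_scaleC_right cinner_self power2_eq_square)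
      finally have "cinner a f *\<^sub>C f = b" using False by (simp add: f_def scaleC_scaleC)
      then show ?thesis using True E(1) fnE by (simp add: b_def)
    next
      case False
      then have *: "x = (\<Sum>e\<in>E. cinner x e *\<^sub>C e)" using E(4) x by blast
      have "cinner (\<Sum>e\<in>E. cinner x e *\<^sub>C e) f = 0"
        by (simp add: cinner_sum_left cinner_scaleC_left fE)
      then have "cinner x f = 0" using * by simp
      then show ?thesis using * E(1) fnE by simp
    qed
    ultimately show ?thesis
      using E fM M by (intro exI[of _ "insert f E"]) auto
  qed
qed

section \<open>Minimal right ideals\<close>

text \<open>The Gelfand--Mazur argument in the corner with unit \<open>e\<close>: if every
  \<open>b - z e\<close> were invertible, the resolvent \<open>R\<close> would be entire and vanish
  at infinity. Liouville's theorem is applied to the functions <R z x, y>, which keeps holomorphy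
  scalar-valued; all of them vanish, contradicting \<open>b R 0 = e \<noteq> 0\<close>.\<close>

lemma gelfand_mazur_corner:
  fixes e b :: "'h :: complex_hilbert_space op"
  assumes e: "e \<noteq> 0" and b: "b \<in> bounded_operators" "b o\<^sub>L e = b" "e o\<^sub>L b = b"
    and inv: "\<And>z. \<exists>r\<in>bounded_operators. r o\<^sub>L e = r \<and> e o\<^sub>L r = r \<and>
      (b - z *\<^sub>C e) o\<^sub>L r = e \<and> r o\<^sub>L (b - z *\<^sub>C e) = e"
  shows False
proof -
  obtain R where R: "\<And>z. R z \<in> bounded_operators" "\<And>z. R z o\<^sub>L e = R z" "\<And>z. e o\<^sub>L R z = R z"
      "\<And>z. (b - z *\<^sub>C e) o\<^sub>L R z = e" "\<And>z. R z o\<^sub>L (b - z *\<^sub>C e) = e"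
    using inv by metis
  have resolvent: "R w - R z = (w - z) *\<^sub>C (R w o\<^sub>L R z)" for w z
  proof -
    have "R w - R z = (R w o\<^sub>L ((b - z *\<^sub>C e) o\<^sub>L R z)) - ((R w o\<^sub>L (b - w *\<^sub>C e)) o\<^sub>L R z)"
      using R(2)[of w] R(3)[of z] R(4)[of z] R(5)[of w] by simp
    also have "\<dots> = R w o\<^sub>L (((b - z *\<^sub>C e) - (b - w *\<^sub>C e)) o\<^sub>L R z)"
      by (simp only: compose_assoc compose_bilinear)
    also have "(b - z *\<^sub>C e) - (b - w *\<^sub>C e) = (w - z) *\<^sub>C e"
      by (simp add: scaleC_op_diff_left)
    also have "R w o\<^sub>L ((w - z) *\<^sub>C e o\<^sub>L R z) = (w - z) *\<^sub>C (R w o\<^sub>L R z)"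
      by (simp add: R scaleC_compose_right)
    finally show ?thesis .
  qed
  \<comment> \<open>Once \<open>cmod (w - z) * norm (R z) < 1 / 2\<close>, the resolvent identity
    bounds \<open>norm (R w)\<close> by \<open>2 * norm (R z)\<close>; this is the origin of the
    constant \<open>2 * (norm (R z))\<^sup>2\<close>.\<close>
  have cont: "(R \<longlongrightarrow> R z) (at z)" for z
  proof (rule LIM_zero_cancel, rule tendsto_0_le[where K = "2 * (norm (R z))\<^sup>2"])
    show "((\<lambda>w. w - z) \<longlongrightarrow> 0) (at z)" by (intro LIM_zero tendsto_ident_at)
    have "((\<lambda>w. cmod (w - z) * norm (R z)) \<longlongrightarrow> cmod (z - z) * norm (R z)) (at z)"
      by (intro tendsto_intros)
    then have "\<forall>\<^sub>F w in at z. cmod (w - z) * norm (R z) < 1 / 2"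
      by (rule order_tendstoD(2)) simp
    then show "\<forall>\<^sub>F w in at z. norm (R w - R z) \<le> norm (w - z) * (2 * (norm (R z))\<^sup>2)"
    proof eventually_elim
      case (elim w)
      have diff: "norm (R w - R z) \<le> cmod (w - z) * (norm (R w) * norm (R z))"
        unfolding resolvent norm_scaleC_op by (intro mult_left_mono norm_blinfun_compose) simp
      also have "\<dots> = (cmod (w - z) * norm (R z)) * norm (R w)" by (simp add: mult_ac)
      also have "\<dots> \<le> (1 / 2) * norm (R w)"
        using elim by (intro mult_right_mono) auto
      finally have "norm (R w) \<le> 2 * norm (R z)"
        using norm_triangle_ineq2[of "R w" "R z"] by linarith
      then have "cmod (w - z) * (norm (R w) * norm (R z)) \<le> cmod (w - z) * (2 * norm (R z) * norm (R z))"
        by (intro mult_left_mono mult_right_mono) auto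
      then show ?case using diff by (simp add: power2_eq_square mult.assoc)
    qed
  qed
  have zero: "cinner (blinfun_apply (R z) x) y = 0" for z x y
  proof (rule Liouville_weak_0[of "\<lambda>z. cinner (blinfun_apply (R z) x) y"])
    show "(\<lambda>z. cinner (blinfun_apply (R z) x) y) holomorphic_on UNIV"
    proof (rule holomorphic_on_open[THEN iffD2, OF open_UNIV], intro ballI exI)
      fix z
      have q: "(cinner (blinfun_apply (R w) x) y - cinner (blinfun_apply (R z) x) y) / (w - z) =
          cinner (blinfun_apply (R w) (blinfun_apply (R z) x)) y" if "w \<noteq> z" for w
      proof -
        have "cinner (blinfun_apply (R w) x) y - cinner (blinfun_apply (R z) x) y =
            cinner (blinfun_apply (R w - R z) x) y"
          by (simp add: blinfun.diff_left cinner_diff_left)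
        also have "\<dots> = (w - z) * cinner (blinfun_apply (R w) (blinfun_apply (R z) x)) y"
          unfolding resolvent by (simp add: cinner_scaleC_left)
        finally show ?thesis using that by simp
      qed
      have "((\<lambda>w. cinner (blinfun_apply (R w) (blinfun_apply (R z) x)) y) \<longlongrightarrow>
          cinner (blinfun_apply (R z) (blinfun_apply (R z) x)) y) (at z)"
        by (intro bounded_linear.tendsto[OF bounded_linear_cinner_left] blinfun.tendsto cont tendsto_const)
      then show "((\<lambda>w. cinner (blinfun_apply (R w) x) y) has_field_derivative
          cinner (blinfun_apply (R z) (blinfun_apply (R z) x)) y) (at z)"
        unfolding has_field_derivative_iff
        by (rule Lim_transform_eventually) (auto simp: eventually_at_filter q)
    qed
    show "((\<lambda>z. cinner (blinfun_apply (R z) x) y) \<longlongrightarrow> 0) at_infinity"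
    proof (rule tendsto_0_le[where K = "2 * norm e * norm x * norm y"])
      show "(inverse \<longlongrightarrow> (0 :: complex)) at_infinity" by (rule tendsto_inverse_0)
      show "\<forall>\<^sub>F z in at_infinity. norm (cinner (blinfun_apply (R z) x) y) \<le>
          norm (inverse z) * (2 * norm e * norm x * norm y)"
        unfolding eventually_at_infinity
      proof (intro exI allI impI)
        fix z :: complex
        \<comment> \<open>For such \<open>z\<close>, half of \<open>cmod z * norm (R z)\<close>
          absorbs the term \<open>norm b * norm (R z)\<close> in the bound for
          \<open>z R z = b R z - e\<close>, leaving
          \<open>cmod z * norm (R z) \<le> 2 * norm e\<close>. The summand 1 keeps \<open>z\<close>
          nonzero.\<close>
        assume z: "2 * norm b + 1 \<le> norm z"
        have "z *\<^sub>C R z = (b o\<^sub>L R z) - e"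
          using R(4)[of z] by (simp add: compose_bilinear R algebra_simps)
        then have "cmod z * norm (R z) \<le> norm b * norm (R z) + norm e"
          unfolding norm_scaleC_op[symmetric]
          using norm_triangle_ineq4[of "b o\<^sub>L R z" e] norm_blinfun_compose[of b "R z"] by simp
        moreover have "(2 * norm b + 1) * norm (R z) \<le> cmod z * norm (R z)"
          using z by (intro mult_right_mono) auto
        then have "2 * (norm b * norm (R z)) + norm (R z) \<le> cmod z * norm (R z)"
          by (simp add: algebra_simps)
        ultimately have "cmod z * norm (R z) \<le> 2 * norm e"
          using norm_ge_zero[of "R z"] by linarith
        moreover have z0: "cmod z > 0"
          using z norm_ge_zero[of b] by linarith
        ultimately have Rz: "norm (R z) \<le> inverse (cmod z) * (2 * norm e)"
          by (simp add: field_simps)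
        have "norm (cinner (blinfun_apply (R z) x) y) \<le> norm (R z) * norm x * norm y"
          using cmod_cinner_le[of "blinfun_apply (R z) x" y]
            mult_right_mono[OF norm_blinfun[of "R z" x], of "norm y"] by simp
        also have "\<dots> \<le> inverse (cmod z) * (2 * norm e) * norm x * norm y"
          by (intro mult_right_mono Rz) auto
        finally show "norm (cinner (blinfun_apply (R z) x) y) \<le>
            norm (inverse z) * (2 * norm e * norm x * norm y)"
          by (simp add: norm_inverse mult.assoc)
      qed
    qed
  qed
  have "R 0 = 0"
    by (rule blinfun_eqI, rule cinner_ext_left) (simp add: zero)
  then show False using R(4)[of 0] e by simp
qed

locale semiprime_operator_algebra =
  fixes A :: "'h :: complex_hilbert_space op set"
  assumes algebra: "operator_algebra A"
    and semiprime: "semiprime A"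
    and approx_unital: "approximately_unital A"
begin

section \<open>Right ideals, the approximate identity and semiprimeness\<close>

lemma in_bounded: "a \<in> A \<Longrightarrow> a \<in> bounded_operators"
  using algebra by (auto simp: operator_algebra_def)

lemma closed: "closed A"
  using algebra by (auto simp: operator_algebra_def)

lemma csubspace: "csubspace A"
  using algebra by (auto simp: operator_algebra_def)

lemma zero_in: "0 \<in> A"
  and add_in: "a \<in> A \<Longrightarrow> b \<in> A \<Longrightarrow> a + b \<in> A"
  and scaleC_in: "a \<in> A \<Longrightarrow> c *\<^sub>C a \<in> A"
  and compose_in: "a \<in> A \<Longrightarrow> b \<in> A \<Longrightarrow> a o\<^sub>L b \<in> A"
  using algebra by (auto simp: operator_algebra_def csubspace_def)

lemma diff_in: "a \<in> A \<Longrightarrow> b \<in> A \<Longrightarrow> a - b \<in> A"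
  using add_in[of a "(-1) *\<^sub>C b"] scaleC_in[of b "-1"] by (simp add: scaleC_op_minus_one)

lemma compose_scaleC: "a \<in> A \<Longrightarrow> a o\<^sub>L (c *\<^sub>C b) = c *\<^sub>C (a o\<^sub>L b)"
  by (simp add: scaleC_compose_right in_bounded)

lemma approximate_identity:
  "\<exists>(F :: 'h op filter) e. F \<noteq> bot \<and> (\<forall>\<^sub>F t in F. e t \<in> A \<and> norm (e t) \<le> 1) \<and>
     (\<forall>x\<in>A. ((\<lambda>t. e t o\<^sub>L x) \<longlongrightarrow> x) F) \<and> (\<forall>x\<in>A. ((\<lambda>t. x o\<^sub>L e t) \<longlongrightarrow> x) F)"
  using approx_unital unfolding approximately_unital_def is_left_cai_def by (simp only: conj_assoc)

text \<open>The approximate identity replaces a unit: \<open>x\<close> is the limit of the products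
  \<open>x e_t\<close>, which all vanish.\<close>

lemma left_faithful:
  assumes x: "x \<in> A" and "\<And>a. a \<in> A \<Longrightarrow> x o\<^sub>L a = 0"
  shows "x = 0"
proof -
  obtain F :: "'h op filter" and e where F: "F \<noteq> bot" "\<forall>\<^sub>F t in F. e t \<in> A \<and> norm (e t) \<le> 1"
      and right: "\<forall>x\<in>A. ((\<lambda>t. x o\<^sub>L e t) \<longlongrightarrow> x) F"
    using approximate_identity by blast
  have "\<forall>\<^sub>F t in F. x o\<^sub>L e t = 0"
    using F(2) by eventually_elim (use assms(2) in auto)
  then have "((\<lambda>t. x o\<^sub>L e t) \<longlongrightarrow> 0) F" by (rule tendsto_eventually)
  then show ?thesis using tendsto_unique[OF F(1) bspec[OF right x]] by blast
qed

lemma principal_right_ideal: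
  assumes x: "x \<in> A" and J: "right_ideal A J"
  shows "right_ideal A ((\<lambda>y. x o\<^sub>L y) ` J)"
proof -
  have "x o\<^sub>L 0 \<in> (\<lambda>y. x o\<^sub>L y) ` J" using J by (intro imageI) (simp add: right_ideal_def csubspace_def)
  moreover have "(x o\<^sub>L y) + (x o\<^sub>L z) \<in> (\<lambda>y. x o\<^sub>L y) ` J" if "y \<in> J" "z \<in> J" for y z
    unfolding bounded_bilinear.add_right[OF bounded_bilinear_blinfun_compose, symmetric] using J that
    by (intro imageI) (simp add: right_ideal_def csubspace_def)
  moreover have "c *\<^sub>C (x o\<^sub>L y) \<in> (\<lambda>y. x o\<^sub>L y) ` J" if "y \<in> J" for y c
    unfolding compose_scaleC[OF x, symmetric] using J that
    by (intro imageI) (simp add: right_ideal_def csubspace_def)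
  moreover have "(x o\<^sub>L y) o\<^sub>L a \<in> (\<lambda>y. x o\<^sub>L y) ` J" if "y \<in> J" "a \<in> A" for y a
    unfolding compose_assoc using J that by (intro imageI) (simp add: right_ideal_def)
  ultimately show ?thesis
    using J x compose_in unfolding right_ideal_def csubspace_def by auto
qed

lemma right_ideal_self: "right_ideal A A"
  unfolding right_ideal_def using csubspace compose_in by auto

lemma right_ideal_generated:
  assumes "x \<in> A"
  shows "right_ideal A {x o\<^sub>L a | a. a \<in> A}"
  using principal_right_ideal[OF assms right_ideal_self] by (simp add: image_def Setcompr_eq_image)

text \<open>
  Semiprimeness is only assumed for closed two-sided ideals. The left annihilator of the right
  annihilator of \<open>J\<close> provides such an ideal containing \<open>J\<close>.
\<close>

lemma right_ideal_square_zero: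
  assumes J: "right_ideal A J" and sq: "\<And>x y. x \<in> J \<Longrightarrow> y \<in> J \<Longrightarrow> x o\<^sub>L y = 0"
  shows "J = {0}"
proof -
  have JA: "J \<subseteq> A" "\<And>x a. x \<in> J \<Longrightarrow> a \<in> A \<Longrightarrow> x o\<^sub>L a \<in> J" and J0: "0 \<in> J"
    using J by (auto simp: right_ideal_def csubspace_def)
  define L where "L = {x \<in> A. \<forall>y\<in>J. y o\<^sub>L x = 0}"
  define I where "I = {x \<in> L. \<forall>y\<in>L. x o\<^sub>L y = 0}"
  have LA: "L \<subseteq> A" by (auto simp: L_def)
  have L: "x o\<^sub>L a \<in> L" "a o\<^sub>L x \<in> L" if x: "x \<in> L" and a: "a \<in> A" for x a
  proof -
    show "x o\<^sub>L a \<in> L" using x a compose_in by (auto simp: L_def compose_assoc[symmetric])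
    show "a o\<^sub>L x \<in> L" using x a compose_in JA(2) by (auto simp: L_def compose_assoc[symmetric])
  qed
  have subL: "csubspace L"
    unfolding csubspace_def L_def using zero_in add_in scaleC_in JA(1)
    by (auto simp: compose_bilinear compose_scaleC subset_iff)
  have subI: "csubspace I"
    using subL unfolding csubspace_def I_def by (auto simp: compose_bilinear)
  have closed_right_annihilator: "closed {x :: 'h op. y o\<^sub>L x = 0}" for y :: "'h op"
    by (intro closed_Collect_eq continuous_intros bounded_bilinear.continuous_on[OF bounded_bilinear_blinfun_compose])
  have closed_left_annihilator: "closed {x :: 'h op. x o\<^sub>L y = 0}" for y :: "'h op"
    by (intro closed_Collect_eq continuous_intros bounded_bilinear.continuous_on[OF bounded_bilinear_blinfun_compose])
  have "L = A \<inter> (\<Inter>y\<in>J. {x. y o\<^sub>L x = 0})" by (auto simp: L_def)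
  then have "closed L"
    by (metis (no_types, lifting) closed closed_INT closed_Int closed_right_annihilator)
  moreover have "I = L \<inter> (\<Inter>y\<in>L. {x. x o\<^sub>L y = 0})" by (auto simp: I_def)
  ultimately have closedI: "closed I"
    by (metis (no_types, lifting) closed_INT closed_Int closed_left_annihilator)
  have "two_sided_ideal A I"
    unfolding two_sided_ideal_def right_ideal_def
  proof (intro conjI ballI)
    show "I \<subseteq> A" using LA by (auto simp: I_def)
    show "x o\<^sub>L a \<in> I" "a o\<^sub>L x \<in> I" if "x \<in> I" "a \<in> A" for x a
      using that L by (auto simp: I_def compose_assoc)
  qed (rule subI)
  moreover have "x o\<^sub>L y = 0" if "x \<in> I" "y \<in> I" for x y
    using that by (auto simp: I_def)
  ultimately have "I = {0}"
    using semiprime closedI unfolding semiprime_def by blast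
  moreover have "J \<subseteq> I"
    using sq JA(1) by (auto simp: I_def L_def)
  ultimately show ?thesis using J0 by auto
qed

text \<open>The right ideal \<open>k A\<close> squares to zero, hence vanishes, and then so does
  \<open>k\<close> by \<open>left_faithful\<close>.\<close>

lemma semiprime_element:
  assumes k: "k \<in> A" and kak: "\<And>a. a \<in> A \<Longrightarrow> k o\<^sub>L a o\<^sub>L k = 0"
  shows "k = 0"
proof -
  have "{k o\<^sub>L a | a. a \<in> A} = {0}"
  proof (rule right_ideal_square_zero[OF right_ideal_generated[OF k]])
    fix x y assume "x \<in> {k o\<^sub>L a | a. a \<in> A}" "y \<in> {k o\<^sub>L a | a. a \<in> A}"
    then obtain a b where "x = k o\<^sub>L a" "y = k o\<^sub>L b" "a \<in> A" by auto
    then have "x o\<^sub>L y = (k o\<^sub>L a o\<^sub>L k) o\<^sub>L b" by (simp add: compose_assoc)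
    then show "x o\<^sub>L y = 0" using kak[OF \<open>a \<in> A\<close>] by simp
  qed
  then show ?thesis using left_faithful[OF k] by blast
qed

text \<open>Brauer's lemma. Semiprimeness gives \<open>x\<close>, \<open>y\<close> in
  \<open>J\<close> with \<open>x y \<noteq> 0\<close>, so minimality gives \<open>x J = J\<close>
  and an \<open>e\<close> in \<open>J\<close> with \<open>x e = x\<close>. The right annihilator of
  \<open>x\<close> in \<open>J\<close> is a proper right ideal, hence zero, and it contains
  \<open>e e - e\<close>.\<close>

lemma minimal_right_ideal_idempotent:
  assumes J: "minimal_right_ideal A J"
  obtains e where "e \<in> A" "e \<noteq> 0" "e o\<^sub>L e = e" "J = {e o\<^sub>L a | a. a \<in> A}"
proof -
  have rJ: "right_ideal A J" and J0: "J \<noteq> {0}"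
    and min: "\<And>K. right_ideal A K \<Longrightarrow> K \<subseteq> J \<Longrightarrow> K = {0} \<or> K = J"
    using J by (auto simp: minimal_right_ideal_def)
  have JA: "J \<subseteq> A" "\<And>x a. x \<in> J \<Longrightarrow> a \<in> A \<Longrightarrow> x o\<^sub>L a \<in> J"
    and Jsub: "0 \<in> J" "\<And>x y. x \<in> J \<Longrightarrow> y \<in> J \<Longrightarrow> x + y \<in> J" "\<And>c x. x \<in> J \<Longrightarrow> c *\<^sub>C x \<in> J"
    using rJ by (auto simp: right_ideal_def csubspace_def)
  obtain x y where xy: "x \<in> J" "y \<in> J" "x o\<^sub>L y \<noteq> 0"
    using right_ideal_square_zero[OF rJ] J0 by blast
  have xA: "x \<in> A" using xy JA by auto
  have "(\<lambda>y. x o\<^sub>L y) ` J = J"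
    using min[OF principal_right_ideal[OF xA rJ]] JA xy by blast
  then have "x \<in> (\<lambda>y. x o\<^sub>L y) ` J" using xy(1) by simp
  then obtain e where e: "e \<in> J" "x o\<^sub>L e = x" by (metis imageE)
  define K where "K = {y \<in> J. x o\<^sub>L y = 0}"
  have "right_ideal A K"
    unfolding right_ideal_def csubspace_def K_def using JA Jsub
    by (auto simp: compose_bilinear compose_scaleC[OF xA] compose_assoc[symmetric])
  moreover have "K \<subseteq> J" "K \<noteq> J" using xy by (auto simp: K_def)
  ultimately have "K = {0}" using min by blast
  moreover have "(e o\<^sub>L e) - e \<in> K"
    using e JA Jsub(2)[of "e o\<^sub>L e" "(-1) *\<^sub>C e"] Jsub(3)[of e "-1"]
    by (auto simp: K_def compose_bilinear scaleC_op_minus_one compose_assoc[symmetric])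
  ultimately have idem: "e o\<^sub>L e = e" by simp
  have eA: "e \<in> A" using e JA by auto
  have e0: "e \<noteq> 0" using e xy by auto
  have "{e o\<^sub>L a | a. a \<in> A} \<subseteq> J" using e(1) JA by auto
  moreover have "e \<in> {e o\<^sub>L a | a. a \<in> A}" using idem eA by force
  ultimately have "J = {e o\<^sub>L a | a. a \<in> A}"
    using min[OF right_ideal_generated[OF eA]] e0 by blast
  then show thesis using that eA e0 idem by blast
qed

text \<open>Minimality of \<open>e A\<close> makes every nonzero element of \<open>e A e\<close>
  invertible there; a corner element outside the multiples of \<open>e\<close> would then satisfy
  the hypotheses of \<open>gelfand_mazur_corner\<close>.\<close>

lemma minimal_right_ideal_corner:
  assumes J: "minimal_right_ideal A {e o\<^sub>L a | a. a \<in> A}"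
    and e: "e \<in> A" "e o\<^sub>L e = e" "e \<noteq> 0"
  shows "algebraically_minimal_idempotent A e"
proof -
  have min: "\<And>K. right_ideal A K \<Longrightarrow> K \<subseteq> {e o\<^sub>L a | a. a \<in> A} \<Longrightarrow> K = {0} \<or> K = {e o\<^sub>L a | a. a \<in> A}"
    using J by (auto simp: minimal_right_ideal_def)
  have e_left: "e o\<^sub>L (e o\<^sub>L a) = e o\<^sub>L a" for a
    using e(2) by (metis compose_assoc)
  have right_inverse: "\<exists>r\<in>A. r o\<^sub>L e = r \<and> e o\<^sub>L r = r \<and> b o\<^sub>L r = e"
    if b: "b \<in> A" "b o\<^sub>L e = b" "e o\<^sub>L b = b" "b \<noteq> 0" for b
  proof -
    have "b o\<^sub>L a = e o\<^sub>L (b o\<^sub>L a)" for a using b(3) by (metis compose_assoc)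
    then have "{b o\<^sub>L a | a. a \<in> A} \<subseteq> {e o\<^sub>L a | a. a \<in> A}" using compose_in b(1) by blast
    moreover have "b \<in> {b o\<^sub>L a | a. a \<in> A}" using b(2) e(1) by force
    ultimately have eq: "{b o\<^sub>L a | a. a \<in> A} = {e o\<^sub>L a | a. a \<in> A}"
      using min[OF right_ideal_generated[OF b(1)]] b(4) by blast
    have "e \<in> {b o\<^sub>L a | a. a \<in> A}" unfolding eq using e by force
    then obtain d where d: "d \<in> A" "b o\<^sub>L d = e" by blast
    have "b o\<^sub>L (e o\<^sub>L d o\<^sub>L e) = (b o\<^sub>L e) o\<^sub>L d o\<^sub>L e" by (simp add: compose_assoc)
    then have "b o\<^sub>L (e o\<^sub>L d o\<^sub>L e) = e" using b d e by simp
    then show ?thesis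
      using e d compose_in by (intro bexI[of _ "e o\<^sub>L d o\<^sub>L e"]) (auto simp: compose_assoc e_left)
  qed
  have inverse: "\<exists>r\<in>A. r o\<^sub>L e = r \<and> e o\<^sub>L r = r \<and> b o\<^sub>L r = e \<and> r o\<^sub>L b = e"
    if b: "b \<in> A" "b o\<^sub>L e = b" "e o\<^sub>L b = b" "b \<noteq> 0" for b
  proof -
    obtain r where r: "r \<in> A" "r o\<^sub>L e = r" "e o\<^sub>L r = r" "b o\<^sub>L r = e"
      using right_inverse[OF b] by blast
    moreover have "r \<noteq> 0" using r(4) e(3) by auto
    ultimately obtain s where s: "s \<in> A" "s o\<^sub>L e = s" "e o\<^sub>L s = s" "r o\<^sub>L s = e"
      using right_inverse by blast
    \<comment> \<open>The right inverse \<open>r\<close> has a right inverse \<open>s\<close> of its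
      own, and \<open>b = b r s = s\<close>; hence \<open>r\<close> is a two-sided inverse of
      \<open>b\<close>.\<close>
    have "b = (b o\<^sub>L r) o\<^sub>L s" using s(4) b(2) by (simp add: compose_assoc)
    then have "b = s" using r(4) s(3) by simp
    then show ?thesis using r s by blast
  qed
  have "e o\<^sub>L a o\<^sub>L e \<in> range (\<lambda>c. c *\<^sub>C e)" if a: "a \<in> A" for a
  proof (rule ccontr)
    assume neq: "e o\<^sub>L a o\<^sub>L e \<notin> range (\<lambda>c. c *\<^sub>C e)"
    define b where "b = e o\<^sub>L a o\<^sub>L e"
    have b: "b \<in> A" "b o\<^sub>L e = b" "e o\<^sub>L b = b"
      using e a compose_in by (auto simp: b_def compose_assoc e_left)
    have "\<exists>r\<in>bounded_operators. r o\<^sub>L e = r \<and> e o\<^sub>L r = r \<and>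
        (b - z *\<^sub>C e) o\<^sub>L r = e \<and> r o\<^sub>L (b - z *\<^sub>C e) = e" for z
    proof -
      have "b - z *\<^sub>C e \<noteq> 0" using neq b_def by auto
      moreover have "b - z *\<^sub>C e \<in> A" using b e diff_in scaleC_in by auto
      moreover have "(b - z *\<^sub>C e) o\<^sub>L e = b - z *\<^sub>C e" "e o\<^sub>L (b - z *\<^sub>C e) = b - z *\<^sub>C e"
        using b e by (auto simp: compose_bilinear compose_scaleC)
      ultimately show ?thesis using inverse in_bounded by blast
    qed
    then show False using gelfand_mazur_corner[OF e(3) in_bounded[OF b(1)] b(2,3)] by blast
  qed
  moreover have "c *\<^sub>C e \<in> {e o\<^sub>L a o\<^sub>L e | a. a \<in> A}" for c
  proof -
    have "c *\<^sub>C e = e o\<^sub>L (c *\<^sub>C e) o\<^sub>L e" using e by (simp add: compose_scaleC)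
    then show ?thesis using scaleC_in[OF e(1)] by blast
  qed
  ultimately show ?thesis
    using e unfolding algebraically_minimal_idempotent_def by blast
qed

lemma algebraically_minimal_corner:
  assumes "algebraically_minimal_idempotent A e" "a \<in> A"
  obtains c where "e o\<^sub>L a o\<^sub>L e = c *\<^sub>C e"
proof -
  have "e o\<^sub>L a o\<^sub>L e \<in> {e o\<^sub>L a o\<^sub>L e | a. a \<in> A}" using assms(2) by blast
  then show thesis using assms(1) that unfolding algebraically_minimal_idempotent_def by blast
qed

text \<open>A nonzero \<open>k\<close> in a right ideal inside \<open>e A\<close> has some
  \<open>a\<close> with \<open>k a k \<noteq> 0\<close>. Here \<open>k a e\<close> is a corner
  element, hence a multiple of \<open>e\<close>, and nonzero because
  \<open>k a k = (k a e) k\<close>; so \<open>e\<close> lies in that ideal.\<close>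

lemma algebraically_minimal_right_ideal:
  assumes e: "algebraically_minimal_idempotent A e" and e0: "e \<noteq> 0"
  shows "minimal_right_ideal A {e o\<^sub>L a | a. a \<in> A}"
proof -
  have eA: "e \<in> A" and idem: "e o\<^sub>L e = e" using e by (auto simp: algebraically_minimal_idempotent_def)
  have "K = {e o\<^sub>L a | a. a \<in> A}"
    if K: "right_ideal A K" "K \<subseteq> {e o\<^sub>L a | a. a \<in> A}" "K \<noteq> {0}" for K
  proof -
    have KA: "K \<subseteq> A" "\<And>x a. x \<in> K \<Longrightarrow> a \<in> A \<Longrightarrow> x o\<^sub>L a \<in> K" and K0: "0 \<in> K"
      and KC: "\<And>c x. x \<in> K \<Longrightarrow> c *\<^sub>C x \<in> K"
      using K by (auto simp: right_ideal_def csubspace_def)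
    obtain k where k: "k \<in> K" "k \<noteq> 0" using K K0 by blast
    have ek: "e o\<^sub>L k = k" using K(2) k(1) idem by (auto simp: compose_assoc[symmetric])
    have kA: "k \<in> A" using k KA by auto
    obtain a where a: "a \<in> A" "k o\<^sub>L a o\<^sub>L k \<noteq> 0" using semiprime_element[OF kA] k by blast
    obtain c where c: "e o\<^sub>L (k o\<^sub>L a) o\<^sub>L e = c *\<^sub>C e"
      using algebraically_minimal_corner[OF e compose_in[OF kA a(1)]] by blast
    have kae: "(k o\<^sub>L a) o\<^sub>L e = c *\<^sub>C e" using c ek by (simp add: compose_assoc[symmetric])
    have "k o\<^sub>L a o\<^sub>L k = ((k o\<^sub>L a) o\<^sub>L e) o\<^sub>L k" using ek by (simp add: compose_assoc)
    then have "c \<noteq> 0" using a(2) kae by auto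
    have "c *\<^sub>C e \<in> K" using KA(2)[OF k(1) compose_in[OF a(1) eA]] kae by (simp add: compose_assoc)
    then have "e \<in> K" using KC[of "c *\<^sub>C e" "inverse c"] \<open>c \<noteq> 0\<close> by simp
    then show ?thesis using K(2) KA(2) by blast
  qed
  moreover have "e \<in> {e o\<^sub>L a | a. a \<in> A}" using eA idem by force
  ultimately show ?thesis
    unfolding minimal_right_ideal_def using right_ideal_generated[OF eA] e0 by blast
qed

subsection \<open>Left contractive approximate identities\<close>

lemma corner_of_right_ideal_element:
  assumes e: "algebraically_minimal_idempotent A e" and f: "f \<in> {e o\<^sub>L a | a. a \<in> A}"
  obtains c where "f o\<^sub>L e = c *\<^sub>C e"
  using algebraically_minimal_corner[OF e] f by blast

text \<open>
  If \<open>f\<close> is a contraction with \<open>f v = c v\<close> for \<open>v = f w\<close>, and \<open>v\<close> is orthogonal to \<open>w\<close>, then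
  \<open>f (s v + w) = (s c + 1) v\<close>, so that \<open>|s c + 1|\<^sup>2 |v|\<^sup>2 \<le> s\<^sup>2 |v|\<^sup>2 + |w|\<^sup>2\<close>. For \<open>c\<close> close to \<open>1\<close>
  and large \<open>s\<close> this makes \<open>v\<close> small.
\<close>

lemma contraction_eigenvector_bound:
  fixes f :: "'a :: complex_hilbert_space op"
  assumes f: "norm f \<le> 1" and v: "v = blinfun_apply f w" "blinfun_apply f v = c *\<^sub>C v"
    and orth: "cinner v w = 0" and s: "s > 0" "2 * s \<le> (cmod (complex_of_real s * c + 1))\<^sup>2 - s\<^sup>2"
  shows "norm v \<le> norm w / sqrt (2 * s)"
proof -
  have "blinfun_apply f (s *\<^sub>R v + w) = (complex_of_real s * c + 1) *\<^sub>C v"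
    using v(2) unfolding blinfun.add_right blinfun.scaleR_right v(1)[symmetric]
    by (simp add: scaleR_scaleC scaleC_scaleC scaleC_add_left)
  then have "cmod (complex_of_real s * c + 1) * norm v = norm (blinfun_apply f (s *\<^sub>R v + w))"
    by (simp add: norm_scaleC)
  also have "\<dots> \<le> norm f * norm (s *\<^sub>R v + w)" by (rule norm_blinfun)
  also have "\<dots> \<le> 1 * norm (s *\<^sub>R v + w)" by (intro mult_right_mono f) simp
  finally have "(cmod (complex_of_real s * c + 1) * norm v)\<^sup>2 \<le> (norm (s *\<^sub>R v + w))\<^sup>2"
    by (intro power_mono) auto
  also have "\<dots> = s\<^sup>2 * (norm v)\<^sup>2 + (norm w)\<^sup>2"
    using orth s(1) by (subst norm_add_orthogonal) (simp_all add: scaleR_scaleC cinner_scaleC_left norm_scaleC power_mult_distrib)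
  finally have "((cmod (complex_of_real s * c + 1))\<^sup>2 - s\<^sup>2) * (norm v)\<^sup>2 \<le> (norm w)\<^sup>2"
    by (simp add: power_mult_distrib algebra_simps)
  moreover have "(2 * s) * (norm v)\<^sup>2 \<le> ((cmod (complex_of_real s * c + 1))\<^sup>2 - s\<^sup>2) * (norm v)\<^sup>2"
    by (intro mult_right_mono s) simp
  ultimately have "(sqrt (2 * s) * norm v)\<^sup>2 \<le> (norm w)\<^sup>2"
    using s(1) by (simp add: power_mult_distrib)
  then have "sqrt (2 * s) * norm v \<le> norm w" by (rule power2_le_imp_le) simp
  then show ?thesis using s(1) by (simp add: field_simps)
qed

text \<open>Split \<open>x\<close> into \<open>P x\<close> and \<open>w = x - P x\<close>. On the
  range of \<open>e\<close>, \<open>f t\<close> is multiplication by \<open>c t\<close>, which tends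
  to 1. The vector \<open>f t w\<close> lies in that range, hence is orthogonal to \<open>w\<close>,
  and the eigenvector bound makes it small uniformly on the unit ball.\<close>

lemma left_cai_imp_range_projection:
  assumes e: "algebraically_minimal_idempotent A e" "e \<noteq> 0"
    and cai: "has_left_cai {e o\<^sub>L a | a. a \<in> A}"
  shows "\<exists>p\<in>A. is_range_projection p e"
proof -
  define J where "J = {e o\<^sub>L a | a. a \<in> A}"
  obtain F :: "'h op filter" and f where F: "F \<noteq> bot" "\<forall>\<^sub>F t in F. f t \<in> J \<and> norm (f t) \<le> 1"
      and lim: "\<And>x. x \<in> J \<Longrightarrow> ((\<lambda>t. f t o\<^sub>L x) \<longlongrightarrow> x) F"
    using cai unfolding has_left_cai_def is_left_cai_def J_def[symmetric] by blast
  have eA: "e \<in> A" and idem: "e o\<^sub>L e = e" using e by (auto simp: algebraically_minimal_idempotent_def)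
  have e_left: "e o\<^sub>L (e o\<^sub>L a) = e o\<^sub>L a" for a
    using idem by (metis compose_assoc)
  have J: "J = {x \<in> A. e o\<^sub>L x = x}"
  proof
    show "J \<subseteq> {x \<in> A. e o\<^sub>L x = x}" using compose_in eA e_left by (auto simp: J_def)
    show "{x \<in> A. e o\<^sub>L x = x} \<subseteq> J" unfolding J_def by (smt (verit, best) mem_Collect_eq subsetI)
  qed
  \<comment> \<open>The idempotent generator exhibits \<open>J\<close> as a fixed point set in
    \<open>A\<close>, hence as closed; this keeps the norm limit \<open>P\<close> in
    \<open>J\<close>.\<close>
  have "J = A \<inter> {x. e o\<^sub>L x = x}" using J by auto
  moreover have "closed {x :: 'h op. e o\<^sub>L x = x}"
    by (intro closed_Collect_eq continuous_intros bounded_bilinear.continuous_on[OF bounded_bilinear_blinfun_compose])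
  ultimately have closedJ: "closed J" using closed by auto
  define M where "M = range (blinfun_apply e)"
  have M: "M = {x. blinfun_apply e x = x}"
  proof -
    have "blinfun_apply e (blinfun_apply e x) = blinfun_apply e x" for x
      using idem by (metis blinfun_apply_blinfun_compose)
    then show ?thesis unfolding M_def by (auto simp: image_iff) metis
  qed
  have "closed {x. blinfun_apply e x = x}"
    by (intro closed_Collect_eq continuous_intros)
  then have closedM: "closed M" by (simp add: M)
  have subM: "csubspace M"
    unfolding csubspace_def M using in_bounded[OF eA]
    by (auto simp: blinfun.add_right bounded_operators_scaleC)
  define P where "P = proj_onto M"
  note P = is_projection_proj_onto[OF subM closedM, folded P_def]
    range_proj_onto[OF subM closedM, folded P_def]
    proj_onto_in[OF subM closedM, folded P_def]
  have eP: "blinfun_apply e (blinfun_apply P x) = blinfun_apply P x" for x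
    using P(3)[of x] M by auto
  define c where "c t = (SOME c. f t o\<^sub>L e = c *\<^sub>C e)" for t
  have c: "f t o\<^sub>L e = c t *\<^sub>C e" if "f t \<in> J" for t
  proof -
    have "\<exists>c. f t o\<^sub>L e = c *\<^sub>C e"
      using corner_of_right_ideal_element[OF e(1)] that unfolding J_def by blast
    then show ?thesis unfolding c_def by (rule someI_ex)
  qed
  have eJ: "e \<in> J" using J eA idem by auto
  have "((\<lambda>t. norm ((f t o\<^sub>L e) - e) / norm e) \<longlongrightarrow> norm (e - e) / norm e) F"
    using e(2) by (intro tendsto_intros lim[OF eJ]) auto
  then have lim0: "((\<lambda>t. norm ((f t o\<^sub>L e) - e) / norm e) \<longlongrightarrow> 0) F" by simp
  have c1: "(c \<longlongrightarrow> 1) F"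
  proof (rule LIM_zero_cancel, rule tendsto_0_le[OF lim0, where K = 1])
    show "\<forall>\<^sub>F t in F. norm (c t - 1) \<le> norm (norm ((f t o\<^sub>L e) - e) / norm e) * 1"
      using F(2)
    proof eventually_elim
      case (elim t)
      have "(f t o\<^sub>L e) - e = (c t - 1) *\<^sub>C e" using c elim by (simp add: scaleC_op_diff_left)
      then have "norm ((f t o\<^sub>L e) - e) = cmod (c t - 1) * norm e" by (simp add: norm_scaleC_op)
      then show ?case using e(2) by simp
    qed
  qed
  have "(f \<longlongrightarrow> P) F"
  proof (rule tendstoI)
    fix \<epsilon> :: real
    assume \<epsilon>: "\<epsilon> > 0"
    \<comment> \<open>With this value \<open>1 / sqrt (2 * s)\<close> is
      \<open>\<epsilon> / 4\<close>, the share of \<open>f t w\<close> in the error;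
      \<open>c t\<close> being within \<open>\<epsilon> / 4\<close> of 1 accounts for another
      \<open>\<epsilon> / 4\<close>. The total \<open>\<epsilon> / 2\<close> leaves room for the
      strict inequality.\<close>
    define s where "s = 8 / \<epsilon>\<^sup>2"
    have s: "s > 0" "1 / sqrt (2 * s) = \<epsilon> / 4"
      using \<epsilon> by (simp_all add: s_def real_sqrt_divide)
    have "((\<lambda>t. (cmod (complex_of_real s * c t + 1))\<^sup>2 - s\<^sup>2) \<longlongrightarrow>
        (cmod (complex_of_real s * 1 + 1))\<^sup>2 - s\<^sup>2) F"
      by (intro tendsto_intros c1)
    \<comment> \<open>At \<open>c = 1\<close> the expression exceeds \<open>2 * s\<close> by exactly
      1, so the inequality demanded of \<open>s\<close> persists for \<open>c t\<close> close to
      1.\<close>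
    moreover have "(cmod (complex_of_real s * 1 + 1))\<^sup>2 - s\<^sup>2 = 2 * s + 1"
    proof -
      have "complex_of_real s * 1 + 1 = complex_of_real (s + 1)" by simp
      then show ?thesis using s(1) by (simp only: norm_of_real) (simp add: power2_eq_square algebra_simps)
    qed
    ultimately have "\<forall>\<^sub>F t in F. 2 * s < (cmod (complex_of_real s * c t + 1))\<^sup>2 - s\<^sup>2"
      by (intro order_tendstoD(1)) auto
    moreover have "\<forall>\<^sub>F t in F. dist (c t) 1 < \<epsilon> / 4"
      using c1 \<epsilon> by (intro tendstoD) auto
    ultimately show "\<forall>\<^sub>F t in F. dist (f t) P < \<epsilon>"
      using F(2)
    proof eventually_elim
      case (elim t)
      have ct: "blinfun_apply (f t) (blinfun_apply e x) = c t *\<^sub>C blinfun_apply e x" for x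
        using c[of t] elim(3) by (metis blinfun_apply_blinfun_compose scaleC_op_apply)
      have "e o\<^sub>L f t = f t" using elim(3) J by blast
      then have fe: "blinfun_apply e (blinfun_apply (f t) x) = blinfun_apply (f t) x" for x
        by (metis blinfun_apply_blinfun_compose)
      have "norm (f t - P) \<le> \<epsilon> / 2"
      proof (rule norm_blinfun_bound)
        fix x
        define w where "w = x - blinfun_apply P x"
        define v where "v = blinfun_apply (f t) w"
        have "blinfun_apply P v = v"
          using proj_onto_id[OF subM closedM, of v, folded P_def] M fe by (simp add: v_def)
        then have "cinner v w = cinner v (blinfun_apply P w)"
          using projection_cinner[OF P(1)] by metis
        also have "blinfun_apply P w = 0"
          using projection_idem_apply[OF P(1)] by (simp add: w_def blinfun.diff_right)
        finally have "cinner v w = 0" by simp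
        moreover have "blinfun_apply (f t) v = c t *\<^sub>C v" using ct[of v] fe by (simp add: v_def)
        ultimately have "norm v \<le> norm w / sqrt (2 * s)"
          using elim s by (intro contraction_eigenvector_bound[of "f t"]) (auto simp: v_def)
        also have "\<dots> = (\<epsilon> / 4) * norm w" unfolding s(2)[symmetric] by simp
        also have "norm w \<le> norm x"
        proof -
          have "cinner (blinfun_apply P x) w = cinner (blinfun_apply P x) (blinfun_apply P w)"
            using projection_cinner[OF P(1)] projection_idem_apply[OF P(1)] by metis
          then have "cinner w (blinfun_apply P x) = 0"
            using \<open>blinfun_apply P w = 0\<close> by (simp add: cinner_commute_zero)
          then have "(norm (w + blinfun_apply P x))\<^sup>2 = (norm w)\<^sup>2 + (norm (blinfun_apply P x))\<^sup>2"
            by (rule norm_add_orthogonal)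
          then have "(norm w)\<^sup>2 \<le> (norm x)\<^sup>2" by (simp add: w_def)
          then show ?thesis by (rule power2_le_imp_le) simp
        qed
        finally have 1: "norm v \<le> \<epsilon> / 4 * norm x" using \<epsilon> by simp
        have "blinfun_apply (f t) x - blinfun_apply P x = v + (c t - 1) *\<^sub>C blinfun_apply P x"
          using ct[of "blinfun_apply P x"] eP
          by (simp add: v_def w_def blinfun.diff_right scaleC_diff_left)
        then have "norm (blinfun_apply (f t - P) x) \<le> norm v + norm ((c t - 1) *\<^sub>C blinfun_apply P x)"
          using norm_triangle_ineq by (simp add: blinfun.diff_left)
        also have "norm ((c t - 1) *\<^sub>C blinfun_apply P x) \<le> \<epsilon> / 4 * norm x"
          unfolding norm_scaleC using elim(2) projection_contractive(1)[OF P(1)] \<epsilon>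
          by (intro mult_mono) (auto simp: dist_norm)
        finally show "norm (blinfun_apply (f t - P) x) \<le> \<epsilon> / 2 * norm x" using 1 by (simp add: field_simps)
      qed (use \<epsilon> in simp)
      then show ?case using \<epsilon> by (simp add: dist_norm)
    qed
  qed
  moreover have "\<forall>\<^sub>F t in F. f t \<in> J" using F(2) by eventually_elim simp
  ultimately have "P \<in> J" using Lim_in_closed_set[OF closedJ _ F(1)] by blast
  then show ?thesis
    using P(1,2) J unfolding is_range_projection_def M_def by blast
qed

text \<open>Both idempotents fix every vector of their common range. The two relations together give
  \<open>p A = e A\<close>.\<close>

lemma range_projection_compose:
  assumes "is_range_projection p e" "e o\<^sub>L e = e"
  shows "p o\<^sub>L e = e" "e o\<^sub>L p = p"
proof -
  have p: "is_projection p" and ran: "range (blinfun_apply p) = range (blinfun_apply e)"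
    using assms(1) by (auto simp: is_range_projection_def)
  show "p o\<^sub>L e = e"
  proof (rule blinfun_eqI)
    fix x
    have "blinfun_apply e x \<in> range (blinfun_apply p)" using ran by auto
    then show "blinfun_apply (p o\<^sub>L e) x = blinfun_apply e x"
      using projection_idem_apply[OF p] by auto
  qed
  show "e o\<^sub>L p = p"
  proof (rule blinfun_eqI)
    fix x
    have "blinfun_apply p x \<in> range (blinfun_apply e)" using ran by auto
    then obtain y where "blinfun_apply p x = blinfun_apply e y" by auto
    then show "blinfun_apply (e o\<^sub>L p) x = blinfun_apply p x"
      using assms(2) by (metis blinfun_apply_blinfun_compose)
  qed
qed

lemma principal_right_ideal_eq:
  assumes "p \<in> A" "e \<in> A" "p o\<^sub>L e = e" "e o\<^sub>L p = p"
  shows "{p o\<^sub>L a | a. a \<in> A} = {e o\<^sub>L a | a. a \<in> A}"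
proof -
  have "p o\<^sub>L a = e o\<^sub>L (p o\<^sub>L a)" "e o\<^sub>L a = p o\<^sub>L (e o\<^sub>L a)" for a
    using assms by (metis compose_assoc)+
  then show ?thesis using assms(1,2) compose_in by blast
qed

lemma projection_left_cai:
  assumes p: "p \<in> A" "is_projection p"
  shows "has_left_cai {p o\<^sub>L a | a. a \<in> A}"
proof -
  have p_in: "p \<in> {p o\<^sub>L a | a. a \<in> A}" using p projection_idem[OF p(2)] by force
  have left_id: "p o\<^sub>L x = x" if x: "x \<in> {p o\<^sub>L a | a. a \<in> A}" for x
    using x projection_idem[OF p(2)] by (auto simp: compose_assoc[symmetric])
  \<comment> \<open>The constant net \<open>p\<close>, along a filter concentrated at one
    point.\<close>
  have "is_left_cai (principal {p}) (\<lambda>_. p) {p o\<^sub>L a | a. a \<in> A}"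
    unfolding is_left_cai_def
  proof (intro conjI ballI)
    show "\<forall>\<^sub>F t in principal {p}. p \<in> {p o\<^sub>L a | a. a \<in> A} \<and> norm p \<le> 1"
      using p_in projection_contractive(2)[OF p(2)] by (intro always_eventually) blast
    show "((\<lambda>t. p o\<^sub>L x) \<longlongrightarrow> x) (principal {p})" if "x \<in> {p o\<^sub>L a | a. a \<in> A}" for x
      unfolding left_id[OF that] by (rule tendsto_const)
  qed (simp add: principal_eq_bot_iff)
  then show ?thesis unfolding has_left_cai_def by blast
qed

lemma left_cai_iff_projection:
  assumes J: "minimal_right_ideal A J"
  shows "has_left_cai J \<longleftrightarrow> (\<exists>p\<in>A. is_projection p \<and> J = {p o\<^sub>L a | a. a \<in> A})"
proof
  assume cai: "has_left_cai J"
  obtain e where e: "e \<in> A" "e \<noteq> 0" "e o\<^sub>L e = e" "J = {e o\<^sub>L a | a. a \<in> A}"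
    using minimal_right_ideal_idempotent[OF J] by blast
  have min: "algebraically_minimal_idempotent A e"
    using minimal_right_ideal_corner J e by simp
  obtain p where p: "p \<in> A" "is_range_projection p e"
    using left_cai_imp_range_projection[OF min e(2)] cai e(4) by auto
  then have "J = {p o\<^sub>L a | a. a \<in> A}"
    using principal_right_ideal_eq[OF p(1) e(1)] range_projection_compose[OF p(2) e(3)] e(4) by simp
  then show "\<exists>p\<in>A. is_projection p \<and> J = {p o\<^sub>L a | a. a \<in> A}"
    using p by (auto simp: is_range_projection_def)
next
  assume "\<exists>p\<in>A. is_projection p \<and> J = {p o\<^sub>L a | a. a \<in> A}"
  then show "has_left_cai J" using projection_left_cai by auto
qed

lemma left_cai_iff_range_projection:
  "(\<forall>J. minimal_right_ideal A J \<longrightarrow> has_left_cai J) \<longleftrightarrow>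
   (\<forall>e. algebraically_minimal_idempotent A e \<longrightarrow> (\<exists>p\<in>A. is_range_projection p e))"
proof (intro iffI allI impI)
  fix e
  assume cai: "\<forall>J. minimal_right_ideal A J \<longrightarrow> has_left_cai J" and e: "algebraically_minimal_idempotent A e"
  show "\<exists>p\<in>A. is_range_projection p e"
  proof (cases "e = 0")
    \<comment> \<open>\<open>algebraically_minimal_idempotent\<close> admits \<open>e = 0\<close>,
      and then 0 is the range projection.\<close>
    case True
    then show ?thesis
      using zero_in bounded_operators_zero
      by (intro bexI[of _ 0]) (auto simp: is_range_projection_def is_projection_def)
  next
    case False
    then show ?thesis
      using left_cai_imp_range_projection[OF e] algebraically_minimal_right_ideal[OF e] cai by blast
  qed
next
  fix J
  assume rp: "\<forall>e. algebraically_minimal_idempotent A e \<longrightarrow> (\<exists>p\<in>A. is_range_projection p e)"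
    and J: "minimal_right_ideal A J"
  obtain e where e: "e \<in> A" "e \<noteq> 0" "e o\<^sub>L e = e" "J = {e o\<^sub>L a | a. a \<in> A}"
    using minimal_right_ideal_idempotent[OF J] by blast
  have "algebraically_minimal_idempotent A e"
    using minimal_right_ideal_corner J e by simp
  then obtain p where p: "p \<in> A" "is_range_projection p e" using rp by blast
  then have "J = {p o\<^sub>L a | a. a \<in> A}"
    using principal_right_ideal_eq[OF p(1) e(1)] range_projection_compose[OF p(2) e(3)] e(4) by simp
  then show "has_left_cai J" using projection_left_cai p by (auto simp: is_range_projection_def)
qed

end

section \<open>Algebras with dense socle\<close>

locale dense_socle_algebra = semiprime_operator_algebra A
  for A :: "'h :: complex_hilbert_space op set" +
  assumes range_projection: "algebraically_minimal_idempotent A e \<Longrightarrow> \<exists>p\<in>A. is_range_projection p e"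
    and dense_socle: "closure (socle A) = A"
begin

text \<open>Zero is excluded explicitly, so that a unit vector in the range exists.\<close>

definition minimal_projection :: "'h op \<Rightarrow> bool" where
  "minimal_projection q \<longleftrightarrow> is_projection q \<and> q \<noteq> 0 \<and> algebraically_minimal_idempotent A q"

lemma
  assumes "minimal_projection q"
  shows minimal_projection_in: "q \<in> A"
    and minimal_projection_is_projection: "is_projection q"
    and minimal_projection_nonzero: "q \<noteq> 0"
  using assms by (auto simp: minimal_projection_def algebraically_minimal_idempotent_def)

text \<open>Minimality makes the corner a multiple of \<open>q\<close>; evaluation at
  \<open>\<xi>\<close> identifies the scalar.\<close>

lemma minimal_projection_corner:
  assumes q: "minimal_projection q" and a: "a \<in> A"
    and \<xi>: "norm \<xi> = 1" "blinfun_apply q \<xi> = \<xi>"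
  shows "q o\<^sub>L a o\<^sub>L q = cinner (blinfun_apply a \<xi>) \<xi> *\<^sub>C q"
proof -
  obtain c where c: "q o\<^sub>L a o\<^sub>L q = c *\<^sub>C q"
    using algebraically_minimal_corner[OF _ a] q by (auto simp: minimal_projection_def)
  have "cinner (blinfun_apply a \<xi>) \<xi> = cinner (blinfun_apply (q o\<^sub>L a o\<^sub>L q) \<xi>) \<xi>"
    using projection_cinner[OF minimal_projection_is_projection[OF q]] \<xi> by simp
  also have "\<dots> = c" unfolding c using \<xi> by (simp add: cinner_scaleC_left cinner_self)
  finally show ?thesis using c by simp
qed

lemma minimal_projection_unit_vector:
  assumes q: "minimal_projection q"
  shows "\<exists>\<xi>. norm \<xi> = 1 \<and> blinfun_apply q \<xi> = \<xi>"
proof -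
  have "\<exists>x. blinfun_apply q x \<noteq> 0"
    using minimal_projection_nonzero[OF q] by (metis blinfun_eqI zero_blinfun.rep_eq)
  then obtain x where x: "blinfun_apply q x \<noteq> 0" by blast
  have "blinfun_apply q (blinfun_apply q x /\<^sub>R norm (blinfun_apply q x)) =
      blinfun_apply q x /\<^sub>R norm (blinfun_apply q x)"
    using projection_idem_apply[OF minimal_projection_is_projection[OF q]]
    by (simp add: blinfun.scaleR_right)
  moreover have "norm (blinfun_apply q x /\<^sub>R norm (blinfun_apply q x)) = 1" using x by simp
  ultimately show ?thesis by blast
qed

text \<open>
  For \<open>a \<in> A\<close>, the element \<open>z = q + (1 - q) a q\<close> is a minimal idempotent. If \<open>p \<in> A\<close> is its range
  projection, then \<open>p q\<close> is a nonzero multiple of \<open>z\<close>, whence \<open>z\<^sup>*\<close> is a multiple of \<open>q p \<in> A\<close>.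
\<close>

lemma adj_left_ideal_in:
  assumes q: "minimal_projection q" and a: "a \<in> A"
  shows "adj (a o\<^sub>L q) \<in> A"
proof -
  note qA = minimal_projection_in[OF q] and qp = minimal_projection_is_projection[OF q]
  note qq = projection_idem[OF qp]
  obtain \<xi> where \<xi>: "norm \<xi> = 1" "blinfun_apply q \<xi> = \<xi>" using minimal_projection_unit_vector[OF q] by blast
  \<comment> \<open>Since \<open>q a q = c q\<close>, subtracting \<open>c q\<close> from
    \<open>a q\<close> leaves \<open>(1 - q) a q\<close>; this gives \<open>q z = q\<close> and
    \<open>z q = z\<close>.\<close>
  define c where "c = cinner (blinfun_apply a \<xi>) \<xi>"
  define z where "z = q + ((a o\<^sub>L q) - c *\<^sub>C q)"
  have zA: "z \<in> A" unfolding z_def using a qA by (intro add_in diff_in compose_in scaleC_in)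
  have zq: "z o\<^sub>L q = z" by (simp add: z_def compose_bilinear compose_assoc qq)
  have "q o\<^sub>L a o\<^sub>L q = c *\<^sub>C q" using minimal_projection_corner[OF q a \<xi>] by (simp add: c_def)
  then have qz: "q o\<^sub>L z = q"
    by (simp add: z_def compose_bilinear compose_assoc[symmetric] qq compose_scaleC[OF qA])
  have zz: "z o\<^sub>L z = z" using zq qz by (metis compose_assoc)
  have "algebraically_minimal_idempotent A z"
  proof -
    have "z o\<^sub>L b o\<^sub>L z \<in> range (\<lambda>c. c *\<^sub>C z)" if b: "b \<in> A" for b
    proof -
      have "z o\<^sub>L b o\<^sub>L z = z o\<^sub>L (q o\<^sub>L (b o\<^sub>L z) o\<^sub>L q)"
        using zq by (metis compose_assoc)
      also have "q o\<^sub>L (b o\<^sub>L z) o\<^sub>L q = cinner (blinfun_apply (b o\<^sub>L z) \<xi>) \<xi> *\<^sub>C q"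
        using minimal_projection_corner[OF q compose_in[OF b zA] \<xi>] .
      finally show ?thesis by (simp add: compose_scaleC[OF zA] zq)
    qed
    moreover have "c *\<^sub>C z \<in> {z o\<^sub>L b o\<^sub>L z | b. b \<in> A}" for c
    proof -
      have "c *\<^sub>C z = z o\<^sub>L (c *\<^sub>C z) o\<^sub>L z" using zz by (simp add: compose_scaleC[OF zA])
      then show ?thesis using scaleC_in[OF zA] by blast
    qed
    ultimately show ?thesis
      using zA zz unfolding algebraically_minimal_idempotent_def by blast
  qed
  then obtain p where pA: "p \<in> A" and rp: "is_range_projection p z" using range_projection by blast
  have pp: "is_projection p" using rp by (simp add: is_range_projection_def)
  have pz: "p o\<^sub>L z = z" and zp: "z o\<^sub>L p = p" using range_projection_compose[OF rp zz] by auto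
  define \<mu> where "\<mu> = cinner (blinfun_apply p \<xi>) \<xi>"
  have pq: "p o\<^sub>L q = \<mu> *\<^sub>C z"
  proof -
    have "p o\<^sub>L q = z o\<^sub>L (q o\<^sub>L p o\<^sub>L q)" using zp zq by (metis compose_assoc)
    then show ?thesis
      using minimal_projection_corner[OF q pA \<xi>] by (simp add: \<mu>_def compose_scaleC[OF zA] zq)
  qed
  have "adj (p o\<^sub>L q) = q o\<^sub>L p"
    using adj_compose[OF in_bounded[OF pA] in_bounded[OF qA]] projection_adj[OF pp] projection_adj[OF qp]
    by simp
  then have qp_adj: "q o\<^sub>L p = cnj \<mu> *\<^sub>C adj z" by (simp add: pq adj_scaleC in_bounded[OF zA])
  \<comment> \<open>Otherwise \<open>q p = 0\<close>, and \<open>p z = z\<close> would give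
    \<open>q = q z = q p z = 0\<close>.\<close>
  have "\<mu> \<noteq> 0"
  proof
    assume "\<mu> = 0"
    then have "q o\<^sub>L p o\<^sub>L z = 0" using qp_adj by simp
    then have "q o\<^sub>L z = 0" using pz by (simp add: compose_assoc)
    then show False using qz minimal_projection_nonzero[OF q] by simp
  qed
  then have "adj z = inverse (cnj \<mu>) *\<^sub>C (q o\<^sub>L p)" by (simp add: qp_adj)
  then have adj_z: "adj z \<in> A" using scaleC_in[OF compose_in[OF qA pA]] by simp
  have "a o\<^sub>L q = (z - q) + c *\<^sub>C q" by (simp add: z_def)
  then have "adj (a o\<^sub>L q) = (adj z - q) + cnj c *\<^sub>C q"
    using zA qA by (simp add: adj_add adj_diff adj_scaleC diff_in scaleC_in in_bounded projection_adj[OF qp])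
  then show ?thesis using adj_z qA by (simp add: add_in diff_in scaleC_in)
qed

text \<open>The operator \<open>T = adj (b q) a\<close> belongs to \<open>A\<close>, so its
  \<open>q\<close>-corner is a scalar, which can be computed at \<open>\<xi>\<close>. Consequently a
  \<xi> |-> a \<eta> is isometric up to the factor \<open>norm \<eta>\<close>, and orthogonal
  vectors in the range of \<open>q\<close> generate orthogonal copies of
  \<open>A \<xi>\<close>.\<close>

lemma cinner_orbit:
  assumes q: "minimal_projection q" and a: "a \<in> A" and b: "b \<in> A"
    and \<xi>: "norm \<xi> = 1" "blinfun_apply q \<xi> = \<xi>"
    and \<eta>: "blinfun_apply q \<eta> = \<eta>" and \<zeta>: "blinfun_apply q \<zeta> = \<zeta>"
  shows "cinner (blinfun_apply a \<eta>) (blinfun_apply b \<zeta>) =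
    cinner (blinfun_apply a \<xi>) (blinfun_apply b \<xi>) * cinner \<eta> \<zeta>"
proof -
  note qA = minimal_projection_in[OF q] and qp = minimal_projection_is_projection[OF q]
  have bq: "b o\<^sub>L q \<in> bounded_operators" using b qA compose_in in_bounded by blast
  define T where "T = adj (b o\<^sub>L q) o\<^sub>L a"
  have T: "cinner (blinfun_apply T x) y = cinner (blinfun_apply a x) (blinfun_apply b y)"
    if "blinfun_apply q y = y" for x y
    unfolding T_def using cinner_adj_left[OF bq] that by simp
  have TA: "T \<in> A" unfolding T_def using compose_in[OF adj_left_ideal_in[OF q b] a] .
  have "cinner (blinfun_apply a \<eta>) (blinfun_apply b \<zeta>) = cinner (blinfun_apply (q o\<^sub>L T o\<^sub>L q) \<eta>) \<zeta>"
    using T[OF \<zeta>, of \<eta>] projection_cinner[OF qp] \<eta> \<zeta> by simp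
  also have "\<dots> = cinner (blinfun_apply T \<xi>) \<xi> * cinner \<eta> \<zeta>"
    unfolding minimal_projection_corner[OF q TA \<xi>] using \<eta> by (simp add: cinner_scaleC_left)
  also have "cinner (blinfun_apply T \<xi>) \<xi> = cinner (blinfun_apply a \<xi>) (blinfun_apply b \<xi>)"
    using T[OF \<xi>(2)] .
  finally show ?thesis .
qed

lemma norm_orbit:
  assumes q: "minimal_projection q" and a: "a \<in> A"
    and \<xi>: "norm \<xi> = 1" "blinfun_apply q \<xi> = \<xi>" and \<eta>: "blinfun_apply q \<eta> = \<eta>"
  shows "norm (blinfun_apply a \<eta>) = norm (blinfun_apply a \<xi>) * norm \<eta>"
proof -
  have "complex_of_real ((norm (blinfun_apply a \<eta>))\<^sup>2) =
      complex_of_real ((norm (blinfun_apply a \<xi>) * norm \<eta>)\<^sup>2)"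
    using cinner_orbit[OF q a a \<xi> \<eta> \<eta>] by (simp add: cinner_self power_mult_distrib)
  then have "(norm (blinfun_apply a \<eta>))\<^sup>2 = (norm (blinfun_apply a \<xi>) * norm \<eta>)\<^sup>2"
    by (simp only: of_real_eq_iff)
  then show ?thesis by (rule power2_eq_imp_eq) auto
qed

section \<open>The subspaces \<open>A \<xi>\<close> and adjoints of \<open>q A\<close>\<close>

definition orbit :: "'h \<Rightarrow> 'h set" where
  "orbit \<xi> = (\<lambda>a. blinfun_apply a \<xi>) ` A"

lemma orbit_csubspace: "csubspace (orbit \<xi>)"
  unfolding csubspace_def
proof (intro conjI ballI allI)
  show "0 \<in> orbit \<xi>" unfolding orbit_def using zero_in by (intro image_eqI[of _ _ 0]) auto
  fix x y c assume "x \<in> orbit \<xi>" "y \<in> orbit \<xi>"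
  then obtain a b where ab: "a \<in> A" "b \<in> A" "x = blinfun_apply a \<xi>" "y = blinfun_apply b \<xi>"
    by (auto simp: orbit_def)
  show "x + y \<in> orbit \<xi>" unfolding orbit_def
    using ab add_in by (intro image_eqI[of _ _ "a + b"]) (auto simp: blinfun.add_left)
  show "c *\<^sub>C x \<in> orbit \<xi>" unfolding orbit_def
    using ab scaleC_in by (intro image_eqI[of _ _ "c *\<^sub>C a"]) auto
qed

text \<open>By \<open>norm_orbit\<close> the map a q |-> a \<xi> is isometric, so a convergent
  sequence in the orbit lifts to a Cauchy sequence in \<open>A\<close>, whose limit yields the limit
  vector.\<close>

lemma orbit_closed:
  assumes q: "minimal_projection q" and \<xi>: "norm \<xi> = 1" "blinfun_apply q \<xi> = \<xi>"
  shows "closed (orbit \<xi>)"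
  unfolding closed_sequential_limits
proof (intro allI impI)
  fix f l assume f: "(\<forall>n. f n \<in> orbit \<xi>) \<and> f \<longlonglongrightarrow> l"
  note qA = minimal_projection_in[OF q] and qp = minimal_projection_is_projection[OF q]
  have "\<forall>n. \<exists>a. a \<in> A \<and> f n = blinfun_apply a \<xi>" using f by (auto simp: orbit_def)
  from choice[OF this] obtain a where a: "\<And>n. a n \<in> A" "\<And>n. f n = blinfun_apply (a n) \<xi>" by blast
  have bound: "norm ((a m o\<^sub>L q) - (a n o\<^sub>L q)) \<le> norm (f m - f n)" for m n
  proof (rule norm_blinfun_bound)
    fix x
    have "norm (blinfun_apply ((a m o\<^sub>L q) - (a n o\<^sub>L q)) x) = norm (blinfun_apply (a m - a n) (blinfun_apply q x))"
      by (simp add: blinfun.diff_left)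
    also have "\<dots> = norm (blinfun_apply (a m - a n) \<xi>) * norm (blinfun_apply q x)"
      using norm_orbit[OF q diff_in[OF a(1) a(1)] \<xi> projection_idem_apply[OF qp]] .
    also have "\<dots> \<le> norm (f m - f n) * norm x"
      using projection_contractive(1)[OF qp] by (intro mult_mono) (auto simp: a(2) blinfun.diff_left)
    finally show "norm (blinfun_apply ((a m o\<^sub>L q) - (a n o\<^sub>L q)) x) \<le> norm (f m - f n) * norm x" .
  qed simp
  have "Cauchy f" using f LIMSEQ_imp_Cauchy by blast
  then have "Cauchy (\<lambda>n. a n o\<^sub>L q)"
    unfolding Cauchy_iff using bound by (meson order_le_less_trans)
  then obtain b where b: "(\<lambda>n. a n o\<^sub>L q) \<longlonglongrightarrow> b"
    using Cauchy_convergent_iff convergent_def by blast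
  have "b \<in> A" using closed_sequentially[OF closed _ b] compose_in[OF a(1) qA] by blast
  have "(\<lambda>n. blinfun_apply (a n o\<^sub>L q) \<xi>) \<longlonglongrightarrow> blinfun_apply b \<xi>"
    using b by (intro blinfun.tendsto tendsto_const)
  then have "f \<longlonglongrightarrow> blinfun_apply b \<xi>" by (simp add: \<xi> a(2)[symmetric])
  then have "l = blinfun_apply b \<xi>" using f LIMSEQ_unique by blast
  then show "l \<in> orbit \<xi>" using \<open>b \<in> A\<close> by (auto simp: orbit_def)
qed

text \<open>
  By Riesz' theorem on \<open>A \<xi>\<close>, the functional \<open>c \<xi> \<mapsto> \<langle>q a c \<xi>, \<xi>\<rangle>\<close> is given by some \<open>b \<xi>\<close>. The
  difference of \<open>q a\<close> and \<open>(b q)\<^sup>*\<close> then annihilates \<open>A q\<close>, hence vanishes.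
\<close>

lemma adj_right_ideal_in:
  assumes q: "minimal_projection q" and a: "a \<in> A"
  shows "adj (q o\<^sub>L a) \<in> A"
proof -
  note qA = minimal_projection_in[OF q] and qp = minimal_projection_is_projection[OF q]
  note qq = projection_idem[OF qp]
  obtain \<xi> where \<xi>: "norm \<xi> = 1" "blinfun_apply q \<xi> = \<xi>" using minimal_projection_unit_vector[OF q] by blast
  define x where "x = q o\<^sub>L a"
  have xA: "x \<in> A" unfolding x_def by (rule compose_in[OF qA a])
  define w where "w = blinfun_apply (adj x) \<xi>"
  define P where "P = proj_onto (orbit \<xi>)"
  note P = is_projection_proj_onto[OF orbit_csubspace orbit_closed[OF q \<xi>], folded P_def]
    proj_onto_in[OF orbit_csubspace orbit_closed[OF q \<xi>], folded P_def]
    proj_onto_id[OF orbit_csubspace orbit_closed[OF q \<xi>], folded P_def]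
  obtain b where b: "b \<in> A" "blinfun_apply P w = blinfun_apply b \<xi>" using P(2)[of w] by (auto simp: orbit_def)
  have bq: "b o\<^sub>L q \<in> A" by (rule compose_in[OF b(1) qA])
  define y where "y = adj (b o\<^sub>L q)"
  have yA: "y \<in> A" unfolding y_def by (rule adj_left_ideal_in[OF q b(1)])
  have qx: "q o\<^sub>L x = x" unfolding x_def using qq by (metis compose_assoc)
  have qy: "q o\<^sub>L y = y"
    using adj_compose[OF in_bounded[OF b(1)] in_bounded[OF qA]] projection_adj[OF qp] qq
    unfolding y_def by (metis compose_assoc)
  \<comment> \<open>Because \<open>q k = k\<close>, the product \<open>k c q\<close> is a corner
    element and is determined by one scalar; it remains to compare the scalars of \<open>x\<close>
    and \<open>y\<close>.\<close>
  have corner: "k o\<^sub>L c o\<^sub>L q = cinner (blinfun_apply k (blinfun_apply c \<xi>)) \<xi> *\<^sub>C q"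
    if "k \<in> A" "q o\<^sub>L k = k" "c \<in> A" for k c
    using minimal_projection_corner[OF q compose_in[OF that(1,3)] \<xi>] that(2)
    by (simp add: compose_assoc[symmetric])
  have same: "x o\<^sub>L c o\<^sub>L q = y o\<^sub>L c o\<^sub>L q" if c: "c \<in> A" for c
  proof -
    have "blinfun_apply c \<xi> \<in> orbit \<xi>" using c by (simp add: orbit_def)
    have "cinner (blinfun_apply x (blinfun_apply c \<xi>)) \<xi> = cinner (blinfun_apply c \<xi>) w"
      unfolding w_def using cinner_adj_right[OF in_bounded[OF xA]] by simp
    also have "\<dots> = cinner (blinfun_apply P (blinfun_apply c \<xi>)) w"
      using P(3)[OF \<open>blinfun_apply c \<xi> \<in> orbit \<xi>\<close>] by simp
    also have "\<dots> = cinner (blinfun_apply c \<xi>) (blinfun_apply b \<xi>)"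
      using projection_cinner[OF P(1)] b(2) by simp
    also have "\<dots> = cinner (blinfun_apply y (blinfun_apply c \<xi>)) \<xi>"
      unfolding y_def using cinner_adj_left[OF in_bounded[OF bq]] \<xi>(2) by simp
    finally show ?thesis using corner[OF xA qx c] corner[OF yA qy c] by simp
  qed
  define k where "k = x - y"
  have kA: "k \<in> A" unfolding k_def by (rule diff_in[OF xA yA])
  have "k = 0"
  proof (rule semiprime_element[OF kA])
    fix c assume c: "c \<in> A"
    have "q o\<^sub>L k = k" by (simp add: k_def compose_bilinear qx qy)
    then have "k o\<^sub>L c o\<^sub>L k = (k o\<^sub>L c o\<^sub>L q) o\<^sub>L k" by (simp add: compose_assoc)
    also have "k o\<^sub>L c o\<^sub>L q = 0" using same[OF c] by (simp add: k_def compose_bilinear)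
    finally show "k o\<^sub>L c o\<^sub>L k = 0" by simp
  qed
  then have "adj (q o\<^sub>L a) = adj (adj (b o\<^sub>L q))" by (simp add: k_def x_def y_def)
  also have "\<dots> = b o\<^sub>L q" by (rule adj_adj[OF in_bounded[OF bq]])
  finally show ?thesis using bq by simp
qed

section \<open>Induction over the socle and self-adjointness of \<open>A\<close>\<close>

lemma minimal_right_ideal_projection:
  assumes J: "minimal_right_ideal A J"
  shows "\<exists>q. minimal_projection q \<and> J = {q o\<^sub>L a | a. a \<in> A}"
proof -
  have "has_left_cai J" using left_cai_iff_range_projection range_projection J by blast
  then obtain q where q: "q \<in> A" "is_projection q" "J = {q o\<^sub>L a | a. a \<in> A}"
    using left_cai_iff_projection[OF J] by blast
  have "q \<noteq> 0"
  proof
    assume "q = 0"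
    then have "J = {0}" using q(3) zero_in by auto
    then show False using J by (simp add: minimal_right_ideal_def)
  qed
  then have "minimal_projection q"
    using minimal_right_ideal_corner J q projection_idem[OF q(2)] by (simp add: minimal_projection_def)
  then show ?thesis using q(3) by blast
qed

text \<open>Every minimal right ideal is \<open>q A\<close> for a minimal projection
  \<open>q\<close>, so a property stable under sums has only to be checked on 0 and on products
  \<open>q a\<close>.\<close>

lemma socle_induct [consumes 1, case_names zero add ideal]:
  assumes "s \<in> socle A" and "P 0" and add: "\<And>s t. P s \<Longrightarrow> P t \<Longrightarrow> P (s + t)"
    and ideal: "\<And>q a. minimal_projection q \<Longrightarrow> a \<in> A \<Longrightarrow> P (q o\<^sub>L a)"
  shows "P s"
proof -
  obtain xs where xs: "s = sum_list xs" "set xs \<subseteq> \<Union> {J. minimal_right_ideal A J}"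
    using assms(1) by (auto simp: socle_def)
  have "P x" if "minimal_right_ideal A J" "x \<in> J" for x J
    using minimal_right_ideal_projection[OF that(1)] that(2) ideal by blast
  then have "P (sum_list xs)"
    using xs(2) assms(2) by (induction xs) (auto intro!: add)
  then show ?thesis by (simp add: xs(1))
qed

lemma socle_subset: "socle A \<subseteq> A"
  using closure_subset dense_socle by blast

lemma adj_in:
  assumes a: "a \<in> A"
  shows "adj a \<in> A"
proof -
  have soc: "adj s \<in> A" if "s \<in> socle A" for s
  proof -
    \<comment> \<open>Membership in \<open>A\<close> is carried through the induction because
      \<open>adj_add\<close> is applied to elements of \<open>bounded_operators\<close>.\<close>
    have "s \<in> A \<and> adj s \<in> A"
      using that
    proof (induction rule: socle_induct)
      case zero
      have "adj (0 :: 'h op) = 0" by (rule adj_unique) (simp_all add: bounded_operators_zero)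
      then show ?case using zero_in by simp
    qed (auto simp: adj_add in_bounded add_in compose_in minimal_projection_in adj_right_ideal_in)
    then show ?thesis by simp
  qed
  obtain f where f: "\<And>n. f n \<in> socle A" "f \<longlonglongrightarrow> a"
    using a dense_socle closure_sequential by blast
  have "(\<lambda>n. adj (f n)) \<longlonglongrightarrow> adj a"
    using f a socle_subset in_bounded by (intro tendsto_adj) auto
  then show ?thesis by (rule closed_sequentially[OF closed soc[OF f(1)]])
qed

subsection \<open>Equivalence of minimal projections\<close>

text \<open>For minimal projections in the self-adjoint algebra \<open>A\<close> this is Murray--von
  Neumann equivalence: a nonzero element of \<open>p A q\<close> is a multiple of a partial
  isometry.\<close>

definition equivalent :: "'h op \<Rightarrow> 'h op \<Rightarrow> bool" where
  "equivalent p q \<longleftrightarrow> (\<exists>a\<in>A. p o\<^sub>L a o\<^sub>L q \<noteq> 0)"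

lemma adj_zero_iff: "T \<in> bounded_operators \<Longrightarrow> adj T = 0 \<Longrightarrow> T = 0"
  by (metis adj_adj adj_unique bounded_operators_zero cinner_zero_left cinner_zero_right zero_blinfun.rep_eq)

lemma adj_compose_self_zero:
  assumes "T \<in> bounded_operators" "adj T o\<^sub>L T = 0"
  shows "T = 0"
proof (rule blinfun_eqI)
  fix x
  have "cinner (blinfun_apply T x) (blinfun_apply T x) = cinner (blinfun_apply (adj T o\<^sub>L T) x) x"
    by (simp add: cinner_adj_left[OF assms(1)])
  then show "blinfun_apply T x = blinfun_apply 0 x" by (simp add: assms(2))
qed

lemma equivalent_refl: "minimal_projection q \<Longrightarrow> equivalent q q"
  using projection_idem[of q] minimal_projection_in[of q]
  by (auto simp: equivalent_def minimal_projection_def intro!: bexI[of _ q])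

text \<open>For \<open>x = q a r \<noteq> 0\<close> the product \<open>x (adj x)\<close> lies in the
  corner of \<open>q\<close>, hence equals \<open>c q\<close>, with \<open>c \<noteq> 0\<close>
  because \<open>x \<noteq> 0\<close>. The factorization through \<open>r\<close> transports
  questions about \<open>q\<close> to a chosen representative of its class.\<close>

lemma equivalent_factor:
  assumes q: "minimal_projection q" and r: "minimal_projection r" and qr: "equivalent q r"
  shows "\<exists>u\<in>A. \<exists>v\<in>A. q = u o\<^sub>L v \<and> r o\<^sub>L v = v \<and> v o\<^sub>L q = v"
proof -
  note qA = minimal_projection_in[OF q] and rA = minimal_projection_in[OF r]
  note qp = minimal_projection_is_projection[OF q] and rp = minimal_projection_is_projection[OF r]
  obtain a where a: "a \<in> A" "q o\<^sub>L a o\<^sub>L r \<noteq> 0" using qr by (auto simp: equivalent_def)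
  define x where "x = q o\<^sub>L a o\<^sub>L r"
  have xA: "x \<in> A" and xb: "x \<in> bounded_operators"
    unfolding x_def using a qA rA compose_in in_bounded by blast+
  have "q o\<^sub>L x = x" "x o\<^sub>L r = x"
    unfolding x_def using projection_idem[OF qp] projection_idem[OF rp] by (metis compose_assoc)+
  then have v: "adj x o\<^sub>L q = adj x" "r o\<^sub>L adj x = adj x"
    using adj_compose[OF in_bounded[OF qA] xb] adj_compose[OF xb in_bounded[OF rA]]
      projection_adj[OF qp] projection_adj[OF rp] by auto
  obtain c where "q o\<^sub>L (x o\<^sub>L adj x) o\<^sub>L q = c *\<^sub>C q"
    using algebraically_minimal_corner compose_in[OF xA adj_in[OF xA]] q
    unfolding minimal_projection_def by metis
  then have c: "x o\<^sub>L adj x = c *\<^sub>C q"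
    using v \<open>q o\<^sub>L x = x\<close> by (metis compose_assoc)
  have "c \<noteq> 0"
  proof
    assume "c = 0"
    then have "adj (adj x) o\<^sub>L adj x = 0" using c adj_adj[OF xb] by simp
    then have "adj x = 0" using adj_compose_self_zero adj_bounded[OF xb] by blast
    then show False using adj_zero_iff[OF xb] a(2) x_def by simp
  qed
  then have "q = (inverse c *\<^sub>C x) o\<^sub>L adj x" by (simp add: c)
  then show ?thesis using v scaleC_in[OF xA] adj_in[OF xA] by blast
qed

lemma equivalent_sym:
  assumes "minimal_projection q" "minimal_projection r" "equivalent q r"
  shows "equivalent r q"
proof -
  obtain u v where uv: "v \<in> A" "q = u o\<^sub>L v" "r o\<^sub>L v = v" "v o\<^sub>L q = v"
    using equivalent_factor[OF assms] by blast
  have "v \<noteq> 0" using uv(2) minimal_projection_nonzero[OF assms(1)] by auto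
  then have "r o\<^sub>L v o\<^sub>L q \<noteq> 0" using uv by simp
  then show ?thesis using uv(1) by (auto simp: equivalent_def)
qed

text \<open>Writing the middle projection as \<open>q = u v\<close> with \<open>p v = v\<close>
  turns a nonzero \<open>q a r\<close> into \<open>u (p (v a) r)\<close>.\<close>

lemma equivalent_trans:
  assumes "minimal_projection p" "minimal_projection q" "minimal_projection r"
    and pq: "equivalent p q" and qr: "equivalent q r"
  shows "equivalent p r"
proof -
  obtain u v where uv: "u \<in> A" "v \<in> A" "q = u o\<^sub>L v" "p o\<^sub>L v = v"
    using equivalent_factor[OF assms(2,1) equivalent_sym[OF assms(1,2) pq]] by blast
  obtain a where a: "a \<in> A" "q o\<^sub>L a o\<^sub>L r \<noteq> 0" using qr by (auto simp: equivalent_def)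
  have "q o\<^sub>L a o\<^sub>L r = u o\<^sub>L (p o\<^sub>L (v o\<^sub>L a) o\<^sub>L r)"
    using uv by (metis compose_assoc)
  then have "p o\<^sub>L (v o\<^sub>L a) o\<^sub>L r \<noteq> 0" using a(2) by auto
  then show ?thesis using compose_in[OF uv(2) a(1)] by (auto simp: equivalent_def)
qed

text \<open>The index type is that of the vectors, so each class is labelled by a unit vector in the
  range of its chosen projection, and \<open>r\<close> recovers the projection from the
  label.\<close>

lemma representatives_exist:
  "\<exists>(I :: 'h set) r. (\<forall>\<xi>\<in>I. minimal_projection (r \<xi>) \<and> norm \<xi> = 1 \<and> blinfun_apply (r \<xi>) \<xi> = \<xi>) \<and>
     (\<forall>\<xi>\<in>I. \<forall>\<eta>\<in>I. \<xi> \<noteq> \<eta> \<longrightarrow> \<not> equivalent (r \<xi>) (r \<eta>)) \<and>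
     (\<forall>q. minimal_projection q \<longrightarrow> (\<exists>\<xi>\<in>I. equivalent q (r \<xi>)))"
proof -
  \<comment> \<open>The predicate depends only on the class of \<open>q\<close>, so the choice takes
    the same value on equivalent projections.\<close>
  define rep where "rep q = (SOME p. minimal_projection p \<and> equivalent q p)" for q
  have rep: "minimal_projection (rep q)" "equivalent q (rep q)" if "minimal_projection q" for q
  proof -
    have "minimal_projection (rep q) \<and> equivalent q (rep q)"
      unfolding rep_def by (rule someI[of _ q]) (use that equivalent_refl in blast)
    then show "minimal_projection (rep q)" "equivalent q (rep q)" by auto
  qed
  have rep_eq: "rep p = rep q" if "minimal_projection p" "minimal_projection q" "equivalent p q" for p q
  proof -
    have "(minimal_projection s \<and> equivalent p s) = (minimal_projection s \<and> equivalent q s)" for s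
      using that equivalent_sym equivalent_trans by blast
    then show ?thesis by (simp add: rep_def)
  qed
  have rep_inj: "rep p = rep q"
    if pq: "minimal_projection p" "minimal_projection q" "equivalent (rep p) (rep q)" for p q
  proof (rule rep_eq)
    have "equivalent p (rep q)"
      using equivalent_trans[OF pq(1) rep(1)[OF pq(1)] rep(1)[OF pq(2)] rep(2)[OF pq(1)] pq(3)] .
    then show "equivalent p q"
      using equivalent_trans[OF pq(1) rep(1)[OF pq(2)] pq(2)]
        equivalent_sym[OF pq(2) rep(1)[OF pq(2)] rep(2)[OF pq(2)]] by blast
  qed (use pq in auto)
  define vec where "vec q = (SOME \<xi>. norm \<xi> = 1 \<and> blinfun_apply q \<xi> = \<xi>)" for q :: "'h op"
  have vec: "norm (vec q) = 1 \<and> blinfun_apply q (vec q) = vec q" if "minimal_projection q" for q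
    unfolding vec_def by (rule someI_ex) (rule minimal_projection_unit_vector[OF that])
  define Q where "Q = rep ` {q. minimal_projection q}"
  have Q: "minimal_projection q" if "q \<in> Q" for q using that rep by (auto simp: Q_def)
  have Q_eq: "p = q" if "p \<in> Q" "q \<in> Q" "equivalent p q" for p q
    using that rep_inj by (auto simp: Q_def)
  have inj: "inj_on vec Q"
  proof (rule inj_onI)
    fix p q assume pq: "p \<in> Q" "q \<in> Q" "vec p = vec q"
    \<comment> \<open>A shared vector is fixed by \<open>p p q\<close>, which is therefore nonzero;
      inequivalent representatives thus get different labels.\<close>
    have "blinfun_apply (p o\<^sub>L p o\<^sub>L q) (vec q) = vec q"
      using vec[OF Q[OF pq(1)]] vec[OF Q[OF pq(2)]] pq(3) by simp
    moreover have "vec q \<noteq> 0" using vec[OF Q[OF pq(2)]] by auto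
    ultimately have "p o\<^sub>L p o\<^sub>L q \<noteq> 0" by (metis zero_blinfun.rep_eq)
    then show "p = q"
      using Q_eq pq minimal_projection_in[OF Q[OF pq(1)]] by (auto simp: equivalent_def)
  qed
  have "\<exists>\<xi>\<in>vec ` Q. equivalent q (inv_into Q vec \<xi>)" if q: "minimal_projection q" for q
    using rep[OF q] q inj by (intro bexI[of _ "vec (rep q)"]) (auto simp: Q_def)
  moreover have "minimal_projection (inv_into Q vec \<xi>) \<and> norm \<xi> = 1 \<and> blinfun_apply (inv_into Q vec \<xi>) \<xi> = \<xi>"
    if "\<xi> \<in> vec ` Q" for \<xi>
    using that inj Q vec by auto
  moreover have "\<not> equivalent (inv_into Q vec \<xi>) (inv_into Q vec \<eta>)"
    if "\<xi> \<in> vec ` Q" "\<eta> \<in> vec ` Q" "\<xi> \<noteq> \<eta>" for \<xi> \<eta>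
    using that inj by (auto dest: Q_eq)
  ultimately show ?thesis by (intro exI[of _ "vec ` Q"] exI[of _ "inv_into Q vec"]) blast
qed

end

section \<open>Matrix norms and compact operators\<close>

text \<open>A crude entrywise bound; it gives access to the supremum in \<open>matrix_norm\<close>,
  since \<open>Sup\<close> on the reals is controlled only for bounded sets.\<close>

lemma matrix_norm_bdd_above:
  fixes T :: "nat \<Rightarrow> nat \<Rightarrow> 'h :: complex_hilbert_space op"
  shows "bdd_above {sqrt (\<Sum>i<n. (norm (\<Sum>j<n. blinfun_apply (T i j) (x j)))\<^sup>2) | x.
     (\<Sum>j<n. (norm (x j))\<^sup>2) \<le> 1}"
proof (rule bdd_aboveI)
  fix z
  assume "z \<in> {sqrt (\<Sum>i<n. (norm (\<Sum>j<n. blinfun_apply (T i j) (x j)))\<^sup>2) | x.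
     (\<Sum>j<n. (norm (x j))\<^sup>2) \<le> 1}"
  then obtain x where z: "z = sqrt (\<Sum>i<n. (norm (\<Sum>j<n. blinfun_apply (T i j) (x j)))\<^sup>2)"
    and x: "(\<Sum>j<n. (norm (x j))\<^sup>2) \<le> 1" by blast
  have x1: "norm (x j) \<le> 1" if "j < n" for j
  proof -
    have "(norm (x j))\<^sup>2 \<le> (\<Sum>j<n. (norm (x j))\<^sup>2)"
      using that by (intro member_le_sum) auto
    then have "(norm (x j))\<^sup>2 \<le> 1\<^sup>2" using x by simp
    then show ?thesis by (rule power2_le_imp_le) simp
  qed
  have "norm (\<Sum>j<n. blinfun_apply (T i j) (x j)) \<le> (\<Sum>j<n. norm (T i j))" for i
  proof (rule sum_norm_le)
    fix j assume "j \<in> {..<n}"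
    then have "norm (T i j) * norm (x j) \<le> norm (T i j) * 1" using x1 by (intro mult_left_mono) auto
    then show "norm (blinfun_apply (T i j) (x j)) \<le> norm (T i j)"
      using norm_blinfun[of "T i j" "x j"] by simp
  qed
  then show "z \<le> sqrt (\<Sum>i<n. (\<Sum>j<n. norm (T i j))\<^sup>2)"
    unfolding z by (intro real_sqrt_le_mono sum_mono power_mono) auto
qed

lemma matrix_norm_upper:
  assumes "(\<Sum>j<n. (norm (x j))\<^sup>2) \<le> 1"
  shows "sqrt (\<Sum>i<n. (norm (\<Sum>j<n. blinfun_apply (T i j) (x j)))\<^sup>2) \<le> matrix_norm n T"
  unfolding matrix_norm_def using assms by (intro cSup_upper matrix_norm_bdd_above) blast

lemma matrix_norm_nonneg: "0 \<le> matrix_norm n T"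
  using matrix_norm_upper[of "\<lambda>_. 0" n T] by simp

lemma matrix_norm_bound:
  fixes x :: "nat \<Rightarrow> 'h :: complex_hilbert_space"
  shows "(\<Sum>i<n. (norm (\<Sum>j<n. blinfun_apply (T i j) (x j)))\<^sup>2) \<le>
    (matrix_norm n T)\<^sup>2 * (\<Sum>j<n. (norm (x j))\<^sup>2)"
proof -
  define N where "N = (\<Sum>j<n. (norm (x j))\<^sup>2)"
  have N0: "N \<ge> 0" unfolding N_def by (intro sum_nonneg) auto
  show ?thesis
  proof (cases "N = 0")
    case True
    then have "x j = 0" if "j < n" for j
      using that sum_nonneg_eq_0_iff[of "{..<n}" "\<lambda>j. (norm (x j))\<^sup>2"] by (simp add: N_def)
    then show ?thesis by simp
  next
    case False
    define t where "t = 1 / sqrt N"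
    have t: "t\<^sup>2 = 1 / N" using N0 by (simp add: t_def power_divide)
    define y where "y j = t *\<^sub>R x j" for j
    have "(\<Sum>j<n. (norm (y j))\<^sup>2) = (\<Sum>j<n. t\<^sup>2 * (norm (x j))\<^sup>2)"
      by (simp add: y_def power_mult_distrib)
    also have "\<dots> = t\<^sup>2 * N" by (simp add: sum_distrib_left N_def)
    also have "\<dots> = 1" using False by (simp add: t)
    finally have "sqrt (\<Sum>i<n. (norm (\<Sum>j<n. blinfun_apply (T i j) (y j)))\<^sup>2) \<le> matrix_norm n T"
      by (intro matrix_norm_upper) simp
    then have "(\<Sum>i<n. (norm (\<Sum>j<n. blinfun_apply (T i j) (y j)))\<^sup>2) \<le> (matrix_norm n T)\<^sup>2"
      by (rule sqrt_le_D)
    also have "(\<Sum>i<n. (norm (\<Sum>j<n. blinfun_apply (T i j) (y j)))\<^sup>2) =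
        (\<Sum>i<n. (norm (t *\<^sub>R (\<Sum>j<n. blinfun_apply (T i j) (x j))))\<^sup>2)"
      by (simp only: y_def blinfun.scaleR_right scaleR_sum_right)
    also have "\<dots> = (1 / N) * (\<Sum>i<n. (norm (\<Sum>j<n. blinfun_apply (T i j) (x j)))\<^sup>2)"
      by (simp add: power_mult_distrib t[symmetric] sum_distrib_left)
    finally show ?thesis using False N0 by (simp add: N_def[symmetric] field_simps)
  qed
qed

lemma matrix_norm_le:
  fixes T :: "nat \<Rightarrow> nat \<Rightarrow> 'h :: complex_hilbert_space op"
  assumes "M \<ge> 0"
    and le: "\<And>x. (\<Sum>i<n. (norm (\<Sum>j<n. blinfun_apply (T i j) (x j)))\<^sup>2) \<le> M\<^sup>2 * (\<Sum>j<n. (norm (x j))\<^sup>2)"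
  shows "matrix_norm n T \<le> M"
  unfolding matrix_norm_def
proof (rule cSup_least)
  have "\<exists>x :: nat \<Rightarrow> 'h. (\<Sum>j<n. (norm (x j))\<^sup>2) \<le> 1" by (rule exI[of _ "\<lambda>_. 0"]) simp
  then show "{sqrt (\<Sum>i<n. (norm (\<Sum>j<n. blinfun_apply (T i j) (x j)))\<^sup>2) | x.
     (\<Sum>j<n. (norm (x j))\<^sup>2) \<le> 1} \<noteq> {}" by simp
  fix z
  assume "z \<in> {sqrt (\<Sum>i<n. (norm (\<Sum>j<n. blinfun_apply (T i j) (x j)))\<^sup>2) | x.
     (\<Sum>j<n. (norm (x j))\<^sup>2) \<le> 1}"
  then obtain x where z: "z = sqrt (\<Sum>i<n. (norm (\<Sum>j<n. blinfun_apply (T i j) (x j)))\<^sup>2)"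
    and x: "(\<Sum>j<n. (norm (x j))\<^sup>2) \<le> 1" by blast
  have "M\<^sup>2 * (\<Sum>j<n. (norm (x j))\<^sup>2) \<le> M\<^sup>2 * 1" using x by (intro mult_left_mono) auto
  then have "(\<Sum>i<n. (norm (\<Sum>j<n. blinfun_apply (T i j) (x j)))\<^sup>2) \<le> M\<^sup>2"
    using le[of x] by simp
  then show "z \<le> M" unfolding z using assms(1) by (rule real_le_lsqrt[rotated])
qed

section \<open>Compact operators and finite rank approximation\<close>

lemma compact_closure_iff:
  fixes S :: "'a :: complete_space set"
  shows "compact (closure S) \<longleftrightarrow> (\<forall>e>0. \<exists>k. finite k \<and> S \<subseteq> (\<Union>x\<in>k. ball x e))"
proof
  assume "compact (closure S)"
  then show "\<forall>e>0. \<exists>k. finite k \<and> S \<subseteq> (\<Union>x\<in>k. ball x e)"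
    unfolding compact_eq_totally_bounded using closure_subset[of S] by (meson order_trans)
next
  assume tb: "\<forall>e>0. \<exists>k. finite k \<and> S \<subseteq> (\<Union>x\<in>k. ball x e)"
  have "\<exists>k. finite k \<and> closure S \<subseteq> (\<Union>x\<in>k. ball x e)" if e: "e > 0" for e
  proof -
    \<comment> \<open>Passing to the closure turns open balls into closed ones; half the radius
      leaves room to open them again.\<close>
    have "e / 2 > 0" using e by simp
    with tb obtain k where k: "finite k" "S \<subseteq> (\<Union>x\<in>k. ball x (e / 2))" by meson
    have "closure S \<subseteq> (\<Union>x\<in>k. cball x (e / 2))"
    proof (rule closure_minimal)
      show "S \<subseteq> (\<Union>x\<in>k. cball x (e / 2))" using k(2) by force
      show "closed (\<Union>x\<in>k. cball x (e / 2))" using k(1) by auto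
    qed
    also have "\<dots> \<subseteq> (\<Union>x\<in>k. ball x e)" using e by force
    finally show ?thesis using k(1) by blast
  qed
  then show "compact (closure S)"
    unfolding compact_eq_totally_bounded by (simp add: complete_eq_closed)
qed

lemma compact_operator_iff:
  "compact_operator T \<longleftrightarrow> T \<in> bounded_operators \<and>
    (\<forall>e>0. \<exists>k. finite k \<and> (\<forall>x. norm x \<le> 1 \<longrightarrow> (\<exists>y\<in>k. dist y (blinfun_apply T x) < e)))"
proof -
  have "blinfun_apply T ` cball 0 1 \<subseteq> (\<Union>x\<in>k. ball x e) \<longleftrightarrow>
      (\<forall>x. norm x \<le> 1 \<longrightarrow> (\<exists>y\<in>k. dist y (blinfun_apply T x) < e))" for k e
    by (simp add: image_subset_iff Ball_def)
  then show ?thesis by (simp only: compact_operator_def compact_closure_iff)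
qed

lemma compact_operator_limit:
  assumes T: "T \<in> bounded_operators"
    and approx: "\<And>\<epsilon>. \<epsilon> > 0 \<Longrightarrow> \<exists>K. compact_operator K \<and> norm (T - K) < \<epsilon>"
  shows "compact_operator T"
  unfolding compact_operator_iff
proof (intro conjI allI impI T)
  fix e :: real assume e: "e > 0"
  then have e2: "e / 2 > 0" by simp
  obtain K where K: "compact_operator K" "norm (T - K) < e / 2" using approx[of "e / 2"] e by auto
  obtain k where k: "finite k" "\<And>x. norm x \<le> 1 \<Longrightarrow> \<exists>y\<in>k. dist y (blinfun_apply K x) < e / 2"
    using K(1) e2 unfolding compact_operator_iff by meson
  have "\<exists>y\<in>k. dist y (blinfun_apply T x) < e" if x: "norm x \<le> 1" for x
  proof -
    obtain y where y: "y \<in> k" "dist y (blinfun_apply K x) < e / 2" using k(2)[OF x] by blast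
    have "norm (blinfun_apply (T - K) x) \<le> norm (T - K) * norm x" by (rule norm_blinfun)
    also have "\<dots> \<le> norm (T - K) * 1" using x by (intro mult_left_mono) auto
    finally have "dist (blinfun_apply K x) (blinfun_apply T x) < e / 2"
      using K(2) by (simp add: dist_norm norm_minus_commute blinfun.diff_left)
    then have "dist y (blinfun_apply T x) < e"
      using y(2) dist_triangle[of y "blinfun_apply T x" "blinfun_apply K x"] by linarith
    then show ?thesis using y(1) by blast
  qed
  then show "\<exists>k. finite k \<and> (\<forall>x. norm x \<le> 1 \<longrightarrow> (\<exists>y\<in>k. dist y (blinfun_apply T x) < e))"
    using k(1) by blast
qed

lemma compact_operator_add:
  assumes S: "compact_operator S" and T: "compact_operator T"
  shows "compact_operator (S + T)"
  unfolding compact_operator_iff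
proof (intro conjI allI impI)
  show "S + T \<in> bounded_operators"
    using S T bounded_operators_add by (auto simp: compact_operator_def)
  fix e :: real assume e: "e > 0"
  then have e2: "e / 2 > 0" by simp
  obtain k where k: "finite k" "\<And>x. norm x \<le> 1 \<Longrightarrow> \<exists>y\<in>k. dist y (blinfun_apply S x) < e / 2"
    using S e2 unfolding compact_operator_iff by meson
  obtain l where l: "finite l" "\<And>x. norm x \<le> 1 \<Longrightarrow> \<exists>y\<in>l. dist y (blinfun_apply T x) < e / 2"
    using T e2 unfolding compact_operator_iff by meson
  have "\<exists>y\<in>(\<lambda>(a, b). a + b) ` (k \<times> l). dist y (blinfun_apply (S + T) x) < e" if x: "norm x \<le> 1" for x
  proof -
    obtain a b where ab: "a \<in> k" "dist a (blinfun_apply S x) < e / 2" "b \<in> l" "dist b (blinfun_apply T x) < e / 2"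
      using k(2)[OF x] l(2)[OF x] by blast
    have "dist (a + b) (blinfun_apply (S + T) x) < e"
      using ab(2,4) dist_triangle_add[of a b "blinfun_apply S x" "blinfun_apply T x"]
      by (simp add: blinfun.add_left)
    then show ?thesis using ab by (intro bexI[of _ "a + b"]) auto
  qed
  then show "\<exists>m. finite m \<and> (\<forall>x. norm x \<le> 1 \<longrightarrow> (\<exists>y\<in>m. dist y (blinfun_apply (S + T) x) < e))"
    using k(1) l(1) by (intro exI[of _ "(\<lambda>(a, b). a + b) ` (k \<times> l)"]) auto
qed

lemma compact_operator_rank_one:
  assumes T: "T \<in> bounded_operators" and rank: "\<And>x. \<exists>c. blinfun_apply T x = c *\<^sub>C v"
  shows "compact_operator T"
proof -
  \<comment> \<open>\<open>T x = c v\<close> with \<open>norm x \<le> 1\<close> forces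
    \<open>cmod c \<le> R\<close>. For \<open>v = 0\<close> division by zero gives
    \<open>R = 0\<close>, and the disc still contains 0.\<close>
  define R where "R = norm T / norm v"
  define C where "C = (\<lambda>c. c *\<^sub>C v) ` cball 0 R"
  have "continuous_on (cball 0 R) (\<lambda>c. c *\<^sub>C v)"
    by (intro linear_continuous_on bounded_bilinear.bounded_linear_left[OF bounded_bilinear_scaleC])
  then have "compact C" unfolding C_def by (intro compact_continuous_image compact_cball)
  have "blinfun_apply T x \<in> C" if x: "norm x \<le> 1" for x
  proof -
    obtain c where c: "blinfun_apply T x = c *\<^sub>C v" using rank by blast
    show ?thesis
    proof (cases "v = 0")
      case True
      have "0 \<in> C" unfolding C_def using True by (intro image_eqI[of _ _ 0]) (auto simp: R_def)
      then show ?thesis using c True by simp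
    next
      case False
      have "cmod c * norm v \<le> norm T * 1"
        using norm_blinfun[of T x] mult_left_mono[OF x, of "norm T"] unfolding c norm_scaleC by simp
      then have "c \<in> cball 0 R" using False by (simp add: R_def field_simps)
      then show ?thesis unfolding C_def c by blast
    qed
  qed
  then have "blinfun_apply T ` cball 0 1 \<subseteq> C" by auto
  then have "closure (blinfun_apply T ` cball 0 1) \<subseteq> C"
    using \<open>compact C\<close> by (intro closure_minimal compact_imp_closed)
  then have "compact (closure (blinfun_apply T ` cball 0 1))"
    using \<open>compact C\<close> compact_Int_closed[of C "closure (blinfun_apply T ` cball 0 1)"]
    by (simp add: Int_absorb1)
  then show ?thesis using T by (simp add: compact_operator_def)
qed

text \<open>The remainder is the orthogonal projection of \<open>w\<close> onto the complement of
  the span of \<open>E\<close>.\<close>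

lemma norm_diff_expansion_le:
  assumes E: "finite E" "orthonormal E"
  shows "norm (w - (\<Sum>e\<in>E. cinner w e *\<^sub>C e)) \<le> norm w"
proof -
  define p where "p = (\<Sum>e\<in>E. cinner w e *\<^sub>C e)"
  have "cinner (w - p) e = 0" if "e \<in> E" for e
    using orthonormal_coefficient[OF E that, of "cinner w"] by (simp add: p_def cinner_diff_left)
  then have "cinner (w - p) p = 0"
    by (subst (2) p_def) (simp add: cinner_sum_right cinner_scaleC_right)
  then have "(norm ((w - p) + p))\<^sup>2 = (norm (w - p))\<^sup>2 + (norm p)\<^sup>2"
    by (rule norm_add_orthogonal)
  then have "(norm (w - p))\<^sup>2 \<le> (norm w)\<^sup>2" by simp
  then show ?thesis unfolding p_def by (rule power2_le_imp_le) simp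
qed

text \<open>The image of the unit ball has a finite net in \<open>M\<close>, whose points are
  expanded exactly by an orthonormal \<open>E\<close>. The error map \<open>D\<close> is contractive
  and vanishes on the net, so it is at most \<epsilon> on that image; homogeneity extends this to
  all \<open>x\<close>.\<close>

lemma compact_operator_finite_rank:
  assumes K: "compact_operator K" and ran: "range (blinfun_apply K) \<subseteq> M"
    and M: "csubspace M" "closed M" and \<epsilon>: "\<epsilon> > 0"
  shows "\<exists>E. finite E \<and> E \<subseteq> M \<and>
    (\<forall>x. norm (blinfun_apply K x - (\<Sum>e\<in>E. cinner (blinfun_apply K x) e *\<^sub>C e)) \<le> \<epsilon> * norm x)"
proof -
  let ?S = "closure (blinfun_apply K ` cball 0 1)"
  have "compact ?S" using K by (simp add: compact_operator_def)
  then obtain k where k: "finite k" "k \<subseteq> ?S" "?S \<subseteq> (\<Union>x\<in>k. ball x \<epsilon>)"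
    using seq_compact_imp_totally_bounded[of ?S] compact_imp_seq_compact \<epsilon> by blast
  have "?S \<subseteq> M" using ran M(2) by (intro closure_minimal) auto
  then have "k \<subseteq> \<Union>{M}" using k(2) by auto
  \<comment> \<open>Gram--Schmidt for the one-member family \<open>{M}\<close> keeps
    \<open>E\<close> inside \<open>M\<close>.\<close>
  from orthonormal_expansion[of "{M}" k, OF _ _ k(1) this] obtain E
    where E: "finite E" "E \<subseteq> M" "orthonormal E" "\<And>y. y \<in> k \<Longrightarrow> y = (\<Sum>e\<in>E. cinner y e *\<^sub>C e)"
    using M(1) by auto
  define D where "D w = w - (\<Sum>e\<in>E. cinner w e *\<^sub>C e)" for w
  have unit: "norm (D (blinfun_apply K x)) \<le> \<epsilon>" if x: "norm x \<le> 1" for x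
  proof -
    have "blinfun_apply K x \<in> ?S" using x by (intro subsetD[OF closure_subset] imageI) simp
    then obtain y where y: "y \<in> k" "norm (y - blinfun_apply K x) < \<epsilon>" using k(3) by (auto simp: dist_norm)
    have "D (blinfun_apply K x) = D (blinfun_apply K x - y)"
      using E(4)[OF y(1)]
      by (simp add: D_def cinner_diff_left scaleC_diff_left sum_subtractf)
    also have "norm \<dots> \<le> norm (blinfun_apply K x - y)"
      unfolding D_def by (rule norm_diff_expansion_le[OF E(1,3)])
    finally show ?thesis using y(2) by (simp add: norm_minus_commute)
  qed
  have "norm (D (blinfun_apply K x)) \<le> \<epsilon> * norm x" for x
  proof (cases "x = 0")
    case False
    define y where "y = (1 / norm x) *\<^sub>R x"
    have x: "x = norm x *\<^sub>R y" using False by (simp add: y_def)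
    have scale: "D (t *\<^sub>R w) = t *\<^sub>R D w" for t w
      by (simp add: D_def scaleR_scaleC scaleC_diff_right scaleC_sum_right cinner_scaleC_left scaleC_scaleC)
    have "D (blinfun_apply K x) = norm x *\<^sub>R D (blinfun_apply K y)"
      by (subst x) (simp only: blinfun.scaleR_right scale)
    then have "norm (D (blinfun_apply K x)) = norm x * norm (D (blinfun_apply K y))" by simp
    also have "\<dots> \<le> norm x * \<epsilon>" using False by (intro mult_left_mono unit) (auto simp: y_def)
    finally show ?thesis by (simp add: mult.commute)
  qed (simp add: D_def)
  then show ?thesis using E(1,2) unfolding D_def by blast
qed

section \<open>Representation as a sum of algebras of compact operators\<close>

locale represented_algebra = dense_socle_algebra A
  for A :: "'h :: complex_hilbert_space op set" +
  fixes I :: "'h set" and r :: "'h \<Rightarrow> 'h op"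
  assumes r_minimal: "\<xi> \<in> I \<Longrightarrow> minimal_projection (r \<xi>)"
    and norm_I: "\<xi> \<in> I \<Longrightarrow> norm \<xi> = 1"
    and r_fix: "\<xi> \<in> I \<Longrightarrow> blinfun_apply (r \<xi>) \<xi> = \<xi>"
    and inequivalent: "\<xi> \<in> I \<Longrightarrow> \<eta> \<in> I \<Longrightarrow> \<xi> \<noteq> \<eta> \<Longrightarrow> \<not> equivalent (r \<xi>) (r \<eta>)"
    and represented: "minimal_projection q \<Longrightarrow> \<exists>\<xi>\<in>I. equivalent q (r \<xi>)"
begin

lemma sum_in: "(\<And>i. i \<in> F \<Longrightarrow> f i \<in> A) \<Longrightarrow> sum f F \<in> A"
  by (induction F rule: infinite_finite_induct) (auto simp: zero_in add_in)

lemma r_in: "\<xi> \<in> I \<Longrightarrow> r \<xi> \<in> A"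
  by (rule minimal_projection_in[OF r_minimal])

lemma r_projection: "\<xi> \<in> I \<Longrightarrow> is_projection (r \<xi>)"
  by (rule minimal_projection_is_projection[OF r_minimal])

lemma r_corner:
  assumes "\<xi> \<in> I" "a \<in> A" "blinfun_apply (r \<xi>) x = x"
  shows "blinfun_apply (r \<xi>) (blinfun_apply a x) = cinner (blinfun_apply a \<xi>) \<xi> *\<^sub>C x"
proof -
  have "blinfun_apply (r \<xi> o\<^sub>L a o\<^sub>L r \<xi>) x = blinfun_apply (cinner (blinfun_apply a \<xi>) \<xi> *\<^sub>C r \<xi>) x"
    using minimal_projection_corner[OF r_minimal[OF assms(1)] assms(2) norm_I[OF assms(1)] r_fix[OF assms(1)]]
    by simp
  then show ?thesis by (simp add: assms(3))
qed

lemma r_corner_zero: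
  assumes "\<xi> \<in> I" "\<eta> \<in> I" "\<xi> \<noteq> \<eta>" "a \<in> A" "blinfun_apply (r \<eta>) x = x"
  shows "blinfun_apply (r \<xi>) (blinfun_apply a x) = 0"
proof -
  have "r \<xi> o\<^sub>L a o\<^sub>L r \<eta> = 0" using inequivalent[OF assms(1-3)] assms(4) by (auto simp: equivalent_def)
  then have "blinfun_apply (r \<xi> o\<^sub>L a o\<^sub>L r \<eta>) x = 0" by simp
  then show ?thesis by (simp add: assms(5))
qed

text \<open>This is the range of \<open>r \<xi>\<close>. Each unit vector \<open>e\<close> in it
  generates a copy \<open>A e\<close> of \<open>orbit \<xi>\<close>, so its dimension is the
  multiplicity of that representation.\<close>

definition fibre :: "'h \<Rightarrow> 'h set" where
  "fibre \<xi> = {x. blinfun_apply (r \<xi>) x = x}"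

lemma fibre_csubspace: "\<xi> \<in> I \<Longrightarrow> csubspace (fibre \<xi>)"
  unfolding csubspace_def fibre_def
  by (auto simp: blinfun.add_right bounded_operators_scaleC in_bounded r_in)

text \<open>Moving \<open>b\<close> across the inner product places \<open>adj b a\<close> between
  \<open>r \<eta>\<close> and \<open>r \<xi>\<close>, where inequivalence makes it vanish.\<close>

lemma fibres_orthogonal_orbits:
  assumes "\<xi> \<in> I" "\<eta> \<in> I" "\<xi> \<noteq> \<eta>" "e \<in> fibre \<xi>" "f \<in> fibre \<eta>" "a \<in> A" "b \<in> A"
  shows "cinner (blinfun_apply a e) (blinfun_apply b f) = 0"
proof -
  have "cinner (blinfun_apply a e) (blinfun_apply b f) =
      cinner (blinfun_apply (adj b o\<^sub>L a) e) (blinfun_apply (r \<eta>) f)"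
    using assms(5) by (simp add: cinner_adj_left in_bounded assms(7) fibre_def)
  also have "\<dots> = cinner (blinfun_apply (r \<eta>) (blinfun_apply (adj b o\<^sub>L a) e)) f"
    using projection_cinner[OF r_projection[OF assms(2)]] by simp
  also have "blinfun_apply (r \<eta>) (blinfun_apply (adj b o\<^sub>L a) e) = 0"
    using assms by (intro r_corner_zero) (auto simp: fibre_def compose_in adj_in)
  finally show ?thesis by simp
qed

lemma fibres_orthogonal:
  assumes "\<xi> \<in> I" "\<eta> \<in> I" "\<xi> \<noteq> \<eta>" "e \<in> fibre \<xi>" "f \<in> fibre \<eta>"
  shows "cinner e f = 0"
  using fibres_orthogonal_orbits[OF assms r_in[OF assms(1)] r_in[OF assms(2)]] assms(4,5)
  by (simp add: fibre_def)

text \<open>Within one fibre \<open>cinner_orbit\<close> supplies the factor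
  \<open>cinner e f\<close>; across fibres inequivalence gives zero.\<close>

lemma orbits_orthogonal:
  assumes "\<xi> \<in> I" "\<eta> \<in> I" "e \<in> fibre \<xi>" "f \<in> fibre \<eta>" "cinner e f = 0" "a \<in> A" "b \<in> A"
  shows "cinner (blinfun_apply a e) (blinfun_apply b f) = 0"
proof (cases "\<xi> = \<eta>")
  case True
  then show ?thesis
    using cinner_orbit[OF r_minimal[OF assms(1)] assms(6,7) norm_I[OF assms(1)] r_fix[OF assms(1)], of e f]
      assms(3-5) by (simp add: fibre_def)
next
  case False
  then show ?thesis using fibres_orthogonal_orbits assms by blast
qed

lemma norm_orbit_unit:
  assumes "\<xi> \<in> I" "e \<in> fibre \<xi>" "norm e = 1" "a \<in> A"
  shows "norm (blinfun_apply a e) = norm (blinfun_apply a \<xi>)"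
  using norm_orbit[OF r_minimal[OF assms(1)] assms(4) norm_I[OF assms(1)] r_fix[OF assms(1)], of e]
    assms(2,3) by (simp add: fibre_def)

subsection \<open>Norm estimates\<close>

text \<open>
  The set \<open>N\<close> is chosen before \<open>E\<close>, so that the sets for two summands of \<open>s\<close> can be united before
  Gram--Schmidt produces a common orthonormal \<open>E\<close>.
\<close>

lemma socle_vectors:
  assumes s: "s \<in> socle A"
  shows "\<exists>N. finite N \<and> N \<subseteq> \<Union> (fibre ` I) \<and>
    (\<forall>E. (\<forall>y\<in>N. y = (\<Sum>e\<in>E. cinner y e *\<^sub>C e)) \<longrightarrow>
      (\<exists>b. (\<forall>j e. b j e \<in> A) \<and>
        (\<forall>j<n::nat. blinfun_apply s (x j) = (\<Sum>e\<in>E. blinfun_apply (b j e) e))))"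
  using s
proof (induction rule: socle_induct)
  case zero
  show ?case
    by (intro exI[of _ "{}"] conjI allI impI exI[of _ "\<lambda>_ _. 0"]) (auto simp: zero_in)
next
  case (add s t)
  then obtain N N' where N: "finite N" "N \<subseteq> \<Union> (fibre ` I)"
      "\<And>E. (\<forall>y\<in>N. y = (\<Sum>e\<in>E. cinner y e *\<^sub>C e)) \<Longrightarrow> \<exists>b. (\<forall>j e. b j e \<in> A) \<and>
        (\<forall>j<n. blinfun_apply s (x j) = (\<Sum>e\<in>E. blinfun_apply (b j e) e))"
    and N': "finite N'" "N' \<subseteq> \<Union> (fibre ` I)"
      "\<And>E. (\<forall>y\<in>N'. y = (\<Sum>e\<in>E. cinner y e *\<^sub>C e)) \<Longrightarrow> \<exists>b. (\<forall>j e. b j e \<in> A) \<and>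
        (\<forall>j<n. blinfun_apply t (x j) = (\<Sum>e\<in>E. blinfun_apply (b j e) e))"
    by blast
  show ?case
  proof (intro exI[of _ "N \<union> N'"] conjI allI impI)
    fix E assume E: "\<forall>y\<in>N \<union> N'. y = (\<Sum>e\<in>E. cinner y e *\<^sub>C e)"
    obtain b where b: "\<forall>j e. b j e \<in> A" "\<forall>j<n. blinfun_apply s (x j) = (\<Sum>e\<in>E. blinfun_apply (b j e) e)"
      using N(3)[of E] E by blast
    obtain c where c: "\<forall>j e. c j e \<in> A" "\<forall>j<n. blinfun_apply t (x j) = (\<Sum>e\<in>E. blinfun_apply (c j e) e)"
      using N'(3)[of E] E by blast
    show "\<exists>b. (\<forall>j e. b j e \<in> A) \<and>
        (\<forall>j<n. blinfun_apply (s + t) (x j) = (\<Sum>e\<in>E. blinfun_apply (b j e) e))"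
      using b c by (intro exI[of _ "\<lambda>j e. b j e + c j e"])
        (simp add: add_in blinfun.add_left sum.distrib)
  qed (use N N' in auto)
next
  case (ideal q a)
  obtain \<xi> where \<xi>: "\<xi> \<in> I" "equivalent q (r \<xi>)" using represented[OF ideal(1)] by blast
  obtain u v where uv: "u \<in> A" "v \<in> A" "q = u o\<^sub>L v" "r \<xi> o\<^sub>L v = v"
    using equivalent_factor[OF ideal(1) r_minimal[OF \<xi>(1)] \<xi>(2)] by blast
  \<comment> \<open>The factor \<open>v\<close> moves the vectors \<open>a (x j)\<close> into the
    fibre, where \<open>E\<close> expands them; \<open>u\<close> carries the expansion back, and the
    coefficients are absorbed into the operators \<open>b j e\<close>.\<close>
  define w where "w j = blinfun_apply v (blinfun_apply a (x j))" for j
  have w: "w j \<in> fibre \<xi>" for j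
    using arg_cong[OF uv(4), of "\<lambda>T. blinfun_apply T (blinfun_apply a (x j))"]
    by (simp add: fibre_def w_def)
  show ?case
  proof (intro exI[of _ "w ` {..<n}"] conjI allI impI)
    show "w ` {..<n} \<subseteq> \<Union> (fibre ` I)" using w \<xi>(1) by blast
    fix E assume E: "\<forall>y\<in>w ` {..<n}. y = (\<Sum>e\<in>E. cinner y e *\<^sub>C e)"
    show "\<exists>b. (\<forall>j e. b j e \<in> A) \<and>
        (\<forall>j<n. blinfun_apply (q o\<^sub>L a) (x j) = (\<Sum>e\<in>E. blinfun_apply (b j e) e))"
    proof (intro exI[of _ "\<lambda>j e. cinner (w j) e *\<^sub>C u"] conjI allI impI)
      fix j assume "j < n"
      then have "w j = (\<Sum>e\<in>E. cinner (w j) e *\<^sub>C e)" using E by blast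
      then have "blinfun_apply u (w j) = blinfun_apply u (\<Sum>e\<in>E. cinner (w j) e *\<^sub>C e)" by simp
      also have "\<dots> = (\<Sum>e\<in>E. blinfun_apply (cinner (w j) e *\<^sub>C u) e)"
        by (simp add: blinfun.sum_right bounded_operators_scaleC[OF in_bounded[OF uv(1)]])
      finally show "blinfun_apply (q o\<^sub>L a) (x j) = (\<Sum>e\<in>E. blinfun_apply (cinner (w j) e *\<^sub>C u) e)"
        by (simp add: uv(3) w_def)
    qed (simp add: scaleC_in uv(1))
  qed simp
qed

text \<open>Distinct \<open>e\<close> in \<open>E\<close> generate orthogonal subspaces
  \<open>A e\<close>, invariant under the entries of \<open>T\<close>, so both sides split over
  \<open>e\<close> by Pythagoras. For a single \<open>e\<close>, replacing it by the label
  \<open>g e\<close> of its fibre preserves norms, and the assumed bound applies.\<close>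

lemma orthonormal_inequality:
  fixes T :: "nat \<Rightarrow> nat \<Rightarrow> 'h op"
  assumes T: "\<And>i j. i < n \<Longrightarrow> j < n \<Longrightarrow> T i j \<in> A"
    and bound: "\<And>\<xi> b. \<xi> \<in> I \<Longrightarrow> (\<And>j. b j \<in> A) \<Longrightarrow>
      (\<Sum>i<n. (norm (\<Sum>j<n. blinfun_apply (T i j) (blinfun_apply (b j) \<xi>)))\<^sup>2) \<le>
      C * (\<Sum>j<n. (norm (blinfun_apply (b j) \<xi>))\<^sup>2)"
    and E: "finite E" "E \<subseteq> \<Union> (fibre ` I)" "orthonormal E" and b: "\<And>j e. b j e \<in> A"
  shows "(\<Sum>i<n. (norm (\<Sum>j<n. blinfun_apply (T i j) (\<Sum>e\<in>E. blinfun_apply (b j e) e)))\<^sup>2) \<le>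
    C * (\<Sum>j<n. (norm (\<Sum>e\<in>E. blinfun_apply (b j e) e))\<^sup>2)"
proof -
  have "\<forall>e\<in>E. \<exists>\<xi>. \<xi> \<in> I \<and> e \<in> fibre \<xi>" using E(2) by blast
  from bchoice[OF this] obtain g where g: "\<And>e. e \<in> E \<Longrightarrow> g e \<in> I" "\<And>e. e \<in> E \<Longrightarrow> e \<in> fibre (g e)" by blast
  have pythagoras: "(norm (\<Sum>e\<in>E. blinfun_apply (c e) e))\<^sup>2 = (\<Sum>e\<in>E. (norm (blinfun_apply (c e) (g e)))\<^sup>2)"
    if c: "\<And>e. c e \<in> A" for c
  proof -
    have "(norm (\<Sum>e\<in>E. blinfun_apply (c e) e))\<^sup>2 = (\<Sum>e\<in>E. (norm (blinfun_apply (c e) e))\<^sup>2)"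
    proof (rule norm_sum_orthogonal[OF E(1)])
      fix e f assume ef: "e \<in> E" "f \<in> E" "e \<noteq> f"
      then have "cinner e f = 0" using E(3) by (auto simp: orthonormal_def)
      then show "cinner (blinfun_apply (c e) e) (blinfun_apply (c f) f) = 0"
        using orbits_orthogonal[OF g(1)[OF ef(1)] g(1)[OF ef(2)] g(2)[OF ef(1)] g(2)[OF ef(2)]] c by blast
    qed
    also have "\<dots> = (\<Sum>e\<in>E. (norm (blinfun_apply (c e) (g e)))\<^sup>2)"
      using norm_orbit_unit[OF g] c E(3) by (intro sum.cong) (auto simp: orthonormal_def)
    finally show ?thesis .
  qed
  define c where "c i e = (\<Sum>j<n. T i j o\<^sub>L b j e)" for i e
  have c: "c i e \<in> A" if "i < n" for i e
    unfolding c_def using that T b by (intro sum_in compose_in) auto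
  have c_apply: "blinfun_apply (c i e) x = (\<Sum>j<n. blinfun_apply (T i j) (blinfun_apply (b j e) x))" for i e x
    by (simp add: c_def blinfun.sum_left)
  have "(\<Sum>i<n. (norm (\<Sum>j<n. blinfun_apply (T i j) (\<Sum>e\<in>E. blinfun_apply (b j e) e)))\<^sup>2) =
      (\<Sum>i<n. (norm (\<Sum>e\<in>E. blinfun_apply (c i e) e))\<^sup>2)"
    unfolding c_apply blinfun.sum_right by (subst sum.swap) simp
  also have "\<dots> = (\<Sum>i<n. \<Sum>e\<in>E. (norm (blinfun_apply (c i e) (g e)))\<^sup>2)"
    by (intro sum.cong refl pythagoras) (use c in auto)
  also have "\<dots> = (\<Sum>e\<in>E. \<Sum>i<n. (norm (blinfun_apply (c i e) (g e)))\<^sup>2)"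
    by (rule sum.swap)
  also have "\<dots> \<le> (\<Sum>e\<in>E. C * (\<Sum>j<n. (norm (blinfun_apply (b j e) (g e)))\<^sup>2))"
    unfolding c_apply using g(1) b by (intro sum_mono bound) auto
  also have "\<dots> = C * (\<Sum>j<n. \<Sum>e\<in>E. (norm (blinfun_apply (b j e) (g e)))\<^sup>2)"
    unfolding sum_distrib_left[symmetric] by (subst sum.swap) simp
  also have "\<dots> = C * (\<Sum>j<n. (norm (\<Sum>e\<in>E. blinfun_apply (b j e) e))\<^sup>2)"
    by (simp add: pythagoras[OF b])
  finally show ?thesis .
qed

text \<open>On vectors \<open>s (x j)\<close> with \<open>s\<close> in the socle this is the
  preceding inequality for a suitable finite \<open>E\<close>. The condition is closed in
  \<open>s\<close> and so extends to \<open>A\<close>. Arbitrary \<open>x\<close> are reached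
  because \<open>T e_t\<close> tends to \<open>T\<close> while
  \<open>norm (e_t x) \<le> norm x\<close>.\<close>

lemma matrix_inequality:
  fixes T :: "nat \<Rightarrow> nat \<Rightarrow> 'h op"
  assumes T: "\<And>i j. i < n \<Longrightarrow> j < n \<Longrightarrow> T i j \<in> A" and C: "C \<ge> 0"
    and bound: "\<And>\<xi> b. \<xi> \<in> I \<Longrightarrow> (\<And>j. b j \<in> A) \<Longrightarrow>
      (\<Sum>i<n. (norm (\<Sum>j<n. blinfun_apply (T i j) (blinfun_apply (b j) \<xi>)))\<^sup>2) \<le>
      C * (\<Sum>j<n. (norm (blinfun_apply (b j) \<xi>))\<^sup>2)"
  shows "(\<Sum>i<n. (norm (\<Sum>j<n. blinfun_apply (T i j) (x j)))\<^sup>2) \<le> C * (\<Sum>j<n. (norm (x j))\<^sup>2)"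
proof -
  define S where "S = {s. (\<Sum>i<n. (norm (\<Sum>j<n. blinfun_apply (T i j) (blinfun_apply s (x j))))\<^sup>2) \<le>
      C * (\<Sum>j<n. (norm (blinfun_apply s (x j)))\<^sup>2)}"
  have "closed S"
    unfolding S_def by (intro closed_Collect_le continuous_intros)
  have "s \<in> S" if s: "s \<in> socle A" for s
  proof -
    obtain N where N: "finite N" "N \<subseteq> \<Union> (fibre ` I)"
      "\<And>E. (\<forall>y\<in>N. y = (\<Sum>e\<in>E. cinner y e *\<^sub>C e)) \<Longrightarrow>
      (\<exists>b. (\<forall>j e. b j e \<in> A) \<and>
        (\<forall>j<n. blinfun_apply s (x j) = (\<Sum>e\<in>E. blinfun_apply (b j e) e)))"
      using socle_vectors[OF s, of n x] by blast
    have "\<exists>E. finite E \<and> E \<subseteq> \<Union> (fibre ` I) \<and> orthonormal E \<and> (\<forall>y\<in>N. y = (\<Sum>e\<in>E. cinner y e *\<^sub>C e))"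
    proof (rule orthonormal_expansion[OF _ _ N(1,2)])
      show "csubspace M" if "M \<in> fibre ` I" for M using that fibre_csubspace by auto
      show "cinner e f = 0" if "M \<in> fibre ` I" "M' \<in> fibre ` I" "M \<noteq> M'" "e \<in> M" "f \<in> M'" for M M' e f
        using that fibres_orthogonal by blast
    qed
    then obtain E where E: "finite E" "E \<subseteq> \<Union> (fibre ` I)" "orthonormal E"
        "\<forall>y\<in>N. y = (\<Sum>e\<in>E. cinner y e *\<^sub>C e)" by blast
    obtain b where b: "\<And>j e. b j e \<in> A" "\<And>j. j < n \<Longrightarrow> blinfun_apply s (x j) = (\<Sum>e\<in>E. blinfun_apply (b j e) e)"
      using N(3)[OF E(4)] by blast
    show ?thesis
      using orthonormal_inequality[where T = T and C = C and b = b, OF T bound E(1-3) b(1)]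
      by (simp add: S_def b(2))
  qed
  then have "closure (socle A) \<subseteq> S" using \<open>closed S\<close> by (intro closure_minimal) auto
  then have AS: "A \<subseteq> S" by (simp add: dense_socle)
  obtain F :: "'h op filter" and e where F: "F \<noteq> bot" "\<forall>\<^sub>F t in F. e t \<in> A \<and> norm (e t) \<le> 1"
      and right: "\<forall>x\<in>A. ((\<lambda>t. x o\<^sub>L e t) \<longlongrightarrow> x) F"
    using approximate_identity by blast
  show ?thesis
  proof (rule tendsto_upperbound[OF _ _ F(1)])
    have "((\<lambda>t. blinfun_apply (T i j o\<^sub>L e t) (x j)) \<longlongrightarrow> blinfun_apply (T i j) (x j)) F"
      if "i < n" "j < n" for i j
      using right T that by (intro blinfun.tendsto tendsto_const) blast
    then show "((\<lambda>t. \<Sum>i<n. (norm (\<Sum>j<n. blinfun_apply (T i j) (blinfun_apply (e t) (x j))))\<^sup>2) \<longlongrightarrow>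
        (\<Sum>i<n. (norm (\<Sum>j<n. blinfun_apply (T i j) (x j)))\<^sup>2)) F"
      by (intro tendsto_sum tendsto_power tendsto_norm) simp
    show "\<forall>\<^sub>F t in F. (\<Sum>i<n. (norm (\<Sum>j<n. blinfun_apply (T i j) (blinfun_apply (e t) (x j))))\<^sup>2) \<le>
        C * (\<Sum>j<n. (norm (x j))\<^sup>2)"
      using F(2)
    proof eventually_elim
      case (elim t)
      have "(\<Sum>i<n. (norm (\<Sum>j<n. blinfun_apply (T i j) (blinfun_apply (e t) (x j))))\<^sup>2) \<le>
          C * (\<Sum>j<n. (norm (blinfun_apply (e t) (x j)))\<^sup>2)"
        using AS elim by (auto simp: S_def)
      also have "\<dots> \<le> C * (\<Sum>j<n. (norm (x j))\<^sup>2)"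
      proof (intro mult_left_mono sum_mono power_mono C)
        show "norm (blinfun_apply (e t) (x j)) \<le> norm (x j)" for j
          using norm_blinfun[of "e t" "x j"] mult_right_mono[of "norm (e t)" 1 "norm (x j)"] elim by simp
      qed simp
      finally show ?case .
    qed
  qed
qed

subsection \<open>The components\<close>

abbreviation proj :: "'h \<Rightarrow> 'h op" where
  "proj \<xi> \<equiv> proj_onto (orbit \<xi>)"

text \<open>The restriction of \<open>a\<close> to the invariant subspace
  \<open>orbit \<xi>\<close>, extended by zero on the complement. The value 0 outside
  \<open>I\<close> matches \<open>c0_sum_compacts\<close>.\<close>

definition component :: "'h op \<Rightarrow> 'h \<Rightarrow> 'h op" where
  "component a \<xi> = (if \<xi> \<in> I then a o\<^sub>L proj \<xi> else 0)"

lemma closed_orbit: "\<xi> \<in> I \<Longrightarrow> Topological_Spaces.closed (orbit \<xi>)"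
  by (rule orbit_closed[OF r_minimal norm_I r_fix])

lemmas proj_projection = is_projection_proj_onto[OF orbit_csubspace closed_orbit]
  and proj_in = proj_onto_in[OF orbit_csubspace closed_orbit]
  and proj_id = proj_onto_id[OF orbit_csubspace closed_orbit]
  and proj_orthogonal = proj_onto_orthogonal[OF orbit_csubspace closed_orbit]

lemma orbit_invariant: "a \<in> A \<Longrightarrow> x \<in> orbit \<xi> \<Longrightarrow> blinfun_apply a x \<in> orbit \<xi>"
  unfolding orbit_def using compose_in by force

lemma component_apply: "\<xi> \<in> I \<Longrightarrow> blinfun_apply (component a \<xi>) x = blinfun_apply a (blinfun_apply (proj \<xi>) x)"
  by (simp add: component_def)

lemma component_orbit: "\<xi> \<in> I \<Longrightarrow> x \<in> orbit \<xi> \<Longrightarrow> blinfun_apply (component a \<xi>) x = blinfun_apply a x"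
  by (simp add: component_apply proj_id)

lemma component_add: "component (a + b) \<xi> = component a \<xi> + component b \<xi>"
  by (simp add: component_def compose_bilinear)

lemma component_diff: "component (a - b) \<xi> = component a \<xi> - component b \<xi>"
  by (simp add: component_def compose_bilinear)

lemma component_zero: "component 0 \<xi> = 0"
  by (simp add: component_def)

lemma component_sum: "component (sum f F) \<xi> = (\<Sum>i\<in>F. component (f i) \<xi>)"
  by (induction F rule: infinite_finite_induct) (auto simp: component_add component_zero)

lemma component_scaleC: "component (c *\<^sub>C a) \<xi> = c *\<^sub>C component a \<xi>"
  by (simp add: component_def)

text \<open>The orbit is invariant under \<open>b\<close>, so the projection standing between
  \<open>a\<close> and \<open>b\<close> acts there as the identity.\<close>

lemma component_compose:
  assumes "b \<in> A"
  shows "component (a o\<^sub>L b) \<xi> = component a \<xi> o\<^sub>L component b \<xi>"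
proof (cases "\<xi> \<in> I")
  case True
  show ?thesis
    by (rule blinfun_eqI) (simp add: component_apply True proj_id orbit_invariant assms proj_in)
qed (simp add: component_def)

lemma component_bounded: "a \<in> A \<Longrightarrow> component a \<xi> \<in> bounded_operators"
  by (simp add: component_def in_bounded bounded_operators_zero bounded_operators_compose
      projection_bounded[OF proj_projection])

lemma norm_component_le: "norm (component a \<xi>) \<le> norm a"
proof (cases "\<xi> \<in> I")
  case True
  have "norm (a o\<^sub>L proj \<xi>) \<le> norm a * norm (proj \<xi>)" by (rule norm_blinfun_compose)
  also have "\<dots> \<le> norm a * 1"
    using projection_contractive(2)[OF proj_projection[OF True]] by (intro mult_left_mono) auto
  finally show ?thesis using True by (simp add: component_def)
qed (simp add: component_def)

lemma matrix_norm_component_le: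
  "matrix_norm n (\<lambda>i j. component (T i j) \<xi>) \<le> matrix_norm n T"
proof (rule matrix_norm_le[OF matrix_norm_nonneg])
  fix x :: "nat \<Rightarrow> 'h"
  show "(\<Sum>i<n. (norm (\<Sum>j<n. blinfun_apply (component (T i j) \<xi>) (x j)))\<^sup>2) \<le>
      (matrix_norm n T)\<^sup>2 * (\<Sum>j<n. (norm (x j))\<^sup>2)"
  proof (cases "\<xi> \<in> I")
    case True
    have "(\<Sum>i<n. (norm (\<Sum>j<n. blinfun_apply (component (T i j) \<xi>) (x j)))\<^sup>2) \<le>
        (matrix_norm n T)\<^sup>2 * (\<Sum>j<n. (norm (blinfun_apply (proj \<xi>) (x j)))\<^sup>2)"
      unfolding component_apply[OF True] by (rule matrix_norm_bound)
    also have "\<dots> \<le> (matrix_norm n T)\<^sup>2 * (\<Sum>j<n. (norm (x j))\<^sup>2)"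
      using projection_contractive(1)[OF proj_projection[OF True]]
      by (intro mult_left_mono sum_mono power_mono) auto
    finally show ?thesis .
  next
    case False
    then show ?thesis by (simp add: component_def sum_nonneg)
  qed
qed

text \<open>\<open>matrix_inequality\<close> tests \<open>T\<close> only on tuples from a single
  orbit, where its entries agree with their components.\<close>

lemma matrix_norm_le_components:
  assumes T: "\<And>i j. i < n \<Longrightarrow> j < n \<Longrightarrow> T i j \<in> A" and M: "M \<ge> 0"
    and le: "\<And>\<xi>. \<xi> \<in> I \<Longrightarrow> matrix_norm n (\<lambda>i j. component (T i j) \<xi>) \<le> M"
  shows "matrix_norm n T \<le> M"
proof (rule matrix_norm_le[OF M], rule matrix_inequality[OF T])
  fix \<xi> and b :: "nat \<Rightarrow> 'h op"
  assume \<xi>: "\<xi> \<in> I" and b: "\<And>j. b j \<in> A"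
  have "blinfun_apply (b j) \<xi> \<in> orbit \<xi>" for j using b by (simp add: orbit_def)
  then have "(\<Sum>i<n. (norm (\<Sum>j<n. blinfun_apply (T i j) (blinfun_apply (b j) \<xi>)))\<^sup>2) \<le>
      (matrix_norm n (\<lambda>i j. component (T i j) \<xi>))\<^sup>2 * (\<Sum>j<n. (norm (blinfun_apply (b j) \<xi>))\<^sup>2)"
    using matrix_norm_bound[where T = "\<lambda>i j. component (T i j) \<xi>" and x = "\<lambda>j. blinfun_apply (b j) \<xi>"]
    by (simp add: component_orbit \<xi>)
  also have "\<dots> \<le> M\<^sup>2 * (\<Sum>j<n. (norm (blinfun_apply (b j) \<xi>))\<^sup>2)"
    using le[OF \<xi>] by (intro mult_right_mono power_mono matrix_norm_nonneg sum_nonneg) auto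
  finally show "(\<Sum>i<n. (norm (\<Sum>j<n. blinfun_apply (T i j) (blinfun_apply (b j) \<xi>)))\<^sup>2) \<le>
      M\<^sup>2 * (\<Sum>j<n. (norm (blinfun_apply (b j) \<xi>))\<^sup>2)" .
qed auto

lemma norm_le_components:
  assumes a: "a \<in> A" and M: "M \<ge> 0" and le: "\<And>\<xi>. \<xi> \<in> I \<Longrightarrow> norm (component a \<xi>) \<le> M"
  shows "norm a \<le> M"
proof (rule norm_blinfun_bound[OF M])
  fix x
  \<comment> \<open>The 1 by 1 case of \<open>matrix_inequality\<close>.\<close>
  have "(\<Sum>i<Suc 0. (norm (\<Sum>j<Suc 0. blinfun_apply a x))\<^sup>2) \<le> M\<^sup>2 * (\<Sum>j<Suc 0. (norm x)\<^sup>2)"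
  proof (rule matrix_inequality)
    fix \<xi> and b :: "nat \<Rightarrow> 'h op"
    assume \<xi>: "\<xi> \<in> I" and b: "\<And>j. b j \<in> A"
    have "blinfun_apply (b 0) \<xi> \<in> orbit \<xi>" using b by (simp add: orbit_def)
    then have "norm (blinfun_apply a (blinfun_apply (b 0) \<xi>)) \<le> norm (component a \<xi>) * norm (blinfun_apply (b 0) \<xi>)"
      using norm_blinfun[of "component a \<xi>" "blinfun_apply (b 0) \<xi>"] by (simp add: component_orbit \<xi>)
    also have "\<dots> \<le> M * norm (blinfun_apply (b 0) \<xi>)" using le[OF \<xi>] by (intro mult_right_mono) auto
    finally have "(norm (blinfun_apply a (blinfun_apply (b 0) \<xi>)))\<^sup>2 \<le> (M * norm (blinfun_apply (b 0) \<xi>))\<^sup>2"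
      by (intro power_mono) auto
    then show "(\<Sum>i<Suc 0. (norm (\<Sum>j<Suc 0. blinfun_apply a (blinfun_apply (b j) \<xi>)))\<^sup>2) \<le>
        M\<^sup>2 * (\<Sum>j<Suc 0. (norm (blinfun_apply (b j) \<xi>))\<^sup>2)"
      by (simp add: power_mult_distrib)
  qed (use a in auto)
  then have "(norm (blinfun_apply a x))\<^sup>2 \<le> (M * norm x)\<^sup>2" by (simp add: power_mult_distrib)
  then show "norm (blinfun_apply a x) \<le> M * norm x"
    by (rule power2_le_imp_le) (use M in simp)
qed

text \<open>Vectors of the orbit have the form \<open>b \<xi> = b (r \<xi>) \<xi>\<close>, and
  \<open>q A (r \<xi>)\<close> is zero.\<close>

lemma component_ideal_zero:
  assumes q: "minimal_projection q" and a: "a \<in> A" and \<xi>: "\<xi> \<in> I" "\<not> equivalent q (r \<xi>)"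
  shows "component (q o\<^sub>L a) \<xi> = 0"
proof (rule blinfun_eqI)
  fix x
  obtain b where b: "b \<in> A" "blinfun_apply (proj \<xi>) x = blinfun_apply b \<xi>"
    using proj_in[OF \<xi>(1), of x] by (auto simp: orbit_def)
  have "q o\<^sub>L (a o\<^sub>L b) o\<^sub>L r \<xi> = 0" using \<xi>(2) compose_in[OF a b(1)] by (auto simp: equivalent_def)
  then have "blinfun_apply (q o\<^sub>L (a o\<^sub>L b) o\<^sub>L r \<xi>) \<xi> = 0" by simp
  then show "blinfun_apply (component (q o\<^sub>L a) \<xi>) x = blinfun_apply 0 x"
    by (simp add: component_apply \<xi>(1) b(2) r_fix)
qed

text \<open>The component of \<open>q a\<close> has rank at most one: with \<open>q = u v\<close>
  factored through \<open>r \<xi>\<close>, the vector \<open>v a b \<xi>\<close> is a multiple of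
  \<open>\<xi>\<close> for every orbit vector \<open>b \<xi>\<close>, so the range lies in the line
  of \<open>u \<xi>\<close>.\<close>

lemma component_socle_compact:
  assumes "s \<in> socle A" "\<xi> \<in> I"
  shows "compact_operator (component s \<xi>)"
  using assms(1)
proof (induction rule: socle_induct)
  case zero
  show ?case
    unfolding component_zero
    by (rule compact_operator_rank_one[where v = 0]) (auto simp: bounded_operators_zero)
next
  case (add s t)
  then show ?case by (simp add: component_add compact_operator_add)
next
  case (ideal q a)
  have qa: "q o\<^sub>L a \<in> A" using compose_in minimal_projection_in ideal by blast
  show ?case
  proof (cases "equivalent q (r \<xi>)")
    case True
    obtain u v where uv: "u \<in> A" "v \<in> A" "q = u o\<^sub>L v" "r \<xi> o\<^sub>L v = v"
      using equivalent_factor[OF ideal(1) r_minimal[OF assms(2)] True] by blast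
    show ?thesis
    proof (rule compact_operator_rank_one[OF component_bounded[OF qa]])
      fix x
      obtain b where b: "b \<in> A" "blinfun_apply (proj \<xi>) x = blinfun_apply b \<xi>"
        using proj_in[OF assms(2), of x] by (auto simp: orbit_def)
      define c where "c = cinner (blinfun_apply (v o\<^sub>L a o\<^sub>L b) \<xi>) \<xi>"
      have "blinfun_apply (r \<xi>) (blinfun_apply (v o\<^sub>L a o\<^sub>L b) \<xi>) = c *\<^sub>C \<xi>"
        unfolding c_def using uv(2) ideal(2) b(1)
        by (intro r_corner[OF assms(2)] compose_in r_fix[OF assms(2)])
      moreover have "blinfun_apply (r \<xi>) (blinfun_apply v y) = blinfun_apply v y" for y
        using arg_cong[OF uv(4), of "\<lambda>T. blinfun_apply T y"] by simp
      ultimately have "blinfun_apply v (blinfun_apply a (blinfun_apply b \<xi>)) = c *\<^sub>C \<xi>" by simp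
      then have "blinfun_apply (component (q o\<^sub>L a) \<xi>) x = c *\<^sub>C blinfun_apply u \<xi>"
        using bounded_operators_scaleC[OF in_bounded[OF uv(1)]]
        by (simp add: component_apply assms(2) b(2) uv(3))
      then show "\<exists>c. blinfun_apply (component (q o\<^sub>L a) \<xi>) x = c *\<^sub>C blinfun_apply u \<xi>" by blast
    qed
  next
    case False
    then have "component (q o\<^sub>L a) \<xi> = 0" by (rule component_ideal_zero[OF ideal assms(2)])
    then show ?thesis
      by (intro compact_operator_rank_one[where v = 0]) (auto simp: bounded_operators_zero)
  qed
qed

lemma socle_approximation:
  assumes "a \<in> A" "\<epsilon> > 0"
  obtains s where "s \<in> socle A" "norm (a - s) < \<epsilon>"
  using assms dense_socle closure_approachable[of a "socle A"] by (auto simp: dist_norm norm_minus_commute)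

lemma component_compact:
  assumes a: "a \<in> A" and \<xi>: "\<xi> \<in> I"
  shows "compact_operator (component a \<xi>)"
proof (rule compact_operator_limit[OF component_bounded[OF a]])
  fix \<epsilon> :: real assume "\<epsilon> > 0"
  then obtain s where s: "s \<in> socle A" "norm (a - s) < \<epsilon>" using socle_approximation a by blast
  have "norm (component a \<xi> - component s \<xi>) < \<epsilon>"
    using norm_component_le[of "a - s" \<xi>] s(2) by (simp add: component_diff)
  then show "\<exists>K. compact_operator K \<and> norm (component a \<xi> - K) < \<epsilon>"
    using component_socle_compact[OF s(1) \<xi>] by blast
qed

lemma component_compact_on:
  assumes "a \<in> A" "\<xi> \<in> I"
  shows "component a \<xi> \<in> compact_operators_on (orbit \<xi>)"
  unfolding compact_operators_on_def
proof (intro CollectI conjI allI impI)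
  show "range (blinfun_apply (component a \<xi>)) \<subseteq> orbit \<xi>"
    using orbit_invariant[OF assms(1) proj_in[OF assms(2)]] by (auto simp: component_apply assms(2))
  show "blinfun_apply (component a \<xi>) x = 0" if "\<forall>y\<in>orbit \<xi>. cinner x y = 0" for x
    using proj_orthogonal[OF assms(2), of x] that by (simp add: component_apply assms(2))
qed (rule component_compact[OF assms])

text \<open>A minimal projection is equivalent to exactly one representative, so \<open>q a\<close>
  has at most one nonzero component.\<close>

lemma component_socle_finite:
  assumes "s \<in> socle A"
  shows "finite {\<xi> \<in> I. component s \<xi> \<noteq> 0}"
  using assms
proof (induction rule: socle_induct)
  case zero
  show ?case by (simp add: component_zero)
next
  case (add s t)
  have "{\<xi> \<in> I. component (s + t) \<xi> \<noteq> 0} \<subseteq> {\<xi> \<in> I. component s \<xi> \<noteq> 0} \<union> {\<xi> \<in> I. component t \<xi> \<noteq> 0}"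
    by (auto simp: component_add)
  then show ?case using add by (meson finite_UnI finite_subset)
next
  case (ideal q a)
  obtain \<xi> where \<xi>: "\<xi> \<in> I" "equivalent q (r \<xi>)" using represented[OF ideal(1)] by blast
  have "\<eta> = \<xi>" if "\<eta> \<in> I" "component (q o\<^sub>L a) \<eta> \<noteq> 0" for \<eta>
  proof (rule ccontr)
    assume "\<eta> \<noteq> \<xi>"
    have "equivalent q (r \<eta>)" using component_ideal_zero[OF ideal that(1)] that(2) by blast
    then have "equivalent (r \<eta>) (r \<xi>)"
      using equivalent_sym equivalent_trans ideal(1) r_minimal that(1) \<xi> by blast
    then show False using inequivalent[OF that(1) \<xi>(1)] \<open>\<eta> \<noteq> \<xi>\<close> by blast
  qed
  then have "{\<eta> \<in> I. component (q o\<^sub>L a) \<eta> \<noteq> 0} \<subseteq> {\<xi>}" by blast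
  then show ?case using finite_subset by blast
qed

lemma component_c0:
  assumes a: "a \<in> A"
  shows "component a \<in> c0_sum_compacts I orbit"
  unfolding c0_sum_compacts_def
proof (intro CollectI conjI ballI allI impI)
  show "component a \<xi> \<in> compact_operators_on (orbit \<xi>)" if "\<xi> \<in> I" for \<xi>
    using component_compact_on[OF a that] .
  show "component a \<xi> = 0" if "\<xi> \<notin> I" for \<xi> using that by (simp add: component_def)
  fix \<epsilon> :: real assume "\<epsilon> > 0"
  then obtain s where s: "s \<in> socle A" "norm (a - s) < \<epsilon>" using socle_approximation a by blast
  have "{\<xi> \<in> I. \<epsilon> \<le> norm (component a \<xi>)} \<subseteq> {\<xi> \<in> I. component s \<xi> \<noteq> 0}"
  proof safe
    fix \<xi> assume \<xi>: "\<xi> \<in> I" "\<epsilon> \<le> norm (component a \<xi>)" "component s \<xi> = 0"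
    have "norm (component a \<xi>) \<le> norm (a - s)"
      using norm_component_le[of "a - s" \<xi>] \<xi>(3) by (simp add: component_diff)
    then show False using \<xi>(2) s(2) by simp
  qed
  then show "finite {\<xi> \<in> I. \<epsilon> \<le> norm (component a \<xi>)}"
    using component_socle_finite[OF s(1)] finite_subset by blast
qed

section \<open>Surjectivity onto the direct sum\<close>

lemma component_limit:
  assumes a: "\<And>n. a n \<in> A"
    and close: "\<And>n \<xi>. \<xi> \<in> I \<Longrightarrow> norm (component (a n) \<xi> - f \<xi>) \<le> 1 / real (Suc n)"
  shows "\<exists>b\<in>A. \<forall>\<xi>\<in>I. component b \<xi> = f \<xi>"
proof -
  \<comment> \<open>Both \<open>a m\<close> and \<open>a n\<close> have components close to
    \<open>f\<close>, uniformly in the index; \<open>norm_le_components\<close> turns this into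
    closeness in \<open>A\<close>, so completeness provides the limit.\<close>
  have diff: "norm (a m - a n) \<le> 1 / real (Suc m) + 1 / real (Suc n)" for m n
  proof (rule norm_le_components[OF diff_in[OF a a]])
    fix \<xi> assume \<xi>: "\<xi> \<in> I"
    have "component (a m - a n) \<xi> = (component (a m) \<xi> - f \<xi>) - (component (a n) \<xi> - f \<xi>)"
      by (simp add: component_diff)
    then have "norm (component (a m - a n) \<xi>) \<le> norm (component (a m) \<xi> - f \<xi>) + norm (component (a n) \<xi> - f \<xi>)"
      by (simp only: norm_triangle_ineq4)
    then show "norm (component (a m - a n) \<xi>) \<le> 1 / real (Suc m) + 1 / real (Suc n)"
      using close[OF \<xi>, of m] close[OF \<xi>, of n] by linarith
  qed simp
  have "Cauchy a"
  proof (rule CauchyI)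
    fix \<epsilon> :: real assume "\<epsilon> > 0"
    then obtain N where N: "1 / real (Suc N) < \<epsilon> / 2" using nat_approx_posE[of "\<epsilon> / 2"] by auto
    have "norm (a m - a n) < \<epsilon>" if "m \<ge> N" "n \<ge> N" for m n
    proof -
      have "1 / real (Suc m) \<le> 1 / real (Suc N)" "1 / real (Suc n) \<le> 1 / real (Suc N)"
        using that by (auto intro!: divide_left_mono)
      then show ?thesis using diff[of m n] N by linarith
    qed
    then show "\<exists>N. \<forall>m\<ge>N. \<forall>n\<ge>N. norm (a m - a n) < \<epsilon>" by blast
  qed
  then obtain b where b: "a \<longlonglongrightarrow> b" using Cauchy_convergent_iff convergent_def by blast
  have bA: "b \<in> A" by (rule closed_sequentially[OF closed a b])
  have "component b \<xi> = f \<xi>" if \<xi>: "\<xi> \<in> I" for \<xi>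
  proof (rule LIMSEQ_unique)
    show "(\<lambda>n. component (a n) \<xi>) \<longlonglongrightarrow> component b \<xi>"
      using \<xi> b unfolding component_def by (simp add: tendsto_compose_op)
    show "(\<lambda>n. component (a n) \<xi>) \<longlonglongrightarrow> f \<xi>"
    proof (rule LIM_zero_cancel, rule tendsto_0_le[where K = 1])
      show "(\<lambda>n. 1 / real (Suc n)) \<longlonglongrightarrow> 0" by (rule LIMSEQ_Suc[OF lim_1_over_n])
      show "\<forall>\<^sub>F n in sequentially. norm (component (a n) \<xi> - f \<xi>) \<le> norm (1 / real (Suc n)) * 1"
        using close[OF \<xi>] by simp
    qed
  qed
  then show ?thesis using bA by blast
qed

text \<open>On \<open>orbit \<xi>\<close> the projection \<open>r \<xi>\<close> acts as the rank one
  projection onto \<open>\<xi>\<close>; framed by \<open>b\<close> and \<open>adj d\<close> it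
  becomes x |-> <x, d \<xi>> b \<xi>. Inequivalence kills the other components.\<close>

lemma rank_one_component:
  assumes \<xi>: "\<xi> \<in> I" and v: "v \<in> orbit \<xi>" and w: "w \<in> orbit \<xi>"
  shows "\<exists>a\<in>A. (\<forall>\<eta>\<in>I. \<eta> \<noteq> \<xi> \<longrightarrow> component a \<eta> = 0) \<and>
    (\<forall>x. blinfun_apply (component a \<xi>) x = cinner x w *\<^sub>C v)"
proof -
  obtain b d where bd: "b \<in> A" "d \<in> A" "v = blinfun_apply b \<xi>" "w = blinfun_apply d \<xi>"
    using v w by (auto simp: orbit_def)
  define a where "a = b o\<^sub>L r \<xi> o\<^sub>L adj d"
  have aA: "a \<in> A" unfolding a_def using bd r_in[OF \<xi>] adj_in compose_in by blast
  have "component a \<eta> = 0" if \<eta>: "\<eta> \<in> I" "\<eta> \<noteq> \<xi>" for \<eta>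
  proof (rule blinfun_eqI)
    fix x
    obtain c where c: "c \<in> A" "blinfun_apply (proj \<eta>) x = blinfun_apply c \<eta>"
      using proj_in[OF \<eta>(1), of x] by (auto simp: orbit_def)
    have "blinfun_apply (r \<xi>) (blinfun_apply (adj d o\<^sub>L c) \<eta>) = 0"
      using r_corner_zero[OF \<xi> \<eta>(1) \<eta>(2)[symmetric] _ r_fix[OF \<eta>(1)]] compose_in adj_in bd(2) c(1)
      by blast
    then show "blinfun_apply (component a \<eta>) x = blinfun_apply 0 x"
      by (simp add: component_apply \<eta>(1) c(2) a_def)
  qed
  moreover have "blinfun_apply (component a \<xi>) x = cinner x w *\<^sub>C v" for x
  proof -
    obtain c where c: "c \<in> A" "blinfun_apply (proj \<xi>) x = blinfun_apply c \<xi>"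
      using proj_in[OF \<xi>, of x] by (auto simp: orbit_def)
    have "blinfun_apply (r \<xi>) (blinfun_apply (adj d o\<^sub>L c) \<xi>) =
        cinner (blinfun_apply (adj d o\<^sub>L c) \<xi>) \<xi> *\<^sub>C \<xi>"
      using \<xi> bd(2) c(1) by (intro r_corner compose_in adj_in r_fix) auto
    also have "cinner (blinfun_apply (adj d o\<^sub>L c) \<xi>) \<xi> = cinner (blinfun_apply (proj \<xi>) x) w"
      by (simp add: cinner_adj_left in_bounded bd(2,4) c(2))
    also have "\<dots> = cinner x w"
      using projection_cinner[OF proj_projection[OF \<xi>]] proj_id[OF \<xi> w] by simp
    finally have "blinfun_apply (r \<xi>) (blinfun_apply (adj d) (blinfun_apply c \<xi>)) = cinner x w *\<^sub>C \<xi>" by simp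
    then show ?thesis
      using bounded_operators_scaleC[OF in_bounded[OF bd(1)]]
      by (simp add: component_apply \<xi> c(2) a_def bd(3))
  qed
  ultimately show ?thesis using aA by blast
qed

text \<open>Each coefficient <K x, e> must be written as the inner product of \<open>x\<close> with
  an orbit vector. As \<open>K\<close> vanishes on the orthogonal complement,
  \<open>K = K P\<close>, and \<open>P (adj K e)\<close> is that vector.\<close>

lemma finite_rank_component:
  assumes \<xi>: "\<xi> \<in> I" and K: "K \<in> compact_operators_on (orbit \<xi>)" and E: "finite E" "E \<subseteq> orbit \<xi>"
  shows "\<exists>a\<in>A. (\<forall>\<eta>\<in>I. \<eta> \<noteq> \<xi> \<longrightarrow> component a \<eta> = 0) \<and>
    (\<forall>x. blinfun_apply (component a \<xi>) x = (\<Sum>e\<in>E. cinner (blinfun_apply K x) e *\<^sub>C e))"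
proof -
  have Kb: "K \<in> bounded_operators" and K0: "\<And>x. \<forall>y\<in>orbit \<xi>. cinner x y = 0 \<Longrightarrow> blinfun_apply K x = 0"
    using K by (auto simp: compact_operators_on_def compact_operator_def)
  define P where "P = proj \<xi>"
  have P: "is_projection P" "\<And>x. blinfun_apply P x \<in> orbit \<xi>" "\<And>x. x \<in> orbit \<xi> \<Longrightarrow> blinfun_apply P x = x"
    unfolding P_def using \<xi> proj_projection proj_in proj_id by auto
  have KP: "blinfun_apply K x = blinfun_apply K (blinfun_apply P x)" for x
  proof -
    have "cinner (x - blinfun_apply P x) y = 0" if "y \<in> orbit \<xi>" for y
      using projection_cinner[OF P(1), of x y] P(3)[OF that] by (simp add: cinner_diff_left)
    then have "blinfun_apply K (x - blinfun_apply P x) = 0" using K0 by blast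
    then show ?thesis by (simp add: blinfun.diff_right)
  qed
  have coeff: "cinner (blinfun_apply K x) e = cinner x (blinfun_apply P (blinfun_apply (adj K) e))" for x e
  proof -
    have "cinner (blinfun_apply K x) e = cinner (blinfun_apply K (blinfun_apply P x)) e"
      using KP[of x] by simp
    also have "\<dots> = cinner x (blinfun_apply P (blinfun_apply (adj K) e))"
      by (simp only: cinner_adj_right[OF Kb, symmetric] projection_cinner[OF P(1)])
    finally show ?thesis .
  qed
  have "\<forall>e\<in>E. \<exists>a. a \<in> A \<and> (\<forall>\<eta>\<in>I. \<eta> \<noteq> \<xi> \<longrightarrow> component a \<eta> = 0) \<and>
    (\<forall>x. blinfun_apply (component a \<xi>) x = cinner (blinfun_apply K x) e *\<^sub>C e)"
    using rank_one_component[OF \<xi> _ P(2)] E(2) unfolding coeff by blast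
  from bchoice[OF this] obtain a where a: "\<And>e. e \<in> E \<Longrightarrow> a e \<in> A"
      "\<And>e \<eta>. e \<in> E \<Longrightarrow> \<eta> \<in> I \<Longrightarrow> \<eta> \<noteq> \<xi> \<Longrightarrow> component (a e) \<eta> = 0"
      "\<And>e x. e \<in> E \<Longrightarrow> blinfun_apply (component (a e) \<xi>) x = cinner (blinfun_apply K x) e *\<^sub>C e"
    by blast
  show ?thesis
    using a sum_in[of E a] by (intro bexI[of _ "sum a E"]) (auto simp: component_sum blinfun.sum_left)
qed

text \<open>Finite rank approximations of \<open>K\<close> with error 1/(n+1) come from
  \<open>A\<close>; \<open>component_limit\<close> passes to \<open>K\<close>.\<close>

lemma compact_component:
  assumes \<xi>: "\<xi> \<in> I" and K: "K \<in> compact_operators_on (orbit \<xi>)"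
  shows "\<exists>a\<in>A. \<forall>\<eta>\<in>I. component a \<eta> = (if \<eta> = \<xi> then K else 0)"
proof -
  have "\<exists>a. a \<in> A \<and> (\<forall>\<eta>\<in>I. norm (component a \<eta> - (if \<eta> = \<xi> then K else 0)) \<le> 1 / real (Suc n))" for n
  proof -
    have "\<exists>E. finite E \<and> E \<subseteq> orbit \<xi> \<and> (\<forall>x. norm (blinfun_apply K x -
        (\<Sum>e\<in>E. cinner (blinfun_apply K x) e *\<^sub>C e)) \<le> 1 / real (Suc n) * norm x)"
      using K orbit_csubspace closed_orbit[OF \<xi>]
      by (intro compact_operator_finite_rank) (auto simp: compact_operators_on_def)
    then obtain E where E: "finite E" "E \<subseteq> orbit \<xi>" "\<And>x. norm (blinfun_apply K x -
        (\<Sum>e\<in>E. cinner (blinfun_apply K x) e *\<^sub>C e)) \<le> 1 / real (Suc n) * norm x" by blast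
    obtain a where a: "a \<in> A" "\<And>\<eta>. \<eta> \<in> I \<Longrightarrow> \<eta> \<noteq> \<xi> \<Longrightarrow> component a \<eta> = 0"
        "\<And>x. blinfun_apply (component a \<xi>) x = (\<Sum>e\<in>E. cinner (blinfun_apply K x) e *\<^sub>C e)"
      using finite_rank_component[OF \<xi> K E(1,2)] by blast
    have "norm (component a \<xi> - K) \<le> 1 / real (Suc n)"
      using E(3) by (intro norm_blinfun_bound) (simp_all add: blinfun.diff_left a(3) norm_minus_commute)
    then show ?thesis using a(1,2) by (intro exI[of _ a]) auto
  qed
  then have "\<forall>n. \<exists>a. a \<in> A \<and>
      (\<forall>\<eta>\<in>I. norm (component a \<eta> - (if \<eta> = \<xi> then K else 0)) \<le> 1 / real (Suc n))" by blast
  from choice[OF this] obtain a where "\<And>n. a n \<in> A"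
    "\<And>n \<eta>. \<eta> \<in> I \<Longrightarrow> norm (component (a n) \<eta> - (if \<eta> = \<xi> then K else 0)) \<le> 1 / real (Suc n)" by blast
  then show ?thesis by (rule component_limit)
qed

text \<open>Truncation to the finitely many indices with \<open>norm (f \<xi>)\<close> at least
  1/(n+1) leaves a uniform error below 1/(n+1), and each truncation is a finite sum of elements
  supported at one index.\<close>

lemma c0_component:
  assumes f: "f \<in> c0_sum_compacts I orbit"
  shows "\<exists>a\<in>A. component a = f"
proof -
  have f': "\<And>\<xi>. \<xi> \<in> I \<Longrightarrow> f \<xi> \<in> compact_operators_on (orbit \<xi>)" "\<And>\<xi>. \<xi> \<notin> I \<Longrightarrow> f \<xi> = 0"
      "\<And>\<epsilon>. \<epsilon> > 0 \<Longrightarrow> finite {\<xi> \<in> I. norm (f \<xi>) \<ge> \<epsilon>}"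
    using f by (auto simp: c0_sum_compacts_def)
  have "\<forall>\<xi>\<in>I. \<exists>a. a \<in> A \<and> (\<forall>\<eta>\<in>I. component a \<eta> = (if \<eta> = \<xi> then f \<xi> else 0))"
    using compact_component f'(1) by blast
  from bchoice[OF this] obtain b where b: "\<And>\<xi>. \<xi> \<in> I \<Longrightarrow> b \<xi> \<in> A"
    "\<And>\<xi> \<eta>. \<xi> \<in> I \<Longrightarrow> \<eta> \<in> I \<Longrightarrow> component (b \<xi>) \<eta> = (if \<eta> = \<xi> then f \<xi> else 0)" by blast
  define F where "F n = {\<xi> \<in> I. norm (f \<xi>) \<ge> 1 / real (Suc n)}" for n
  define g where "g n = sum b (F n)" for n
  have gA: "g n \<in> A" for n unfolding g_def using b(1) by (intro sum_in) (auto simp: F_def)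
  have "norm (component (g n) \<eta> - f \<eta>) \<le> 1 / real (Suc n)" if \<eta>: "\<eta> \<in> I" for n \<eta>
  proof -
    have fin: "finite (F n)" unfolding F_def by (rule f'(3)) simp
    have "component (g n) \<eta> = (\<Sum>\<xi>\<in>F n. if \<eta> = \<xi> then f \<xi> else 0)"
      unfolding g_def component_sum using b(2) \<eta> by (intro sum.cong) (auto simp: F_def)
    also have "\<dots> = (if \<eta> \<in> F n then f \<eta> else 0)" using fin by simp
    finally show ?thesis using \<eta> by (auto simp: F_def)
  qed
  then have "\<exists>a\<in>A. \<forall>\<xi>\<in>I. component a \<xi> = f \<xi>" by (rule component_limit[of g f, OF gA])
  then obtain a where a: "a \<in> A" "\<And>\<xi>. \<xi> \<in> I \<Longrightarrow> component a \<xi> = f \<xi>" by blast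
  have "component a \<xi> = f \<xi>" for \<xi> using a(2) f'(2) by (cases "\<xi> \<in> I") (auto simp: component_def)
  then show ?thesis using a(1) by blast
qed

lemma component_inj: "inj_on component A"
proof (rule inj_onI)
  fix a b assume ab: "a \<in> A" "b \<in> A" "component a = component b"
  have "norm (a - b) \<le> 0"
  proof (rule norm_le_components[OF diff_in[OF ab(1,2)]])
    show "norm (component (a - b) \<xi>) \<le> 0" for \<xi>
      unfolding component_diff ab(3) by simp
  qed simp
  then show "a = b" by simp
qed

lemma c0_matrix_norm_component:
  assumes T: "\<And>i j. i < n \<Longrightarrow> j < n \<Longrightarrow> T i j \<in> A"
  shows "c0_matrix_norm I n (\<lambda>j k. component (T j k)) = matrix_norm n T"
proof -
  let ?S = "insert 0 ((\<lambda>\<xi>. matrix_norm n (\<lambda>j k. component (T j k) \<xi>)) ` I)"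
  have le: "z \<le> matrix_norm n T" if "z \<in> ?S" for z
    using that matrix_norm_component_le matrix_norm_nonneg by auto
  then have bdd: "bdd_above ?S" by (rule bdd_aboveI)
  have "Sup ?S \<le> matrix_norm n T" using le by (intro cSup_least) auto
  moreover have "matrix_norm n T \<le> Sup ?S"
    using T by (rule matrix_norm_le_components) (auto intro!: cSup_upper bdd)
  ultimately show ?thesis unfolding c0_matrix_norm_def by simp
qed

lemma completely_isometric_isomorphism_component:
  "completely_isometric_isomorphism_c0 A I orbit component"
  unfolding completely_isometric_isomorphism_c0_def
proof (intro conjI ballI allI impI)
  show "bij_betw component A (c0_sum_compacts I orbit)"
    unfolding bij_betw_def using component_inj component_c0 c0_component by blast
  show "component (a + b) = (\<lambda>i. component a i + component b i)" for a b
    by (rule ext) (rule component_add)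
  show "component (c *\<^sub>C a) = (\<lambda>i. c *\<^sub>C component a i)" for c a
    by (rule ext) (rule component_scaleC)
  show "component (a o\<^sub>L b) = (\<lambda>i. component a i o\<^sub>L component b i)" if "b \<in> A" for a b
    by (rule ext) (rule component_compose[OF that])
  show "c0_matrix_norm I n (\<lambda>j k. component (a j k)) = matrix_norm n a"
    if "\<forall>j<n. \<forall>k<n. a j k \<in> A" for n a
    using that by (intro c0_matrix_norm_component) blast
qed

end

lemma (in dense_socle_algebra) completely_isometric_to_annihilator:
  "completely_isometric_to_annihilator_Cstar_algebra A"
proof -
  obtain I r where Ir: "\<forall>\<xi>\<in>I. minimal_projection (r \<xi>) \<and> norm \<xi> = 1 \<and> blinfun_apply (r \<xi>) \<xi> = \<xi>"
      "\<forall>\<xi>\<in>I. \<forall>\<eta>\<in>I. \<xi> \<noteq> \<eta> \<longrightarrow> \<not> equivalent (r \<xi>) (r \<eta>)"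
      "\<forall>q. minimal_projection q \<longrightarrow> (\<exists>\<xi>\<in>I. equivalent q (r \<xi>))"
    using representatives_exist by blast
  interpret represented_algebra A I r
    by unfold_locales (use Ir in auto)
  show ?thesis
    unfolding completely_isometric_to_annihilator_Cstar_algebra_def
    using completely_isometric_isomorphism_component orbit_csubspace closed_orbit by blast
qed

theorem theorem5p1:
  fixes A :: "('h :: complex_hilbert_space \<Rightarrow>\<^sub>L 'h) set"
  assumes "operator_algebra A" and "semiprime A" and "approximately_unital A"
  shows "(\<forall>J. minimal_right_ideal A J \<longrightarrow>
            (has_left_cai J \<longleftrightarrow> (\<exists>p\<in>A. is_projection p \<and> J = {p o\<^sub>L a | a. a \<in> A})))
       \<and> ((\<forall>J. minimal_right_ideal A J \<longrightarrow> has_left_cai J) \<longleftrightarrow>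
          (\<forall>e. algebraically_minimal_idempotent A e \<longrightarrow> (\<exists>p\<in>A. is_range_projection p e)))
       \<and> (((\<forall>J. minimal_right_ideal A J \<longrightarrow> has_left_cai J) \<or>
           (\<forall>e. algebraically_minimal_idempotent A e \<longrightarrow> (\<exists>p\<in>A. is_range_projection p e)))
          \<and> closure (socle A) = A
          \<longrightarrow> completely_isometric_to_annihilator_Cstar_algebra A)"
proof -
  interpret semiprime_operator_algebra A
    using assms by unfold_locales
  have "completely_isometric_to_annihilator_Cstar_algebra A"
    if rp: "\<forall>e. algebraically_minimal_idempotent A e \<longrightarrow> (\<exists>p\<in>A. is_range_projection p e)"
      and dense: "closure (socle A) = A"
  proof -
    interpret dense_socle_algebra A
      by unfold_locales (use rp dense in auto)
    show ?thesis by (rule completely_isometric_to_annihilator)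
  qed
  then show ?thesis
    using left_cai_iff_projection left_cai_iff_range_projection by blast
qed

end
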